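(* Let $\mathcal{H}_S$ and $\mathcal{H}_E$ be finite-dimensional Hilbert spaces with $d_S=\dim\mathcal{H}_S$, and let $\mathcal{S}$ be a nonempty set of density operators on $\mathcal{H}_S\otimes\mathcal{H}_E$. Let $\mathcal{S}'=\{\rho_{SE}^{(1)},\dots,\rho_{SE}^{(m)}\}\subseteq\mathcal{S}$ be a maximal linearly independent subset of $\mathcal{S}$, and assume that the reduced states $\rho_S^{(i)}=\mathrm{Tr}_E(\rho_{SE}^{(i)})$, $i=1,\dots,m$, are also linearly independent (so $m\le d_S^2$). Put $\mathcal{V}=\mathrm{Span}_{\mathbb{C}}\mathcal{S}$ and $\mathcal{V}_S=\mathrm{Tr}_E\mathcal{V}=\mathrm{Span}_{\mathbb{C}}\{\rho_S^{(1)},\dots,\rho_S^{(m)}\}$. Define the reference state $$\omega_{RSE}=\sum_{l=1}^m\frac1m\,|l_R\rangle\langle l_R|\otimes\rho_{SE}^{(l)}\in\mathcal{D}(\mathcal{H}_R\otimes\mathcal{H}_S\otimes\mathcal{H}_E),$$ where $\{|l_R\rangle\}_{l=1}^m$ is an orthonormal basis of an auxiliary Hilbert space $\mathcal{H}_R$. Suppose there exists a linear, trace-preserving, positive map $\Lambda_S^{(P)}:\mathcal{L}(\mathcal{H}_S)\to\mathcal{L}(\mathcal{H}_S\otimes\mathcal{H}_E)$ that maps $\mathcal{V}_S$ to $\mathcal{V}$, i.e. $\Lambda_S^{(P)}(\rho_S^{(i)})=\rho_{SE}^{(i)}$ for $i=1,\dots,m$ (equivalently $\Lambda_S^{(P)}(\mathrm{Tr}_E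 X)=X$ for all $X\in\mathcal{V}$). Then: (i) $\omega_{RSE}$ is a Markov state; (ii) there exists a linear, trace-preserving, completely positive map $\Lambda_S^{(CP)}:\mathcal{L}(\mathcal{H}_S)\to\mathcal{L}(\mathcal{H}_S\otimes\mathcal{H}_E)$ with $\Lambda_S^{(CP)}(\rho_S^{(i)})=\rho_{SE}^{(i)}$ for all $i=1,\dots,m$; (iii) $\mathrm{Tr}_E(\mathcal{D}(\mathcal{H}_S\otimes\mathcal{H}_E)\cap\mathcal{V})=\mathcal{D}(\mathcal{H}_S)\cap\mathcal{V}_S$, and for every unitary $U$ on $\mathcal{H}_S\otimes\mathcal{H}_E$ the map $\mathcal{E}_S=\mathrm{Tr}_E\circ\mathrm{Ad}_U\circ\Lambda_S^{(CP)}$ (where $\mathrm{Ad}_U(X)=UXU^\dagger$) is completely positive and satisfies $\mathcal{E}_S(\mathrm{Tr}_E\rho_{SE})=\mathrm{Tr}_E(U\rho_{SE}U^\dagger)$ for every $\rho_{SE}\in\mathcal{D}(\mathcal{H}_S\otimes\mathcal{H}_E)\cap\mathcal{V}$.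
   Context: $\mathcal{L}(\mathcal{H})$ denotes the linear operators on $\mathcal{H}$ and $\mathcal{D}(\mathcal{H})$ the density operators. A positive map sends positive semidefinite operators to positive semidefinite operators; completely positive means $\mathrm{id}_k\otimes\Phi$ is positive for all $k$. A tripartite state $\sigma_{RSE}\in\mathcal{D}(\mathcal{H}_R\otimes\mathcal{H}_S\otimes\mathcal{H}_E)$ is a Markov state if there is a decomposition $\mathcal{H}_S=\bigoplus_k\mathcal{H}_{s_k^L}\otimes\mathcal{H}_{s_k^R}$ (orthogonal direct sum) such that $\sigma_{RSE}=\bigoplus_k\lambda_k\,\sigma_{Rs_k^L}\otimes\sigma_{s_k^RE}$ with $\{\lambda_k\}$ a probability distribution, $\sigma_{Rs_k^L}\in\mathcal{D}(\mathcal{H}_R\otimes\mathcal{H}_{s_k^L})$ and $\sigma_{s_k^RE}\in\mathcal{D}(\mathcal{H}_{s_k^R}\otimes\mathcal{H}_E)$. *)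

theory Defs
  imports "Jordan_Normal_Form.Schur_Decomposition"
begin

text \<open>Finite-dimensional Hilbert spaces are modelled as C^n; operators as complex n x n
  matrices (Jordan_Normal_Form). Tensor products use the Kronecker ordering:
  basis vector (i,j) of C^a (x) C^b has index i*b + j.\<close>

definition mtrace :: "complex mat \<Rightarrow> complex" where
  "mtrace A = (\<Sum>i<dim_row A. A $$ (i,i))"

text \<open>positive semidefinite operator on C^n: v^dagger A v is a nonnegative real
  (order on complex from HOL-Library.Complex_Order)\<close>
definition psd :: "nat \<Rightarrow> complex mat \<Rightarrow> bool" where
  "psd n A \<longleftrightarrow> A \<in> carrier_mat n n \<and> (\<forall>v\<in>carrier_vec n. 0 \<le> (A *\<^sub>v v) \<bullet>c v)"

definition density :: "nat \<Rightarrow> complex mat set" where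
  "density n = {A. psd n A \<and> mtrace A = 1}"

definition kron :: "complex mat \<Rightarrow> complex mat \<Rightarrow> complex mat" where
  "kron A B = mat (dim_row A * dim_row B) (dim_col A * dim_col B)
     (\<lambda>(i,j). A $$ (i div dim_row B, j div dim_col B) * B $$ (i mod dim_row B, j mod dim_col B))"

definition ptrace_E :: "nat \<Rightarrow> nat \<Rightarrow> complex mat \<Rightarrow> complex mat" where
  "ptrace_E dS dE X = mat dS dS (\<lambda>(i,j). \<Sum>k<dE. X $$ (i*dE+k, j*dE+k))"

definition msum :: "nat \<Rightarrow> nat \<Rightarrow> (nat \<Rightarrow> complex mat) \<Rightarrow> complex mat" where
  "msum N K f = mat N N (\<lambda>(i,j). \<Sum>k<K. f k $$ (i,j))"

definition lincomb :: "nat \<Rightarrow> (nat \<Rightarrow> complex) \<Rightarrow> complex mat list \<Rightarrow> complex mat" where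
  "lincomb N c l = mat N N (\<lambda>(i,j). \<Sum>k<length l. c k * (l!k) $$ (i,j))"

definition cspan :: "nat \<Rightarrow> complex mat set \<Rightarrow> complex mat set" where
  "cspan N A = {lincomb N c l | c l. set l \<subseteq> A}"

definition lin_indep :: "nat \<Rightarrow> complex mat list \<Rightarrow> bool" where
  "lin_indep N l \<longleftrightarrow> set l \<subseteq> carrier_mat N N \<and>
     (\<forall>c. lincomb N c l = 0\<^sub>m N N \<longrightarrow> (\<forall>k<length l. c k = 0))"

definition max_lin_indep_subset :: "nat \<Rightarrow> complex mat set \<Rightarrow> complex mat list \<Rightarrow> bool" where
  "max_lin_indep_subset N S l \<longleftrightarrow> set l \<subseteq> S \<and> lin_indep N l \<and>
     (\<forall>X\<in>S. X \<notin> set l \<longrightarrow> \<not> lin_indep N (l @ [X]))"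

definition lin_map :: "nat \<Rightarrow> nat \<Rightarrow> (complex mat \<Rightarrow> complex mat) \<Rightarrow> bool" where
  "lin_map n m \<Phi> \<longleftrightarrow> (\<forall>A\<in>carrier_mat n n. \<Phi> A \<in> carrier_mat m m) \<and>
     (\<forall>A\<in>carrier_mat n n. \<forall>B\<in>carrier_mat n n. \<Phi> (A + B) = \<Phi> A + \<Phi> B) \<and>
     (\<forall>c. \<forall>A\<in>carrier_mat n n. \<Phi> (c \<cdot>\<^sub>m A) = c \<cdot>\<^sub>m \<Phi> A)"

definition trace_pres :: "nat \<Rightarrow> (complex mat \<Rightarrow> complex mat) \<Rightarrow> bool" where
  "trace_pres n \<Phi> \<longleftrightarrow> (\<forall>A\<in>carrier_mat n n. mtrace (\<Phi> A) = mtrace A)"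

definition positive_map :: "nat \<Rightarrow> nat \<Rightarrow> (complex mat \<Rightarrow> complex mat) \<Rightarrow> bool" where
  "positive_map n m \<Phi> \<longleftrightarrow> (\<forall>A. psd n A \<longrightarrow> psd m (\<Phi> A))"

definition mblock :: "nat \<Rightarrow> complex mat \<Rightarrow> nat \<Rightarrow> nat \<Rightarrow> complex mat" where
  "mblock n X a b = mat n n (\<lambda>(p,q). X $$ (a*n+p, b*n+q))"

text \<open>id_k (x) Phi acting on L(C^k (x) C^n)\<close>
definition ampl :: "nat \<Rightarrow> nat \<Rightarrow> nat \<Rightarrow> (complex mat \<Rightarrow> complex mat) \<Rightarrow> complex mat \<Rightarrow> complex mat" where
  "ampl k n m \<Phi> X = mat (k*m) (k*m)
     (\<lambda>(i,j). \<Phi> (mblock n X (i div m) (j div m)) $$ (i mod m, j mod m))"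

definition cp_map :: "nat \<Rightarrow> nat \<Rightarrow> (complex mat \<Rightarrow> complex mat) \<Rightarrow> bool" where
  "cp_map n m \<Phi> \<longleftrightarrow> (\<forall>k X. psd (k*n) X \<longrightarrow> psd (k*m) (ampl k n m \<Phi> X))"

definition unitary_mat :: "nat \<Rightarrow> complex mat \<Rightarrow> bool" where
  "unitary_mat n U \<longleftrightarrow> U \<in> carrier_mat n n \<and>
     U * mat_adjoint U = 1\<^sub>m n \<and> mat_adjoint U * U = 1\<^sub>m n"

text \<open>Markov state on C^dR (x) C^dS (x) C^dE. The orthogonal decomposition
  H_S = (+)_k H_{s_k^L} (x) H_{s_k^R} is given by isometries V k : C^(a k) (x) C^(b k) -> C^dS
  with mutually orthogonal ranges that sum to the identity.\<close>
definition markov_state :: "nat \<Rightarrow> nat \<Rightarrow> nat \<Rightarrow> complex mat \<Rightarrow> bool" where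
  "markov_state dR dS dE \<sigma> \<longleftrightarrow>
    (\<exists>K a b V (lam :: nat \<Rightarrow> real) A B.
       (\<forall>k<K. V k \<in> carrier_mat dS (a k * b k)) \<and>
       (\<forall>k<K. \<forall>l<K. mat_adjoint (V k) * V l =
           (if k = l then 1\<^sub>m (a k * b k) else 0\<^sub>m (a k * b k) (a l * b l))) \<and>
       msum dS K (\<lambda>k. V k * mat_adjoint (V k)) = 1\<^sub>m dS \<and>
       (\<forall>k<K. 0 \<le> lam k) \<and> (\<Sum>k<K. lam k) = 1 \<and>
       (\<forall>k<K. A k \<in> density (dR * a k) \<and> B k \<in> density (b k * dE)) \<and>
       \<sigma> = msum (dR * dS * dE) K (\<lambda>k.
              let W = kron (kron (1\<^sub>m dR) (V k)) (1\<^sub>m dE)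
              in complex_of_real (lam k) \<cdot>\<^sub>m (W * kron (A k) (B k) * mat_adjoint W)))"

definition ketbra :: "nat \<Rightarrow> nat \<Rightarrow> complex mat" where
  "ketbra m l = mat m m (\<lambda>(i,j). if i = l \<and> j = l then 1 else 0)"

definition omega_RSE :: "nat \<Rightarrow> nat \<Rightarrow> complex mat list \<Rightarrow> complex mat" where
  "omega_RSE dS dE rhos = msum (length rhos * dS * dE) (length rhos)
     (\<lambda>l. (1 / of_nat (length rhos)) \<cdot>\<^sub>m kron (ketbra (length rhos) l) (rhos ! l))"

end

theory Submission
  imports Defs "Jordan_Normal_Form.Spectral_Radius"
begin

text \<open>
  Let \<open>\<Sigma>\<close> be the sum of the states \<open>\<rho>\<^sub>i\<close> on SE and \<open>\<sigma>\<close> its marginal on S, with norms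
  \<open>\<parallel>X\<parallel>\<^sub>\<sigma>\<^sup>2 = tr (X \<sigma>\<^bsup>-1/2\<^esup> X \<sigma>\<^bsup>-1/2\<^esup>)\<close> (KMS inner product), and similarly for \<open>\<Sigma>\<close>.
  A positive map carrying \<open>\<sigma>\<close> to \<open>\<Sigma>\<close> whose KMS adjoint carries \<open>\<Sigma>\<close> to \<open>\<sigma>\<close> is a contraction:
  composed with its adjoint it is a self-adjoint map that preserves the order interval
  \<open>[0, \<sigma>]\<close>, so its orbits are bounded. No complete positivity is needed for this.
  The adjoint of the partial trace is the Petz map
  \<open>R X = \<Sigma>\<^bsup>1/2\<^esup> (\<sigma>\<^bsup>-1/2\<^esup> X \<sigma>\<^bsup>-1/2\<^esup> \<otimes> 1) \<Sigma>\<^bsup>1/2\<^esup>\<close>. Contractivity of the given lift and of \<open>R\<close>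
  forces \<open>\<parallel>\<rho>\<^sub>i - R (tr\<^sub>E \<rho>\<^sub>i)\<parallel> = 0\<close>, so the completely positive map \<open>R\<close> recovers every \<open>\<rho>\<^sub>i\<close>.

  For the Markov form, the fixed points of the unital map \<open>\<sigma>\<^bsup>-1/2\<^esup> tr\<^sub>E (\<Sigma>\<^bsup>1/2\<^esup> (\<sqdot> \<otimes> 1) \<Sigma>\<^bsup>1/2\<^esup>) \<sigma>\<^bsup>-1/2\<^esup>\<close>
  lie in the *-algebra of operators on S commuting with \<open>G = \<Sigma>\<^bsup>1/2\<^esup> (\<sigma>\<^bsup>-1/2\<^esup> \<otimes> 1)\<close>.
  This algebra is normalised by \<open>\<Sigma>\<close> and \<open>\<rho>\<^sub>i = (Y\<^sub>i \<otimes> 1) \<Sigma>\<close> with \<open>Y\<^sub>i\<close> in it. Its block decomposition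
  splits S as a direct sum of tensor products, and normalisation makes
  every block of \<open>\<Sigma>\<close> a product across the two factors.
\<close>

text \<open>The given lift is only positive, so it has no Kraus form or dilation to work with. What
  remains is this: positivity with trace preservation gives a positive unital Hilbert-Schmidt dual,
  and conjugating the dual by square roots gives the KMS adjoint, which is positive again. The zero
  distance comes from expanding a square: for x = tr_E \<rho>, the cross term <R x, \<rho>> equals
  <x, x> by adjointness, while both squares are at most <x, x>. The states may be singular. Inverses
  are therefore pseudo-inverses, and every argument stays below \<sigma> or \<Sigma>, which fixes
  its support. The unnormalised sum \<Sigma> dominates each \<rho>_i, so all of them lie in one
  order interval. In the Markov half \<Sigma> need not commute with the algebra; it acts by \<Sigma>
  (Y \<otimes> 1) = (Y' \<otimes> 1) \<Sigma> with Y' = \<sigma> Y \<sigma>^(-1), the inverse being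
  the pseudo-inverse. A positive operator that normalises a full matrix factor in this way is a
  product, and all \<rho>_i share its right factors. The label i is thus correlated with the left
  factors only.\<close>

declare assoc_mult_mat [simp del] index_mult_mat(1) [simp del]

abbreviation adj :: "complex mat \<Rightarrow> complex mat" ("_\<^sup>\<dagger>" [1000] 999)
  where "A\<^sup>\<dagger> \<equiv> mat_adjoint A"

section \<open>Matrix algebra with side conditions on dimensions\<close>

lemma dim_adjoint [simp]: "dim_row (A\<^sup>\<dagger>) = dim_col A" "dim_col (A\<^sup>\<dagger>) = dim_row A"
  by (auto simp: mat_adjoint_def)

lemma index_adjoint [simp]:
  "i < dim_col A \<Longrightarrow> j < dim_row A \<Longrightarrow> (A :: complex mat)\<^sup>\<dagger> $$ (i,j) = cnj (A $$ (j,i))"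
  unfolding mat_adjoint_def by (subst mat_of_rows_index) auto

lemma adjoint_carrier [simp]: "(A\<^sup>\<dagger> \<in> carrier_mat n m) = (A \<in> carrier_mat m n)"
  unfolding carrier_mat_def by auto

lemma adjoint_adjoint [simp]: "(A\<^sup>\<dagger>)\<^sup>\<dagger> = (A :: complex mat)"
  by (rule eq_matI) auto

lemma adjoint_zero [simp]: "(0\<^sub>m n m :: complex mat)\<^sup>\<dagger> = 0\<^sub>m m n"
  by (rule eq_matI) auto

lemma adjoint_one [simp]: "(1\<^sub>m n :: complex mat)\<^sup>\<dagger> = 1\<^sub>m n"
  by (rule eq_matI) auto

lemma adjoint_smult [simp]: "(c \<cdot>\<^sub>m A)\<^sup>\<dagger> = cnj c \<cdot>\<^sub>m (A :: complex mat)\<^sup>\<dagger>"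
  by (rule eq_matI) auto

lemma index_mult_sum:
  "i < dim_row A \<Longrightarrow> j < dim_col B \<Longrightarrow> dim_col A = dim_row B \<Longrightarrow>
    (A * B) $$ (i,j) = (\<Sum>k<dim_row B. A $$ (i,k) * B $$ (k,j))"
  by (auto simp: index_mult_mat(1) scalar_prod_def lessThan_atLeast0)

text \<open>Side conditions in this collection are equations between dimensions, which the
  simplifier can discharge; carrier premises would contain inner dimensions that do not occur in the
  conclusion.\<close>

named_theorems mat_dist

lemma adjoint_mult [mat_dist]:
  "dim_col A = dim_row B \<Longrightarrow> (A * B)\<^sup>\<dagger> = (B :: complex mat)\<^sup>\<dagger> * A\<^sup>\<dagger>"
  by (rule eq_matI) (auto simp: index_mult_sum mult.commute)

lemma adjoint_add [mat_dist]:
  "dim_row A = dim_row B \<Longrightarrow> dim_col A = dim_col B \<Longrightarrow> (A + B)\<^sup>\<dagger> = (A :: complex mat)\<^sup>\<dagger> + B\<^sup>\<dagger>"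
  by (rule eq_matI) auto

lemma adjoint_minus [mat_dist]:
  "dim_row A = dim_row B \<Longrightarrow> dim_col A = dim_col B \<Longrightarrow> (A - B)\<^sup>\<dagger> = (A :: complex mat)\<^sup>\<dagger> - B\<^sup>\<dagger>"
  by (rule eq_matI) auto

lemma mat_assoc [mat_dist]:
  "dim_col A = dim_row B \<Longrightarrow> dim_col B = dim_row C \<Longrightarrow> (A * B) * C = A * (B * (C :: complex mat))"
  by (rule assoc_mult_mat) auto

lemma mat_add_right [mat_dist]:
  "dim_col A = dim_row B \<Longrightarrow> dim_row B = dim_row C \<Longrightarrow> dim_col B = dim_col C \<Longrightarrow>
    A * (B + C) = A * B + A * (C :: complex mat)"
  by (rule mult_add_distrib_mat) auto

lemma mat_add_left [mat_dist]:
  "dim_col A = dim_row C \<Longrightarrow> dim_row A = dim_row B \<Longrightarrow> dim_col A = dim_col B \<Longrightarrow>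
    (A + B) * C = A * C + B * (C :: complex mat)"
  by (rule add_mult_distrib_mat) auto

lemma mat_minus_right [mat_dist]:
  "dim_col A = dim_row B \<Longrightarrow> dim_row B = dim_row C \<Longrightarrow> dim_col B = dim_col C \<Longrightarrow>
    A * (B - C) = A * B - A * (C :: complex mat)"
  by (rule mult_minus_distrib_mat) auto

lemma mat_minus_left [mat_dist]:
  "dim_col A = dim_row C \<Longrightarrow> dim_row A = dim_row B \<Longrightarrow> dim_col A = dim_col B \<Longrightarrow>
    (A - B) * C = A * C - B * (C :: complex mat)"
  by (rule minus_mult_distrib_mat) auto

lemma mat_smult_right [mat_dist]:
  "dim_col A = dim_row B \<Longrightarrow> A * (c \<cdot>\<^sub>m B) = c \<cdot>\<^sub>m (A * (B :: complex mat))"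
  by (rule mult_smult_distrib) auto

lemma mat_smult_left [mat_dist]:
  "dim_col A = dim_row B \<Longrightarrow> (c \<cdot>\<^sub>m A) * B = c \<cdot>\<^sub>m (A * (B :: complex mat))"
  by (rule mult_smult_assoc_mat) auto

lemma mat_smult_smult [mat_dist]: "c \<cdot>\<^sub>m (d \<cdot>\<^sub>m A) = (c * d) \<cdot>\<^sub>m (A :: complex mat)"
  by (rule eq_matI) auto

lemma mat_smult_one [simp]: "1 \<cdot>\<^sub>m A = (A :: complex mat)"
  by (rule eq_matI) auto

lemma mat_minus_self [simp]: "A - A = (0\<^sub>m (dim_row A) (dim_col A) :: complex mat)"
  by (rule eq_matI) auto

lemma mat_minus_zero [simp]: "dim_row A = n \<Longrightarrow> dim_col A = m \<Longrightarrow> A - 0\<^sub>m n m = (A :: complex mat)"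
  by (rule eq_matI) auto

lemma mat_eq_of_minus:
  "A - B = 0\<^sub>m n m \<Longrightarrow> A \<in> carrier_mat n m \<Longrightarrow> B \<in> carrier_mat n m \<Longrightarrow> A = (B :: complex mat)"
  by (rule eq_matI) (auto simp: mat_eq_iff)

section \<open>Traces\<close>

lemma mtrace_mult_comm:
  "A \<in> carrier_mat n m \<Longrightarrow> B \<in> carrier_mat m n \<Longrightarrow> mtrace (A * B) = mtrace (B * A)"
  by (auto simp: mtrace_def index_mult_sum mult.commute intro: sum.swap)

lemma mtrace_add: "A \<in> carrier_mat n n \<Longrightarrow> B \<in> carrier_mat n n \<Longrightarrow> mtrace (A + B) = mtrace A + mtrace B"
  by (auto simp: mtrace_def sum.distrib)

lemma mtrace_minus: "A \<in> carrier_mat n n \<Longrightarrow> B \<in> carrier_mat n n \<Longrightarrow> mtrace (A - B) = mtrace A - mtrace B"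
  by (auto simp: mtrace_def sum_subtractf)

lemma mtrace_smult: "A \<in> carrier_mat n n \<Longrightarrow> mtrace (c \<cdot>\<^sub>m A) = c * mtrace A"
  by (auto simp: mtrace_def sum_distrib_left)

lemma mtrace_one [simp]: "mtrace (1\<^sub>m n) = of_nat n"
  by (simp add: mtrace_def)

lemma mtrace_zero [simp]: "mtrace (0\<^sub>m n n) = 0"
  by (simp add: mtrace_def)

text \<open>The squared Hilbert-Schmidt norm. Being a sum of squares it vanishes only for
  \<open>B = 0\<close>, and most vanishing arguments below end here.\<close>

lemma mtrace_gram:
  assumes "B \<in> carrier_mat m n"
  shows "mtrace (B\<^sup>\<dagger> * B) = of_real (\<Sum>i<n. \<Sum>k<m. (cmod (B $$ (k,i)))\<^sup>2)"
  unfolding of_real_sum complex_norm_square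
  using assms by (auto simp: mtrace_def index_mult_sum mult.commute)

lemma mtrace_gram_eq_0:
  assumes "B \<in> carrier_mat m n" "mtrace (B\<^sup>\<dagger> * B) = 0"
  shows "B = 0\<^sub>m m n"
proof (rule eq_matI)
  have "(\<Sum>i<n. \<Sum>k<m. (cmod (B $$ (k,i)))\<^sup>2) = 0"
    using assms by (simp only: mtrace_gram[OF assms(1)] of_real_eq_0_iff)
  then have *: "\<forall>i<n. \<forall>k<m. B $$ (k,i) = 0"
    by (simp add: sum_nonneg_eq_0_iff sum_nonneg)
  show "B $$ (i,j) = 0\<^sub>m m n $$ (i,j)" if "i < dim_row (0\<^sub>m m n :: complex mat)" "j < dim_col (0\<^sub>m m n :: complex mat)" for i j
    using that * by simp
qed (use assms in auto)

lemma gram_eq_0: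
  assumes "B \<in> carrier_mat m n" "B\<^sup>\<dagger> * B = 0\<^sub>m n n"
  shows "B = 0\<^sub>m m n"
  by (rule mtrace_gram_eq_0[OF assms(1)]) (simp add: assms(2))

section \<open>Finite sums of matrices\<close>

lemma msum_carrier [simp]: "msum N K f \<in> carrier_mat N N" "dim_row (msum N K f) = N" "dim_col (msum N K f) = N"
  by (auto simp: msum_def)

lemma msum_0: "msum N 0 f = 0\<^sub>m N N"
  by (rule eq_matI) (auto simp: msum_def)

lemma msum_Suc: "f K \<in> carrier_mat N N \<Longrightarrow> msum N (Suc K) f = msum N K f + f K"
  by (rule eq_matI) (auto simp: msum_def)

lemma msum_cong: "(\<And>k. k < K \<Longrightarrow> f k = g k) \<Longrightarrow> msum N K f = msum N K g"
  by (auto simp: msum_def)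

lemma msum_single:
  assumes "l < K" "\<And>k. k < K \<Longrightarrow> k \<noteq> l \<Longrightarrow> f k = 0\<^sub>m N N" "f l \<in> carrier_mat N N"
  shows "msum N K f = f l"
proof (rule eq_matI)
  fix i j assume ij: "i < dim_row (f l)" "j < dim_col (f l)"
  have "(\<Sum>k<K. f k $$ (i,j)) = (\<Sum>k<K. if k = l then f l $$ (i,j) else 0)"
    using assms ij by (intro sum.cong) auto
  then show "msum N K f $$ (i,j) = f l $$ (i,j)"
    using assms ij by (simp add: msum_def)
qed (use assms in auto)

lemma msum_sandwich:
  assumes "A \<in> carrier_mat M N" "B \<in> carrier_mat N M" "\<And>k. k < K \<Longrightarrow> f k \<in> carrier_mat N N"
  shows "A * msum N K f * B = msum M K (\<lambda>k. A * f k * B)"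
  using assms(3)
proof (induction K)
  case (Suc K)
  define g where "g = f K"
  have g: "g \<in> carrier_mat N N" using Suc.prems by (simp add: g_def)
  have "msum N (Suc K) f = msum N K f + g"
    using g by (simp add: g_def msum_Suc)
  moreover have "msum M (Suc K) (\<lambda>k. A * f k * B) = msum M K (\<lambda>k. A * f k * B) + A * g * B"
    using g assms(1,2) by (subst msum_Suc) (auto simp: g_def)
  moreover have "A * msum N K f * B = msum M K (\<lambda>k. A * f k * B)"
    using Suc by simp
  ultimately show ?case using assms(1,2) g
    by (simp add: mat_add_left mat_add_right)
qed (use assms in \<open>simp add: msum_0\<close>)

lemma msum_left:
  assumes "A \<in> carrier_mat N N" "\<And>k. k < K \<Longrightarrow> f k \<in> carrier_mat N N"
  shows "A * msum N K f = msum N K (\<lambda>k. A * f k)"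
  using assms(2)
proof (induction K)
  case (Suc K)
  define g where "g = f K"
  have g: "g \<in> carrier_mat N N" using Suc.prems by (simp add: g_def)
  have "msum N (Suc K) f = msum N K f + g"
    using g by (simp add: g_def msum_Suc)
  moreover have "msum N (Suc K) (\<lambda>k. A * f k) = msum N K (\<lambda>k. A * f k) + A * g"
    using g assms(1) by (simp add: g_def msum_Suc)
  moreover have "A * msum N K f = msum N K (\<lambda>k. A * f k)"
    using Suc by simp
  ultimately show ?case using assms(1) g
    by (simp add: mat_add_left mat_add_right)
qed (use assms in \<open>simp add: msum_0\<close>)

lemma msum_right:
  assumes "A \<in> carrier_mat N N" "\<And>k. k < K \<Longrightarrow> f k \<in> carrier_mat N N"
  shows "msum N K f * A = msum N K (\<lambda>k. f k * A)"
  using assms(2)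
proof (induction K)
  case (Suc K)
  define g where "g = f K"
  have g: "g \<in> carrier_mat N N" using Suc.prems by (simp add: g_def)
  have "msum N (Suc K) f = msum N K f + g"
    using g by (simp add: g_def msum_Suc)
  moreover have "msum N (Suc K) (\<lambda>k. f k * A) = msum N K (\<lambda>k. f k * A) + g * A"
    using g assms(1) by (simp add: g_def msum_Suc)
  moreover have "msum N K f * A = msum N K (\<lambda>k. f k * A)"
    using Suc by simp
  ultimately show ?case using assms(1) g
    by (simp add: mat_add_left mat_add_right)
qed (use assms in \<open>simp add: msum_0\<close>)

lemma msum_smult: "(\<And>k. k < K \<Longrightarrow> f k \<in> carrier_mat N N) \<Longrightarrow>
    c \<cdot>\<^sub>m msum N K f = msum N K (\<lambda>k. c \<cdot>\<^sub>m f k)"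
  by (rule eq_matI) (auto simp: msum_def sum_distrib_left carrier_mat_def intro!: sum.cong index_smult_mat(1)[symmetric] simp del: carrier_matD)

lemma mtrace_msum: "(\<And>k. k < K \<Longrightarrow> f k \<in> carrier_mat N N) \<Longrightarrow>
    mtrace (msum N K f) = (\<Sum>k<K. mtrace (f k))"
proof -
  assume f: "\<And>k. k < K \<Longrightarrow> f k \<in> carrier_mat N N"
  have "(\<Sum>k<K. mtrace (f k)) = (\<Sum>k<K. \<Sum>i<N. f k $$ (i,i))"
    using f by (intro sum.cong) (auto simp: mtrace_def)
  then show ?thesis by (simp add: mtrace_def msum_def sum.swap[of _ "{..<N}"])
qed

lemma msum_mem:
  assumes "0\<^sub>m N N \<in> S" "\<And>A B. A \<in> S \<Longrightarrow> B \<in> S \<Longrightarrow> A + B \<in> S" "S \<subseteq> carrier_mat N N"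
    "\<And>k. k < K \<Longrightarrow> f k \<in> S"
  shows "msum N K f \<in> S"
  using assms(4) by (induction K) (use assms in \<open>auto simp: msum_0 msum_Suc subset_iff\<close>)

section \<open>Positive semidefinite matrices\<close>

lemma psd_carrier: "psd n A \<Longrightarrow> A \<in> carrier_mat n n"
  by (simp add: psd_def)

lemma cscalar_eq_column_form:
  assumes "A \<in> carrier_mat n n" "v \<in> carrier_mat n 1"
  shows "(A *\<^sub>v col v 0) \<bullet>c col v 0 = (v\<^sup>\<dagger> * A * v) $$ (0,0)"
proof -
  have "(v\<^sup>\<dagger> * A * v) $$ (0,0) = (v\<^sup>\<dagger> * (A * v)) $$ (0,0)"
    using assms by (simp add: mat_dist)
  also have "\<dots> = (A *\<^sub>v col v 0) \<bullet>c col v 0"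
    using assms by (subst index_mult_sum)
      (auto simp: scalar_prod_def index_mult_sum lessThan_atLeast0 mult.commute intro!: sum.cong)
  finally show ?thesis ..
qed

text \<open>With vectors encoded as one-column matrices, quadratic forms are ordinary products and
  obey the rules of \<open>mat_dist\<close>.\<close>

lemma psd_iff:
  "psd n A \<longleftrightarrow> A \<in> carrier_mat n n \<and> (\<forall>v\<in>carrier_mat n 1. 0 \<le> (v\<^sup>\<dagger> * A * v) $$ (0,0))"
proof -
  have "(\<forall>v\<in>carrier_vec n. 0 \<le> (A *\<^sub>v v) \<bullet>c v) \<longleftrightarrow>
      (\<forall>v\<in>carrier_mat n 1. 0 \<le> (v\<^sup>\<dagger> * A * v) $$ (0,0))" if A: "A \<in> carrier_mat n n"
  proof safe
    fix v :: "complex mat"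
    assume *: "\<forall>v\<in>carrier_vec n. 0 \<le> (A *\<^sub>v v) \<bullet>c v" "v \<in> carrier_mat n 1"
    then have "0 \<le> (A *\<^sub>v col v 0) \<bullet>c col v 0" by auto
    then show "0 \<le> (v\<^sup>\<dagger> * A * v) $$ (0,0)"
      using cscalar_eq_column_form[OF A *(2)] by simp
  next
    fix v :: "complex vec"
    assume *: "\<forall>v\<in>carrier_mat n 1. 0 \<le> (v\<^sup>\<dagger> * A * v) $$ (0,0)" "v \<in> carrier_vec n"
    have "0 \<le> ((mat_of_cols n [v])\<^sup>\<dagger> * A * mat_of_cols n [v]) $$ (0,0)"
      using *(1) by (metis length_Cons list.size(3) mat_of_cols_carrier(1) One_nat_def)
    moreover have "col (mat_of_cols n [v]) 0 = v"
      using *(2) by simp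
    ultimately show "0 \<le> (A *\<^sub>v v) \<bullet>c v"
      using cscalar_eq_column_form[OF A, of "mat_of_cols n [v]"] mat_of_cols_carrier(1)[of n "[v]"] by simp
  qed
  then show ?thesis by (auto simp: psd_def)
qed

lemma psd_gram:
  assumes "B \<in> carrier_mat m n"
  shows "psd n (B\<^sup>\<dagger> * B)"
  unfolding psd_iff
proof (intro conjI ballI)
  fix v :: "complex mat" assume v: "v \<in> carrier_mat n 1"
  have "v\<^sup>\<dagger> * (B\<^sup>\<dagger> * B) * v = (B * v)\<^sup>\<dagger> * (B * v)"
    using assms v by (simp add: mat_dist)
  then have "(v\<^sup>\<dagger> * (B\<^sup>\<dagger> * B) * v) $$ (0,0) = mtrace ((B * v)\<^sup>\<dagger> * (B * v))"
    using v by (simp add: mtrace_def)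
  also have "\<dots> = of_real (\<Sum>i<1. \<Sum>k<m. (cmod ((B * v) $$ (k,i)))\<^sup>2)"
    using assms v by (intro mtrace_gram) auto
  finally show "0 \<le> (v\<^sup>\<dagger> * (B\<^sup>\<dagger> * B) * v) $$ (0,0)"
    by (simp add: less_eq_complex_def sum_nonneg del: of_real_power of_real_sum)
qed (use assms in auto)

lemma psd_zero: "psd n (0\<^sub>m n n)"
  using psd_gram[of "0\<^sub>m n n" n n] by simp

lemma psd_one: "psd n (1\<^sub>m n)"
  using psd_gram[of "1\<^sub>m n" n n] by simp

lemma psd_add: "psd n A \<Longrightarrow> psd n B \<Longrightarrow> psd n (A + B)"
  unfolding psd_iff by (auto simp: mat_add_right mat_add_left)

lemma psd_smult: "psd n A \<Longrightarrow> 0 \<le> c \<Longrightarrow> psd n (c \<cdot>\<^sub>m A)"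
  unfolding psd_iff by (auto simp: mat_smult_right mat_smult_left)

lemma psd_msum: "(\<And>k. k < K \<Longrightarrow> psd N (f k)) \<Longrightarrow> psd N (msum N K f)"
  by (rule msum_mem[where S = "{A. psd N A}", simplified]) (auto simp: psd_zero psd_add psd_carrier)

lemma psd_conj:
  assumes "psd n A" "K \<in> carrier_mat n m"
  shows "psd m (K\<^sup>\<dagger> * A * K)"
  unfolding psd_iff
proof (intro conjI ballI)
  fix v :: "complex mat" assume v: "v \<in> carrier_mat m 1"
  have "v\<^sup>\<dagger> * (K\<^sup>\<dagger> * A * K) * v = (K * v)\<^sup>\<dagger> * A * (K * v)"
    using assms v psd_carrier[OF assms(1)] by (simp add: mat_dist)
  then show "0 \<le> (v\<^sup>\<dagger> * (K\<^sup>\<dagger> * A * K) * v) $$ (0,0)"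
    using assms v by (simp add: psd_iff)
qed (use assms psd_carrier[OF assms(1)] in auto)

lemma psd_conj':
  "psd n A \<Longrightarrow> K \<in> carrier_mat m n \<Longrightarrow> psd m (K * A * K\<^sup>\<dagger>)"
  using psd_conj[of n A "K\<^sup>\<dagger>" m] by simp

text \<open>The standard basis as columns, so that
  \<open>ecol n i * (ecol n j)\<^sup>\<dagger>\<close> is a matrix unit.\<close>

definition ecol :: "nat \<Rightarrow> nat \<Rightarrow> complex mat" where
  "ecol n i = mat n 1 (\<lambda>(k,_). if k = i then 1 else 0)"

lemma ecol_carrier [simp]: "ecol n i \<in> carrier_mat n 1" "dim_row (ecol n i) = n" "dim_col (ecol n i) = 1"
  by (auto simp: ecol_def)

lemma index_ecol: "k < n \<Longrightarrow> ecol n i $$ (k,0) = (if k = i then 1 else 0)"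
  by (simp add: ecol_def)

lemma mult_ecol:
  assumes "A \<in> carrier_mat n m" "j < m" "i < n"
  shows "(A * ecol m j) $$ (i,0) = A $$ (i,j)"
proof -
  have "(A * ecol m j) $$ (i,0) = (\<Sum>k<m. if k = j then A $$ (i,j) else 0)"
    using assms by (subst index_mult_sum) (simp_all add: index_ecol if_distrib[of "(*) _"] cong: if_cong)
  then show ?thesis using assms by simp
qed

lemma ecol_form:
  assumes "A \<in> carrier_mat n m" "i < n" "j < m"
  shows "((ecol n i)\<^sup>\<dagger> * (A * ecol m j)) $$ (0,0) = A $$ (i,j)"
proof -
  have "((ecol n i)\<^sup>\<dagger> * (A * ecol m j)) $$ (0,0) = (\<Sum>k<n. if k = i then A $$ (i,j) else 0)"
    using assms by (subst index_mult_sum) (simp_all add: mult_ecol index_ecol if_distrib[of cnj] if_distrib[of "\<lambda>x. x * _"] cong: if_cong)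
  then show ?thesis using assms by simp
qed

lemma psd_diag:
  assumes "psd n A" "i < n"
  shows "0 \<le> A $$ (i,i)"
proof -
  have A: "A \<in> carrier_mat n n" by (rule psd_carrier[OF assms(1)])
  have "0 \<le> ((ecol n i)\<^sup>\<dagger> * A * ecol n i) $$ (0,0)"
    using assms(1) ecol_carrier(1) unfolding psd_iff by blast
  then show ?thesis using A assms(2) by (simp add: mat_assoc ecol_form)
qed

lemma psd_mtrace: "psd n A \<Longrightarrow> 0 \<le> mtrace A"
  using psd_carrier[of n A] by (auto simp: mtrace_def intro!: sum_nonneg psd_diag)

text \<open>Polarisation: the form is real at e_i + c e_j. Taking c = 1 compares the imaginary parts
  of the two off-diagonal entries, c = \<i> their real parts.\<close>

lemma psd_hermitian:
  assumes "psd n A"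
  shows "A\<^sup>\<dagger> = A"
proof (rule eq_matI)
  have A: "A \<in> carrier_mat n n" by (rule psd_carrier[OF assms])
  show "dim_row (A\<^sup>\<dagger>) = dim_row A" "dim_col (A\<^sup>\<dagger>) = dim_col A" using A by auto
  fix i j assume "i < dim_row A" "j < dim_col A"
  then have ij: "i < n" "j < n" using A by auto
  have q: "Im (A $$ (i,i) + cnj c * A $$ (j,i) + c * A $$ (i,j) + cnj c * c * A $$ (j,j)) = 0" for c
  proof -
    define v where "v = ecol n i + c \<cdot>\<^sub>m ecol n j"
    have v: "v \<in> carrier_mat n 1" unfolding v_def by (intro add_carrier_mat smult_carrier_mat ecol_carrier)
    have "(v\<^sup>\<dagger> * A * v) $$ (0,0) = A $$ (i,i) + cnj c * A $$ (j,i) + c * A $$ (i,j) + cnj c * c * A $$ (j,j)"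
      using ij A by (simp add: v_def mat_dist ecol_form[OF A] algebra_simps)
    moreover have "0 \<le> (v\<^sup>\<dagger> * A * v) $$ (0,0)" using assms v unfolding psd_iff by blast
    ultimately show ?thesis by (simp add: less_eq_complex_def)
  qed
  have r: "Im (A $$ (k,k)) = 0" if "k < n" for k
    using psd_diag[OF assms that] by (simp add: less_eq_complex_def)
  have "Im (A $$ (j,i)) + Im (A $$ (i,j)) = 0" using q[of 1] r ij by simp
  moreover have "- Re (A $$ (j,i)) + Re (A $$ (i,j)) = 0" using q[of \<i>] r ij by simp
  ultimately have "A $$ (i,j) = cnj (A $$ (j,i))" by (auto simp: complex_eq_iff)
  then show "A\<^sup>\<dagger> $$ (i,j) = A $$ (i,j)" using ij A by simp
qed

section \<open>Isometries and the spectral theorem\<close>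

text \<open>Subspaces are handled through orthonormal columns spanning them: \<open>d\<close> is the
  dimension, \<open>J * J\<^sup>\<dagger>\<close> the projection,
  \<open>J\<^sup>\<dagger> * X * J\<close> the compression.\<close>

definition isometry :: "nat \<Rightarrow> nat \<Rightarrow> complex mat \<Rightarrow> bool" where
  "isometry n d J \<longleftrightarrow> J \<in> carrier_mat n d \<and> J\<^sup>\<dagger> * J = 1\<^sub>m d"

lemma isometry_mult:
  assumes "isometry n d J" "isometry d e K"
  shows "isometry n e (J * K)"
proof -
  have c: "J \<in> carrier_mat n d" "K \<in> carrier_mat d e" using assms by (auto simp: isometry_def)
  have "(J * K)\<^sup>\<dagger> * (J * K) = K\<^sup>\<dagger> * ((J\<^sup>\<dagger> * J) * K)" using c by (simp add: mat_dist)
  also have "\<dots> = 1\<^sub>m e" using assms c by (simp add: isometry_def)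
  finally show ?thesis using c by (auto simp: isometry_def)
qed

lemma isometry_trace:
  assumes "isometry n d J"
  shows "mtrace (J * J\<^sup>\<dagger>) = of_nat d"
  using assms mtrace_mult_comm[of J n d "J\<^sup>\<dagger>"] by (simp add: isometry_def)

lemma psd_projection: "D \<in> carrier_mat n n \<Longrightarrow> D\<^sup>\<dagger> = D \<Longrightarrow> D * D = D \<Longrightarrow> psd n D"
  using psd_gram[of D n n] by simp

lemma isometry_projection:
  assumes "isometry n d J"
  shows "(J * J\<^sup>\<dagger>) * (J * J\<^sup>\<dagger>) = J * J\<^sup>\<dagger>"
proof -
  have c: "J \<in> carrier_mat n d" using assms by (auto simp: isometry_def)
  have "(J * J\<^sup>\<dagger>) * (J * J\<^sup>\<dagger>) = J * ((J\<^sup>\<dagger> * J) * J\<^sup>\<dagger>)" using c by (simp add: mat_dist)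
  then show ?thesis using assms c by (simp add: isometry_def)
qed

text \<open>The projection onto the complement of the range has trace n - d, and traces of positive
  operators are nonnegative.\<close>

lemma isometry_le:
  assumes "isometry n d J"
  shows "d \<le> n"
proof -
  have c: "J \<in> carrier_mat n d" using assms by (auto simp: isometry_def)
  let ?D = "1\<^sub>m n - J * J\<^sup>\<dagger>"
  have "psd n ?D"
    using c isometry_projection[OF assms] by (intro psd_projection) (auto simp: mat_dist)
  then have "0 \<le> mtrace ?D" by (rule psd_mtrace)
  also have "mtrace ?D = of_nat n - of_nat d"
    using c isometry_trace[OF assms] by (subst mtrace_minus[of _ n]) auto
  finally show ?thesis by (simp add: less_eq_complex_def)
qed

text \<open>Taking traces turns the hypothesis into c b = squared norm of \<open>W\<close>, so c is
  automatically a positive real and its root can be divided out.\<close>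

lemma isometry_scale:
  assumes "W \<in> carrier_mat n b" "W\<^sup>\<dagger> * W = c \<cdot>\<^sub>m 1\<^sub>m b" "W \<noteq> 0\<^sub>m n b"
  shows "\<exists>t. t \<noteq> 0 \<and> isometry n b (t \<cdot>\<^sub>m W)"
proof -
  have b: "b > 0"
  proof (rule ccontr)
    assume "\<not> b > 0"
    then have "W = 0\<^sub>m n b" using assms(1) by (intro eq_matI) auto
    then show False using assms(3) by simp
  qed
  define r where "r = (\<Sum>i<b. \<Sum>k<n. (cmod (W $$ (k,i)))\<^sup>2)"
  have r: "of_real r = c * of_nat b"
    using mtrace_gram[OF assms(1)] by (simp add: assms(2) mtrace_smult[of _ b] r_def)
  have "r \<ge> 0" by (simp add: r_def sum_nonneg)
  moreover have "r \<noteq> 0"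
    using mtrace_gram_eq_0[OF assms(1)] mtrace_gram[OF assms(1)] assms(3) unfolding r_def[symmetric] by auto
  ultimately have "r > 0" by simp
  define q where "q = r / of_nat b"
  have q: "q > 0" "c = of_real q" using \<open>r > 0\<close> b r by (auto simp: q_def field_simps)
  let ?t = "of_real (1 / sqrt q) :: complex"
  have "(?t \<cdot>\<^sub>m W)\<^sup>\<dagger> * (?t \<cdot>\<^sub>m W) = (?t * ?t) \<cdot>\<^sub>m (W\<^sup>\<dagger> * W)"
    using assms(1) by (simp add: mat_dist)
  also have "\<dots> = (?t * ?t * c) \<cdot>\<^sub>m 1\<^sub>m b" using assms(2) by (simp add: mat_smult_smult)
  also have "?t * ?t * c = 1"
    using q by (simp flip: of_real_mult)
  finally have "isometry n b (?t \<cdot>\<^sub>m W)" using assms(1) by (auto simp: isometry_def)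
  then show ?thesis using q by (intro exI[of _ ?t]) auto
qed

section \<open>Maximal orthonormal systems and diagonalisation\<close>

lemma unit_column:
  assumes "w \<in> carrier_mat n 1" "w \<noteq> 0\<^sub>m n 1"
  shows "\<exists>t. t \<noteq> 0 \<and> isometry n 1 (t \<cdot>\<^sub>m w)"
proof (rule isometry_scale[OF assms(1) _ assms(2)])
  show "w\<^sup>\<dagger> * w = ((w\<^sup>\<dagger> * w) $$ (0,0)) \<cdot>\<^sub>m 1\<^sub>m 1"
    using assms(1) by (intro eq_matI) auto
qed

text \<open>A projection fixes its own columns, so any nonzero column can be normalised.\<close>

lemma projection_unit_column:
  assumes "D \<in> carrier_mat n n" "D * D = D" "D \<noteq> 0\<^sub>m n n"
  shows "\<exists>v. isometry n 1 v \<and> D * v = v"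
proof -
  obtain i j where ij: "i < n" "j < n" "D $$ (i,j) \<noteq> 0"
    using assms(1,3) by (metis carrier_matD eq_matI index_zero_mat)
  define w where "w = D * ecol n j"
  have w: "w \<in> carrier_mat n 1" using assms(1) by (auto simp: w_def)
  have "w $$ (i,0) \<noteq> 0" using mult_ecol[OF assms(1) ij(2,1)] ij by (simp add: w_def)
  then have "w \<noteq> 0\<^sub>m n 1" using ij by auto
  from unit_column[OF w this] obtain t where t: "isometry n 1 (t \<cdot>\<^sub>m w)" by auto
  have "D * w = (D * D) * ecol n j" using assms(1) by (simp add: w_def mat_assoc)
  then have "D * (t \<cdot>\<^sub>m w) = t \<cdot>\<^sub>m w" using assms w by (simp add: mat_dist w_def)
  with t show ?thesis by auto
qed

text \<open>Juxtaposition of columns; it extends an orthonormal system by further vectors.\<close>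

definition hcat :: "complex mat \<Rightarrow> complex mat \<Rightarrow> complex mat" where
  "hcat A B = mat (dim_row A) (dim_col A + dim_col B)
     (\<lambda>(i,j). if j < dim_col A then A $$ (i,j) else B $$ (i,j - dim_col A))"

lemma hcat_carrier: "A \<in> carrier_mat n a \<Longrightarrow> B \<in> carrier_mat n b \<Longrightarrow> hcat A B \<in> carrier_mat n (a + b)"
  by (auto simp: hcat_def)

lemma hcat_mult:
  assumes "C \<in> carrier_mat m n" "A \<in> carrier_mat n a" "B \<in> carrier_mat n b"
  shows "C * hcat A B = hcat (C * A) (C * B)"
  using assms by (intro eq_matI) (auto simp: hcat_def index_mult_sum)

lemma hcat_isometry:
  assumes "isometry n a A" "isometry n b B" "A\<^sup>\<dagger> * B = 0\<^sub>m a b"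
  shows "isometry n (a + b) (hcat A B)"
proof -
  have c: "A \<in> carrier_mat n a" "B \<in> carrier_mat n b" and o: "A\<^sup>\<dagger> * A = 1\<^sub>m a" "B\<^sup>\<dagger> * B = 1\<^sub>m b"
    using assms by (auto simp: isometry_def)
  have "B\<^sup>\<dagger> * A = (A\<^sup>\<dagger> * B)\<^sup>\<dagger>" using c by (simp add: mat_dist)
  then have BA: "B\<^sup>\<dagger> * A = 0\<^sub>m b a" using assms(3) by simp
  have ip: "(\<Sum>k<n. cnj (X $$ (k,i)) * Y $$ (k,j)) = (X\<^sup>\<dagger> * Y) $$ (i,j)"
    if "X \<in> carrier_mat n x" "Y \<in> carrier_mat n y" "i < x" "j < y" for X Y x y i j
    using that by (auto simp: index_mult_sum)
  have "(hcat A B)\<^sup>\<dagger> * hcat A B = 1\<^sub>m (a + b)"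
  proof (rule eq_matI)
    fix i j assume "i < dim_row (1\<^sub>m (a+b) :: complex mat)" "j < dim_col (1\<^sub>m (a+b) :: complex mat)"
    then have ij: "i < a + b" "j < a + b" by auto
    have "((hcat A B)\<^sup>\<dagger> * hcat A B) $$ (i,j) = (\<Sum>k<n. cnj (hcat A B $$ (k,i)) * hcat A B $$ (k,j))"
      using ij c by (auto simp: index_mult_sum hcat_def)
    also have "\<dots> = (if i < a then if j < a then (A\<^sup>\<dagger> * A) $$ (i,j) else (A\<^sup>\<dagger> * B) $$ (i,j - a)
       else if j < a then (B\<^sup>\<dagger> * A) $$ (i - a,j) else (B\<^sup>\<dagger> * B) $$ (i - a,j - a))"
      using ij c by (auto simp: hcat_def ip[symmetric])
    also have "\<dots> = 1\<^sub>m (a+b) $$ (i,j)"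
      using ij unfolding o assms(3) BA by auto
    finally show "((hcat A B)\<^sup>\<dagger> * hcat A B) $$ (i,j) = 1\<^sub>m (a+b) $$ (i,j)" .
  qed (use c in \<open>auto simp: hcat_def\<close>)
  then show ?thesis using hcat_carrier[OF c] by (simp add: isometry_def)
qed

text \<open>The sizes are bounded by \<open>isometry_le\<close>, so a largest system exists. It
  replaces recursive constructions: a property of the maximal system is proved by extending it by
  one column.\<close>

lemma maximal_isometry:
  assumes "\<And>d J. R d J \<Longrightarrow> isometry n d J" "R d0 J0"
  shows "\<exists>d J. R d J \<and> (\<forall>J'. \<not> R (Suc d) J')"
proof -
  have "\<exists>d. (\<exists>J. R d J) \<and> (\<forall>e. (\<exists>J. R e J) \<longrightarrow> e \<le> d)"
    using ex_has_greatest_nat[of "\<lambda>d. \<exists>J. R d J" d0 id "Suc n"] assms(2) isometry_le[OF assms(1)]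
    by (auto simp: less_Suc_eq_le)
  then show ?thesis using Suc_n_not_le_n by blast
qed

text \<open>Take a maximal orthonormal system fixed by \<open>D\<close>. What \<open>D\<close> has
  beyond its span is again a projection, and a unit vector in the range of that remainder would
  enlarge the system.\<close>

lemma projection_factor:
  assumes "D \<in> carrier_mat n n" "D\<^sup>\<dagger> = D" "D * D = D"
  shows "\<exists>d J. isometry n d J \<and> J * J\<^sup>\<dagger> = D"
proof -
  let ?R = "\<lambda>d J. isometry n d J \<and> D * J = J"
  have "?R 0 (0\<^sub>m n 0)" using assms(1) by (auto simp: isometry_def)
  then have "\<exists>d J. ?R d J \<and> (\<forall>J'. \<not> ?R (Suc d) J')"
    by (intro maximal_isometry[where n = n]) auto
  then obtain d J where J: "isometry n d J" "D * J = J" and mx: "\<And>J'. \<not> ?R (Suc d) J'" by blast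
  have c: "J \<in> carrier_mat n d" and o: "J\<^sup>\<dagger> * J = 1\<^sub>m d" using J by (auto simp: isometry_def)
  have JD: "J\<^sup>\<dagger> * D = J\<^sup>\<dagger>"
    using arg_cong[OF J(2), of adj] assms c by (simp add: mat_dist)
  define E where "E = D - J * J\<^sup>\<dagger>"
  have E: "E \<in> carrier_mat n n" using assms c by (auto simp: E_def)
  have DJJ: "D * (J * J\<^sup>\<dagger>) = J * J\<^sup>\<dagger>" using J(2) assms c by (simp add: mat_assoc[symmetric])
  have DE: "D * E = E" using assms c DJJ by (simp add: E_def mat_minus_right)
  have JE: "J\<^sup>\<dagger> * E = 0\<^sub>m d n"
    using assms c JD o by (simp add: E_def mat_minus_right mat_assoc[symmetric])
  have "E = 0\<^sub>m n n"
  proof (rule ccontr)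
    assume "E \<noteq> 0\<^sub>m n n"
    have "E * E = D * E - J * (J\<^sup>\<dagger> * E)"
      using assms c E unfolding E_def[of] by (simp add: mat_minus_left mat_assoc)
    then have "E * E = E" using DE JE c E by simp
    from projection_unit_column[OF E this \<open>E \<noteq> _\<close>]
    obtain v where v: "isometry n 1 v" "E * v = v" by auto
    have vc: "v \<in> carrier_mat n 1" using v by (auto simp: isometry_def)
    have "D * v = (D * E) * v" using v assms E vc by (simp add: mat_assoc)
    then have Dv: "D * v = v" using DE v by simp
    have "J\<^sup>\<dagger> * v = (J\<^sup>\<dagger> * E) * v" using v c E vc by (simp add: mat_assoc)
    then have "J\<^sup>\<dagger> * v = 0\<^sub>m d 1" using JE vc by simp
    from hcat_isometry[OF J(1) v(1) this] have "isometry n (Suc d) (hcat J v)" by simp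
    moreover have "D * hcat J v = hcat J v" using hcat_mult[OF assms(1) c vc] J(2) Dv by simp
    ultimately show False using mx by blast
  qed
  then have "D = J * J\<^sup>\<dagger>" using assms c by (intro mat_eq_of_minus[of D _ n n]) (auto simp: E_def)
  then show ?thesis using J by auto
qed

text \<open>The point where algebraic closedness of the complex numbers enters.\<close>

lemma eigen_column:
  assumes "B \<in> carrier_mat d d" "d > 0"
  shows "\<exists>w \<mu>. isometry d 1 w \<and> B * w = \<mu> \<cdot>\<^sub>m w"
proof -
  from spectrum_non_empty[OF assms] obtain \<mu> u where u: "eigenvector B u \<mu>"
    by (auto simp: spectrum_def eigenvalue_def)
  define w :: "complex mat" where "w = mat d 1 (\<lambda>(i,_). u $ i)"
  have ud: "u \<in> carrier_vec d" "u \<noteq> 0\<^sub>v d" "B *\<^sub>v u = \<mu> \<cdot>\<^sub>v u"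
    using u assms by (auto simp: eigenvector_def)
  have w: "w \<in> carrier_mat d 1" by (simp add: w_def)
  have "w \<noteq> 0\<^sub>m d 1"
  proof
    assume "w = 0\<^sub>m d 1"
    then have "w $$ (i,0) = 0" if "i < d" for i using that by simp
    then have "u = 0\<^sub>v d" using ud(1) by (intro eq_vecI) (auto simp: w_def)
    then show False using ud by simp
  qed
  have "B * w = \<mu> \<cdot>\<^sub>m w"
  proof (rule eq_matI)
    fix i j assume "i < dim_row (\<mu> \<cdot>\<^sub>m w)" "j < dim_col (\<mu> \<cdot>\<^sub>m w)"
    then have ij: "i < d" "j = 0" using w by auto
    have "(B * w) $$ (i,0) = (B *\<^sub>v u) $ i"
      using assms(1) ij ud(1) by (auto simp: index_mult_sum w_def scalar_prod_def lessThan_atLeast0)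
    then show "(B * w) $$ (i,j) = (\<mu> \<cdot>\<^sub>m w) $$ (i,j)"
      using ij ud by (simp add: w_def)
  qed (use assms w in auto)
  moreover from unit_column[OF w \<open>w \<noteq> _\<close>] obtain t where "isometry d 1 (t \<cdot>\<^sub>m w)" by auto
  moreover have "B * (t \<cdot>\<^sub>m w) = t \<cdot>\<^sub>m (B * w)" using assms w by (simp add: mat_dist)
  ultimately show ?thesis
    by (intro exI[of _ "t \<cdot>\<^sub>m w"] exI[of _ \<mu>]) (simp add: mat_smult_smult mult.commute)
qed

text \<open>Take a maximal orthonormal system of eigenvectors. Hermiticity makes its orthogonal
  complement invariant, so an eigenvector of the compression to a nonzero complement would be an
  eigenvector of \<open>A\<close> and would enlarge the system.\<close>

lemma spectral_decomposition:
  assumes A: "A \<in> carrier_mat n n" and h: "A\<^sup>\<dagger> = A"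
  shows "\<exists>U f. isometry n n U \<and> U * U\<^sup>\<dagger> = 1\<^sub>m n \<and> A = U * mat_diag n f * U\<^sup>\<dagger>"
proof -
  let ?R = "\<lambda>d J. isometry n d J \<and> (\<exists>f. A * J = J * mat_diag d f)"
  have "?R 0 (0\<^sub>m n 0)" using A by (auto simp: isometry_def mat_diag_def)
  then have "\<exists>d J. ?R d J \<and> (\<forall>J'. \<not> ?R (Suc d) J')"
    by (intro maximal_isometry[where n = n]) auto
  then obtain d J f where J: "isometry n d J" "A * J = J * mat_diag d f"
    and mx: "\<And>J'. \<not> ?R (Suc d) J'" by blast
  have c: "J \<in> carrier_mat n d" and o: "J\<^sup>\<dagger> * J = 1\<^sub>m d" using J by (auto simp: isometry_def)
  have dg [simp]: "dim_row (mat_diag m g) = m" "dim_col (mat_diag m g) = m" for m and g :: "nat \<Rightarrow> complex"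
    by (auto simp: mat_diag_def)
  define E where "E = 1\<^sub>m n - J * J\<^sup>\<dagger>"
  have E: "E \<in> carrier_mat n n" using c by (auto simp: E_def)
  have Eh: "E\<^sup>\<dagger> = E" using c by (simp add: E_def mat_dist)
  have JE: "J\<^sup>\<dagger> * E = 0\<^sub>m d n"
    using c o by (simp add: E_def mat_minus_right mat_assoc[symmetric])
  have "E * E = 1\<^sub>m n * E - J * (J\<^sup>\<dagger> * E)"
    using c E unfolding E_def[of] by (simp add: mat_minus_left mat_assoc)
  then have EE: "E * E = E" using JE c E by simp
  \<comment> \<open>\<open>K\<close> parametrises the complement of the eigenvectors collected in
    \<open>J\<close>.\<close>
  from projection_factor[OF E Eh EE] obtain e K where K: "isometry n e K" "K * K\<^sup>\<dagger> = E" by auto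
  have Kc: "K \<in> carrier_mat n e" and Ko: "K\<^sup>\<dagger> * K = 1\<^sub>m e" using K by (auto simp: isometry_def)
  have EK: "E * K = K"
    using Kc Ko K(2)[symmetric] by (simp add: mat_assoc)
  have "J\<^sup>\<dagger> * A = (A * J)\<^sup>\<dagger>" using A c h by (simp add: mat_dist)
  also have "\<dots> = (mat_diag d f)\<^sup>\<dagger> * J\<^sup>\<dagger>" unfolding J(2) using c by (simp add: mat_dist)
  finally have JA: "J\<^sup>\<dagger> * A = (mat_diag d f)\<^sup>\<dagger> * J\<^sup>\<dagger>" .
  have JK: "J\<^sup>\<dagger> * K = 0\<^sub>m d e"
  proof -
    have "J\<^sup>\<dagger> * K = (J\<^sup>\<dagger> * E) * K" using EK c E Kc by (simp add: mat_assoc)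
    then show ?thesis using JE Kc by simp
  qed
  have e0: "e = 0"
  proof (rule ccontr)
    assume "e \<noteq> 0"
    then obtain w \<mu> where w: "isometry e 1 w" "(K\<^sup>\<dagger> * (A * K)) * w = \<mu> \<cdot>\<^sub>m w"
      using eigen_column[of "K\<^sup>\<dagger> * (A * K)" e] A Kc by auto
    have wc: "w \<in> carrier_mat e 1" using w by (auto simp: isometry_def)
    define v where "v = K * w"
    have v: "isometry n 1 v" unfolding v_def by (rule isometry_mult[OF K(1) w(1)])
    have vc: "v \<in> carrier_mat n 1" using v by (auto simp: isometry_def)
    have one: "1\<^sub>m n = J * J\<^sup>\<dagger> + K * K\<^sup>\<dagger>"
      unfolding K(2) E_def using c by (intro eq_matI) auto
    have Av: "A * v \<in> carrier_mat n 1" using A vc by auto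
    have "A * v = 1\<^sub>m n * (A * v)" using A by simp
    also have "\<dots> = J * ((J\<^sup>\<dagger> * A) * K) * w + K * ((K\<^sup>\<dagger> * (A * K)) * w)"
      unfolding one using A c Kc wc by (simp add: v_def mat_add_left mat_assoc)
    also have "(J\<^sup>\<dagger> * A) * K = 0\<^sub>m d e"
      unfolding JA using c Kc JK by (simp add: mat_assoc)
    also have "K * ((K\<^sup>\<dagger> * (A * K)) * w) = \<mu> \<cdot>\<^sub>m v"
      unfolding w(2) using Kc wc by (simp add: mat_dist v_def)
    finally have Av: "A * v = \<mu> \<cdot>\<^sub>m v" using c wc vc by simp
    have "J\<^sup>\<dagger> * v = (J\<^sup>\<dagger> * K) * w" using c Kc wc by (simp add: v_def mat_assoc)
    then have "J\<^sup>\<dagger> * v = 0\<^sub>m d 1" using JK wc by simp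
    from hcat_isometry[OF J(1) v(1) this] have 1: "isometry n (Suc d) (hcat J v)" by simp
    have "A * hcat J v = hcat (J * mat_diag d f) (\<mu> \<cdot>\<^sub>m v)" using hcat_mult[OF A c vc] J(2) Av by simp
    also have "\<dots> = hcat J v * mat_diag (Suc d) (f(d := \<mu>))"
      using c vc hcat_carrier[OF c vc]
      by (intro eq_matI) (auto simp: hcat_def mat_diag_mult_right[of _ n] less_Suc_eq)
    finally show False using mx 1 by blast
  qed
  have "E = 0\<^sub>m n n"
    unfolding K(2)[symmetric] using Kc unfolding e0 by (intro eq_matI) (auto simp: index_mult_sum)
  then have JJ: "J * J\<^sup>\<dagger> = 1\<^sub>m n"
    using c by (intro mat_eq_of_minus[of "1\<^sub>m n" _ n n, symmetric]) (auto simp: E_def)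
  \<comment> \<open>The dimensions agree because \<open>J * J\<^sup>\<dagger>\<close> and
    \<open>J\<^sup>\<dagger> * J\<close> have the same trace.\<close>
  then have "of_nat n = (of_nat d :: complex)" using isometry_trace[OF J(1)] by simp
  then have d: "d = n" by simp
  have "A = A * (J * J\<^sup>\<dagger>)" using JJ A by simp
  also have "\<dots> = J * mat_diag n f * J\<^sup>\<dagger>"
    using A c J(2) d by (simp add: mat_assoc[symmetric])
  finally show ?thesis using J(1) JJ d by blast
qed

text \<open>On an eigenvalue x these are x^(1/2), x^(-1/2), the indicator of x \<noteq> 0, and
  x^(-1/4). The convention \<open>inverse 0 = 0\<close> makes \<open>t\<close> the pseudo-inverse of
  \<open>s\<close>.\<close>

lemma psd_root:
  assumes "psd n A"
  obtains s t P r where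
    "s \<in> carrier_mat n n" "t \<in> carrier_mat n n" "P \<in> carrier_mat n n" "r \<in> carrier_mat n n"
    "s\<^sup>\<dagger> = s" "t\<^sup>\<dagger> = t" "P\<^sup>\<dagger> = P" "r\<^sup>\<dagger> = r"
    "s * s = A" "s * t = P" "t * s = P" "P * s = s" "s * P = s" "P * t = t" "t * P = t"
    "P * P = P" "r * r = t"
proof -
  have A: "A \<in> carrier_mat n n" by (rule psd_carrier[OF assms])
  from spectral_decomposition[OF A psd_hermitian[OF assms]] obtain U f where
    U: "U \<in> carrier_mat n n" "U\<^sup>\<dagger> * U = 1\<^sub>m n" "U * U\<^sup>\<dagger> = 1\<^sub>m n" and AU: "A = U * mat_diag n f * U\<^sup>\<dagger>"
    by (auto simp: isometry_def)
  have dg [simp]: "dim_row (mat_diag m g) = m" "dim_col (mat_diag m g) = m" for m and g :: "nat \<Rightarrow> complex"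
    by (auto simp: mat_diag_def)
  have can: "U\<^sup>\<dagger> * (U * X) = X" if "dim_row X = n" for X
    using U that by (simp add: mat_assoc[symmetric])
  have "U\<^sup>\<dagger> * A * U = mat_diag n f"
    unfolding AU using U by (simp add: mat_assoc can)
  then have pf: "psd n (mat_diag n f)" using psd_conj[OF assms U(1)] by simp
  have f0: "0 \<le> f i" if "i < n" for i
    using psd_diag[OF pf that] that by (simp add: mat_diag_def)
  \<comment> \<open>Functional calculus of \<open>A\<close>: by \<open>Fm\<close> and
    \<open>Fe\<close>, identities between functions on the nonnegative reals become identities
    between matrices.\<close>
  define F where "F g = U * mat_diag n (\<lambda>i. of_real (g (Re (f i)))) * U\<^sup>\<dagger>" for g :: "real \<Rightarrow> real"
  have Fc: "F g \<in> carrier_mat n n" for g using U by (auto simp: F_def)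
  have Fh: "(F g)\<^sup>\<dagger> = F g" for g
  proof -
    have "(mat_diag n (\<lambda>i. of_real (g (Re (f i)))))\<^sup>\<dagger> = mat_diag n (\<lambda>i. of_real (g (Re (f i))))"
      by (rule eq_matI) (auto simp: mat_diag_def)
    then show ?thesis using U by (simp add: F_def mat_dist)
  qed
  have Fm: "F g * F h = F (\<lambda>x. g x * h x)" for g h
  proof -
    have "mat_diag n a * (mat_diag n b * X) = mat_diag n (\<lambda>i. a i * b i) * X"
      if "dim_row X = n" for a b :: "nat \<Rightarrow> complex" and X
      using that by (subst mat_assoc[symmetric]) auto
    then have "F g * F h = F (\<lambda>x. g x * h x)"
      using U by (simp add: F_def mat_assoc can)
    then show ?thesis by simp
  qed
  have Fe: "F g = F h" if "\<And>x. 0 \<le> x \<Longrightarrow> g x = h x" for g h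
  proof -
    have "mat_diag n (\<lambda>i. complex_of_real (g (Re (f i)))) = mat_diag n (\<lambda>i. of_real (h (Re (f i))))"
      using f0 that by (intro eq_matI) (auto simp: mat_diag_def less_eq_complex_def)
    then show ?thesis by (simp add: F_def)
  qed
  have FA: "F (\<lambda>x. x) = A"
  proof -
    have "mat_diag n (\<lambda>i. complex_of_real (Re (f i))) = mat_diag n f"
      using f0 by (intro eq_matI) (auto simp: mat_diag_def less_eq_complex_def complex_eq_iff)
    then show ?thesis by (simp add: F_def AU)
  qed
  show thesis
  proof (rule that[of "F sqrt" "F (\<lambda>x. inverse (sqrt x))" "F (\<lambda>x. if x = 0 then 0 else 1)" "F (\<lambda>x. sqrt (inverse (sqrt x)))"])
  qed (auto simp: Fc Fh Fm FA[symmetric] intro!: Fe)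
qed

section \<open>Kronecker products and partial traces\<close>

lemma div_mod_less:
  assumes "i < a * (b::nat)"
  shows "i div b < a" "i mod b < b"
  using assms by (auto simp: less_mult_imp_div_less) (metis mod_less_divisor mult_0_right neq0_conv not_less0)

lemma mult_add_less: "i < a \<Longrightarrow> k < b \<Longrightarrow> i * b + k < a * (b::nat)"
proof -
  assume "i < a" "k < b"
  then have "i * b + k < Suc i * b" by simp
  also have "\<dots> \<le> a * b" using \<open>i < a\<close> by (intro mult_le_mono1) simp
  finally show ?thesis .
qed

lemma sum_div_mod:
  fixes f :: "nat \<Rightarrow> nat \<Rightarrow> 'a :: comm_monoid_add"
  shows "(\<Sum>k<a*b. f (k div b) (k mod b)) = (\<Sum>i<a. \<Sum>j<b. f i j)"
proof -
  have "(\<Sum>i<a. \<Sum>j<b. f i j) = (\<Sum>i<a. \<Sum>k\<in>{i*b..<i*b+b}. f (k div b) (k mod b))"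
  proof (rule sum.cong[OF refl])
    fix i
    have "(\<Sum>k\<in>{i*b..<i*b+b}. f (k div b) (k mod b)) = (\<Sum>j\<in>{0..<b}. f ((j+i*b) div b) ((j+i*b) mod b))"
      using sum.shift_bounds_nat_ivl[of "\<lambda>k. f (k div b) (k mod b)" 0 "i*b" b] by (simp add: add.commute)
    also have "\<dots> = (\<Sum>j<b. f i j)"
      by (intro sum.cong) auto
    finally show "(\<Sum>j<b. f i j) = (\<Sum>k\<in>{i*b..<i*b+b}. f (k div b) (k mod b))" ..
  qed
  then show ?thesis using sum.nat_group[of "\<lambda>k. f (k div b) (k mod b)" b a] by simp
qed

lemma dim_kron [simp]: "dim_row (kron A B) = dim_row A * dim_row B" "dim_col (kron A B) = dim_col A * dim_col B"
  by (auto simp: kron_def)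

lemma kron_carrier [simp]:
  "A \<in> carrier_mat n m \<Longrightarrow> B \<in> carrier_mat p q \<Longrightarrow> kron A B \<in> carrier_mat (n * p) (m * q)"
  by auto

lemma index_kron:
  "i < dim_row A * dim_row B \<Longrightarrow> j < dim_col A * dim_col B \<Longrightarrow>
    kron A B $$ (i,j) = A $$ (i div dim_row B, j div dim_col B) * B $$ (i mod dim_row B, j mod dim_col B)"
  by (simp add: kron_def)

lemma kron_mult:
  assumes "dim_col A = dim_row C" "dim_col B = dim_row D"
  shows "kron A B * kron C D = kron (A * C) (B * D)"
proof (rule eq_matI)
  fix i j assume "i < dim_row (kron (A * C) (B * D))" "j < dim_col (kron (A * C) (B * D))"
  then have ij: "i < dim_row A * dim_row B" "j < dim_col C * dim_col D" by auto
  note d = div_mod_less[OF ij(1)] div_mod_less[OF ij(2)]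
  have "(kron A B * kron C D) $$ (i,j) = (\<Sum>k<dim_row C * dim_row D. kron A B $$ (i,k) * kron C D $$ (k,j))"
    using ij assms by (subst index_mult_sum) auto
  also have "\<dots> = (\<Sum>k<dim_row C * dim_row D.
      (A $$ (i div dim_row B, k div dim_row D) * B $$ (i mod dim_row B, k mod dim_row D)) *
      (C $$ (k div dim_row D, j div dim_col D) * D $$ (k mod dim_row D, j mod dim_col D)))"
    using ij assms by (intro sum.cong) (auto simp: index_kron)
  also have "\<dots> = (\<Sum>k<dim_row C. \<Sum>l<dim_row D.
      (A $$ (i div dim_row B, k) * B $$ (i mod dim_row B, l)) * (C $$ (k, j div dim_col D) * D $$ (l, j mod dim_col D)))"
    by (rule sum_div_mod)
  also have "\<dots> = (A * C) $$ (i div dim_row B, j div dim_col D) * (B * D) $$ (i mod dim_row B, j mod dim_col D)"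
    using d assms by (simp add: index_mult_sum sum_product mult.assoc mult.left_commute)
  also have "\<dots> = kron (A * C) (B * D) $$ (i,j)"
    using ij by (simp add: index_kron)
  finally show "(kron A B * kron C D) $$ (i,j) = kron (A * C) (B * D) $$ (i,j)" .
qed auto

lemma kron_adjoint: "(kron A B)\<^sup>\<dagger> = kron (A\<^sup>\<dagger>) (B\<^sup>\<dagger>)"
proof (rule eq_matI)
  fix i j assume "i < dim_row (kron (A\<^sup>\<dagger>) (B\<^sup>\<dagger>))" "j < dim_col (kron (A\<^sup>\<dagger>) (B\<^sup>\<dagger>))"
  then have ij: "i < dim_col A * dim_col B" "j < dim_row A * dim_row B" by auto
  then show "(kron A B)\<^sup>\<dagger> $$ (i,j) = kron (A\<^sup>\<dagger>) (B\<^sup>\<dagger>) $$ (i,j)"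
    using div_mod_less[OF ij(1)] div_mod_less[OF ij(2)] by (simp add: index_kron)
qed auto

lemma kron_one: "kron (1\<^sub>m a) (1\<^sub>m b) = 1\<^sub>m (a * b)"
proof (rule eq_matI)
  fix i j assume "i < dim_row (1\<^sub>m (a*b) :: complex mat)" "j < dim_col (1\<^sub>m (a*b) :: complex mat)"
  then have ij: "i < a * b" "j < a * b" by auto
  have "i = j" if "i div b = j div b" "i mod b = j mod b"
    using that by (metis div_mult_mod_eq)
  then show "kron (1\<^sub>m a) (1\<^sub>m b) $$ (i,j) = 1\<^sub>m (a*b) $$ (i,j)"
    using ij div_mod_less[OF ij(1)] div_mod_less[OF ij(2)] by (auto simp: index_kron)
qed auto

lemma kron_minus_left:
  assumes "A \<in> carrier_mat n m" "B \<in> carrier_mat n m"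
  shows "kron (A - B) C = kron A C - kron B C"
proof (rule eq_matI)
  fix i j assume "i < dim_row (kron A C - kron B C)" "j < dim_col (kron A C - kron B C)"
  then have ij: "i < n * dim_row C" "j < m * dim_col C" using assms by auto
  then show "kron (A - B) C $$ (i,j) = (kron A C - kron B C) $$ (i,j)"
    using div_mod_less[OF ij(1)] div_mod_less[OF ij(2)] assms by (simp add: index_kron algebra_simps)
qed (use assms in auto)

lemma kron_smult_left: "kron (c \<cdot>\<^sub>m A) B = c \<cdot>\<^sub>m kron A B"
proof (rule eq_matI)
  fix i j assume "i < dim_row (c \<cdot>\<^sub>m kron A B)" "j < dim_col (c \<cdot>\<^sub>m kron A B)"
  then have ij: "i < dim_row A * dim_row B" "j < dim_col A * dim_col B" by auto
  then show "kron (c \<cdot>\<^sub>m A) B $$ (i,j) = (c \<cdot>\<^sub>m kron A B) $$ (i,j)"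
    using div_mod_less[OF ij(1)] div_mod_less[OF ij(2)] by (simp add: index_kron)
qed auto

lemma kron_smult_right: "kron A (c \<cdot>\<^sub>m B) = c \<cdot>\<^sub>m kron A B"
proof (rule eq_matI)
  fix i j assume "i < dim_row (c \<cdot>\<^sub>m kron A B)" "j < dim_col (c \<cdot>\<^sub>m kron A B)"
  then have ij: "i < dim_row A * dim_row B" "j < dim_col A * dim_col B" by auto
  then show "kron A (c \<cdot>\<^sub>m B) $$ (i,j) = (c \<cdot>\<^sub>m kron A B) $$ (i,j)"
    using div_mod_less[OF ij(1)] div_mod_less[OF ij(2)] by (simp add: index_kron)
qed auto

lemma kron_zero_left: "kron (0\<^sub>m n m) B = 0\<^sub>m (n * dim_row B) (m * dim_col B)"
proof (rule eq_matI)
  fix i j assume "i < dim_row (0\<^sub>m (n * dim_row B) (m * dim_col B) :: complex mat)"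
    "j < dim_col (0\<^sub>m (n * dim_row B) (m * dim_col B) :: complex mat)"
  then have ij: "i < n * dim_row B" "j < m * dim_col B" by auto
  then show "kron (0\<^sub>m n m) B $$ (i,j) = 0\<^sub>m (n * dim_row B) (m * dim_col B) $$ (i,j)"
    using div_mod_less[OF ij(1)] div_mod_less[OF ij(2)] by (simp add: index_kron)
qed auto

lemma kron_assoc: "kron (kron A B) C = kron A (kron B C)"
proof (rule eq_matI)
  fix i j assume "i < dim_row (kron A (kron B C))" "j < dim_col (kron A (kron B C))"
  then have ij: "i < dim_row A * dim_row B * dim_row C" "j < dim_col A * dim_col B * dim_col C"
    by (auto simp: mult.assoc)
  have ij': "i < dim_row A * (dim_row B * dim_row C)" "j < dim_col A * (dim_col B * dim_col C)"
    using ij by (auto simp: mult.assoc)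
  have e: "x div c div b = x div (b * c)" "x div c mod b = x mod (b * c) div c"
    if "c > 0" for x b c :: nat
    using that by (auto simp: div_mult2_eq mod_mult2_eq mult.commute[of b c])
  have e3: "x mod (b * c) mod c = x mod c" for x b c :: nat
    by (simp add: mod_mod_cancel)
  have "dim_row C > 0" "dim_col C > 0" using ij by (auto intro: gr0I)
  then show "kron (kron A B) C $$ (i,j) = kron A (kron B C) $$ (i,j)"
    using ij ij' div_mod_less[OF ij(1)] div_mod_less[OF ij(2)] div_mod_less[OF ij'(1)] div_mod_less[OF ij'(2)]
    by (simp add: index_kron e e3 mult.assoc)
qed (auto simp: mult.assoc)

lemma mtrace_kron:
  assumes "A \<in> carrier_mat a a" "B \<in> carrier_mat b b"
  shows "mtrace (kron A B) = mtrace A * mtrace B"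
proof -
  have "mtrace (kron A B) = (\<Sum>k<a*b. A $$ (k div b, k div b) * B $$ (k mod b, k mod b))"
    using assms by (auto simp: mtrace_def index_kron)
  also have "\<dots> = (\<Sum>i<a. \<Sum>j<b. A $$ (i,i) * B $$ (j,j))" by (rule sum_div_mod)
  finally show ?thesis using assms by (auto simp: mtrace_def sum_product)
qed

section \<open>Products and kernels of positive semidefinite operators\<close>

lemma psd_factor:
  assumes "psd n A"
  shows "\<exists>B\<in>carrier_mat n n. B\<^sup>\<dagger> = B \<and> A = B\<^sup>\<dagger> * B"
proof -
  from psd_root[OF assms] obtain s where "s \<in> carrier_mat n n" "s\<^sup>\<dagger> = s" "s * s = A" by metis
  then show ?thesis by (intro bexI[of _ s]) auto
qed

lemma psd_kron:
  assumes "psd a A" "psd b B"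
  shows "psd (a * b) (kron A B)"
proof -
  obtain C D where C: "C \<in> carrier_mat a a" "A = C\<^sup>\<dagger> * C" and D: "D \<in> carrier_mat b b" "B = D\<^sup>\<dagger> * D"
    using psd_factor[OF assms(1)] psd_factor[OF assms(2)] by blast
  have "kron A B = (kron C D)\<^sup>\<dagger> * kron C D"
    using C D by (simp add: kron_adjoint kron_mult)
  then show ?thesis using psd_gram[of "kron C D" "a*b" "a*b"] C D by simp
qed

lemma mtrace_psd_mult:
  assumes "psd n A" "psd n B"
  shows "0 \<le> mtrace (A * B)"
proof -
  obtain C where C: "C \<in> carrier_mat n n" "A = C\<^sup>\<dagger> * C" using psd_factor[OF assms(1)] by blast
  have B: "B \<in> carrier_mat n n" by (rule psd_carrier[OF assms(2)])
  have "mtrace (A * B) = mtrace (C\<^sup>\<dagger> * (C * B))" using C B by (simp add: mat_assoc)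
  also have "\<dots> = mtrace (C * B * C\<^sup>\<dagger>)"
    using C B by (subst mtrace_mult_comm[of _ n n]) auto
  finally show ?thesis using psd_mtrace[OF psd_conj'[OF assms(2) C(1)]] by simp
qed

text \<open>With A factored as a Gram product of C, the trace is the squared norm of C K, so C K
  vanishes.\<close>

lemma psd_conj_eq_0:
  assumes "psd n A" "K \<in> carrier_mat n m" "mtrace (K\<^sup>\<dagger> * A * K) = 0"
  shows "A * K = 0\<^sub>m n m"
proof -
  obtain C where C: "C \<in> carrier_mat n n" "A = C\<^sup>\<dagger> * C" using psd_factor[OF assms(1)] by blast
  have "K\<^sup>\<dagger> * A * K = (C * K)\<^sup>\<dagger> * (C * K)" using C assms(2) by (simp add: mat_dist)
  then have "C * K = 0\<^sub>m n m" using mtrace_gram_eq_0[of "C * K" n m] assms C by simp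
  then show ?thesis using C assms by (simp add: mat_assoc)
qed

text \<open>The compressions of X and A - X by K have nonnegative traces that add up to the trace of
  the compression of A, which is zero.\<close>

lemma psd_dominated_kernel:
  assumes "psd n X" "psd n (A - X)" "A \<in> carrier_mat n n" "K \<in> carrier_mat n m" "A * K = 0\<^sub>m n m"
  shows "X * K = 0\<^sub>m n m"
proof -
  have X: "X \<in> carrier_mat n n" by (rule psd_carrier[OF assms(1)])
  have "K\<^sup>\<dagger> * (A - X) * K + K\<^sup>\<dagger> * X * K = K\<^sup>\<dagger> * (A * K)"
    using assms(3,4) X by (simp add: mat_dist) (rule eq_matI, auto)
  then have "mtrace (K\<^sup>\<dagger> * (A - X) * K) + mtrace (K\<^sup>\<dagger> * X * K) = 0"
    using assms(3-5) X by (subst mtrace_add[of _ m, symmetric]) auto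
  then have "mtrace (K\<^sup>\<dagger> * X * K) = 0"
    using psd_mtrace[OF psd_conj[OF assms(1,4)]] psd_mtrace[OF psd_conj[OF assms(2,4)]]
    by (auto simp: less_eq_complex_def complex_eq_iff)
  then show ?thesis by (rule psd_conj_eq_0[OF assms(1,4)])
qed

section \<open>Operators on one tensor factor, slices and the partial trace\<close>

abbreviation lift :: "nat \<Rightarrow> complex mat \<Rightarrow> complex mat" where
  "lift d A \<equiv> kron A (1\<^sub>m d)"

lemma lift_mult: "dim_col A = dim_row B \<Longrightarrow> lift d A * lift d B = lift d (A * B)"
  by (simp add: kron_mult)

lemma lift_adjoint: "(lift d A)\<^sup>\<dagger> = lift d (A\<^sup>\<dagger>)"
  by (simp add: kron_adjoint)

abbreviation ket :: "nat \<Rightarrow> nat \<Rightarrow> nat \<Rightarrow> complex mat" where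
  "ket n c q \<equiv> kron (1\<^sub>m n) (ecol c q)"

lemma ket_carrier: "ket n c q \<in> carrier_mat (n * c) n"
  by (rule carrier_matI) auto

text \<open>The coefficients in X = \<Sum> X_qp \<otimes> |q><p|, taken with respect to the second
  factor. The partial trace is the sum of the diagonal ones.\<close>

definition slice :: "nat \<Rightarrow> nat \<Rightarrow> complex mat \<Rightarrow> nat \<Rightarrow> nat \<Rightarrow> complex mat" where
  "slice n c X q p = mat n n (\<lambda>(i,j). X $$ (i*c+q, j*c+p))"

lemma slice_carrier [simp]: "slice n c X q p \<in> carrier_mat n n" "dim_row (slice n c X q p) = n" "dim_col (slice n c X q p) = n"
  by (auto simp: slice_def)

lemma mult_ket_index:
  assumes "X \<in> carrier_mat m (n * c)" "i < m" "j < n" "q < c"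
  shows "(X * ket n c q) $$ (i,j) = X $$ (i, j*c+q)"
proof -
  have "(X * ket n c q) $$ (i,j) = (\<Sum>k<n*c. X $$ (i,k) * (if k div c = j \<and> k mod c = q then 1 else 0))"
    using assms by (auto simp: index_mult_sum index_kron index_ecol div_mod_less intro!: sum.cong)
  also have "\<dots> = (\<Sum>k<n*c. if k = j*c+q then X $$ (i,k) else 0)"
  proof (intro sum.cong refl)
    fix k
    have "k div c = j \<and> k mod c = q \<longleftrightarrow> k = j*c+q" using assms(4) by auto
    then show "X $$ (i,k) * (if k div c = j \<and> k mod c = q then 1 else 0) = (if k = j*c+q then X $$ (i,k) else 0)"
      by auto
  qed
  finally show ?thesis using mult_add_less[OF assms(3,4)] by simp
qed

lemma slice_eq:
  assumes "X \<in> carrier_mat (n * c) (n * c)" "q < c" "p < c"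
  shows "slice n c X q p = (ket n c q)\<^sup>\<dagger> * X * ket n c p"
proof (rule eq_matI)
  fix i j assume "i < dim_row ((ket n c q)\<^sup>\<dagger> * X * ket n c p)" "j < dim_col ((ket n c q)\<^sup>\<dagger> * X * ket n c p)"
  then have ij: "i < n" "j < n" by auto
  have "((ket n c q)\<^sup>\<dagger> * X * ket n c p) $$ (i,j) = ((ket n c q)\<^sup>\<dagger> * X) $$ (i,j*c+p)"
    by (rule mult_ket_index) (use assms ij in auto)
  also have "\<dots> = (X\<^sup>\<dagger> * ket n c q)\<^sup>\<dagger> $$ (i,j*c+p)" using assms by (simp add: mat_dist)
  also have "\<dots> = cnj ((X\<^sup>\<dagger> * ket n c q) $$ (j*c+p,i))"
    using assms ij mult_add_less[OF ij(2) assms(3)] by (subst index_adjoint) auto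
  also have "(X\<^sup>\<dagger> * ket n c q) $$ (j*c+p,i) = X\<^sup>\<dagger> $$ (j*c+p, i*c+q)"
    by (rule mult_ket_index) (use assms ij mult_add_less[OF ij(2) assms(3)] in auto)
  finally show "slice n c X q p $$ (i,j) = ((ket n c q)\<^sup>\<dagger> * X * ket n c p) $$ (i,j)"
    using assms ij mult_add_less[OF ij(2) assms(3)] mult_add_less[OF ij(1) assms(2)] by (simp add: slice_def)
qed auto

lemma slice_ext:
  assumes "X \<in> carrier_mat (n * c) (n * c)" "Y \<in> carrier_mat (n * c) (n * c)"
    "\<And>q p. q < c \<Longrightarrow> p < c \<Longrightarrow> slice n c X q p = slice n c Y q p"
  shows "X = Y"
proof (rule eq_matI)
  fix i j assume "i < dim_row Y" "j < dim_col Y"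
  then have ij: "i < n * c" "j < n * c" using assms by auto
  note d = div_mod_less[OF ij(1)] div_mod_less[OF ij(2)]
  have "slice n c X (i mod c) (j mod c) $$ (i div c, j div c) = slice n c Y (i mod c) (j mod c) $$ (i div c, j div c)"
    using assms(3) d by simp
  then show "X $$ (i,j) = Y $$ (i,j)" using d by (simp add: slice_def)
qed (use assms in auto)

lemma lift_ket:
  assumes "Y \<in> carrier_mat n n"
  shows "lift c Y * ket n c q = ket n c q * Y"
proof -
  have "kron Y (1\<^sub>m 1) = Y" using assms by (intro eq_matI) (auto simp: index_kron)
  then have "ket n c q * Y = ket n c q * kron Y (1\<^sub>m 1)" by simp
  also have "\<dots> = lift c Y * ket n c q" using assms by (simp add: kron_mult)
  finally show ?thesis ..
qed

text \<open>Operators Y \<otimes> 1 pass through the kets of the second factor and hence act on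
  every slice separately.\<close>

lemma slice_mult_lift:
  assumes "X \<in> carrier_mat (n * c) (n * c)" "Y \<in> carrier_mat n n" "q < c" "p < c"
  shows "slice n c (X * lift c Y) q p = slice n c X q p * Y"
    "slice n c (lift c Y * X) q p = Y * slice n c X q p"
proof -
  have k: "ket n c q \<in> carrier_mat (n * c) n" for q by (rule ket_carrier)
  show "slice n c (X * lift c Y) q p = slice n c X q p * Y"
    using assms k by (simp add: slice_eq mat_assoc lift_ket)
  have "(ket n c q)\<^sup>\<dagger> * lift c Y = (lift c (Y\<^sup>\<dagger>) * ket n c q)\<^sup>\<dagger>"
    using assms k[of q] by (simp add: adjoint_mult lift_adjoint)
  also have "\<dots> = Y * (ket n c q)\<^sup>\<dagger>"
    using assms k[of q] by (subst lift_ket) (auto simp: adjoint_mult)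
  finally have *: "(ket n c q)\<^sup>\<dagger> * lift c Y = Y * (ket n c q)\<^sup>\<dagger>" .
  have "slice n c (lift c Y * X) q p = ((ket n c q)\<^sup>\<dagger> * lift c Y) * (X * ket n c p)"
    using assms by (subst slice_eq) (auto simp: mat_assoc)
  also have "\<dots> = Y * slice n c X q p"
    unfolding * using assms by (simp add: slice_eq mat_assoc)
  finally show "slice n c (lift c Y * X) q p = Y * slice n c X q p" .
qed

lemma ptrace_eq_msum: "ptrace_E n c X = msum n c (\<lambda>k. slice n c X k k)"
  by (rule eq_matI) (auto simp: ptrace_E_def msum_def slice_def)

lemma ptrace_carrier [simp]: "ptrace_E n c X \<in> carrier_mat n n" "dim_row (ptrace_E n c X) = n" "dim_col (ptrace_E n c X) = n"
  by (auto simp: ptrace_E_def)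

lemma ptrace_lift:
  assumes "X \<in> carrier_mat (n * c) (n * c)" "Y \<in> carrier_mat n n"
  shows "ptrace_E n c (X * lift c Y) = ptrace_E n c X * Y" "ptrace_E n c (lift c Y * X) = Y * ptrace_E n c X"
  using assms by (auto simp: ptrace_eq_msum msum_left msum_right slice_mult_lift intro!: msum_cong)

lemma mtrace_ptrace:
  assumes "X \<in> carrier_mat (n * c) (n * c)"
  shows "mtrace (ptrace_E n c X) = mtrace X"
proof -
  have "mtrace X = (\<Sum>k<n*c. X $$ (k div c * c + k mod c, k div c * c + k mod c))"
    using assms by (simp add: mtrace_def)
  also have "\<dots> = (\<Sum>i<n. \<Sum>k<c. X $$ (i*c+k, i*c+k))" by (rule sum_div_mod)
  finally show ?thesis by (simp add: mtrace_def ptrace_E_def)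
qed

text \<open>Duality: tensoring with the identity is the Hilbert-Schmidt adjoint of the partial
  trace.\<close>

lemma mtrace_lift:
  assumes "X \<in> carrier_mat (n * c) (n * c)" "Y \<in> carrier_mat n n"
  shows "mtrace (lift c Y * X) = mtrace (Y * ptrace_E n c X)"
proof -
  have "lift c Y * X \<in> carrier_mat (n * c) (n * c)" using assms by (intro carrier_matI) auto
  from mtrace_ptrace[OF this] show ?thesis using assms by (simp add: ptrace_lift)
qed

lemma ptrace_add:
  assumes "X \<in> carrier_mat (n * c) (n * c)" "Y \<in> carrier_mat (n * c) (n * c)"
  shows "ptrace_E n c (X + Y) = ptrace_E n c X + ptrace_E n c Y"
  using assms mult_add_less by (intro eq_matI) (auto simp: ptrace_E_def sum.distrib)

lemma ptrace_minus:
  assumes "X \<in> carrier_mat (n * c) (n * c)" "Y \<in> carrier_mat (n * c) (n * c)"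
  shows "ptrace_E n c (X - Y) = ptrace_E n c X - ptrace_E n c Y"
  using assms mult_add_less by (intro eq_matI) (auto simp: ptrace_E_def sum_subtractf)

lemma ptrace_smult:
  assumes "X \<in> carrier_mat (n * c) (n * c)"
  shows "ptrace_E n c (a \<cdot>\<^sub>m X) = a \<cdot>\<^sub>m ptrace_E n c X"
  using assms mult_add_less by (intro eq_matI) (auto simp: ptrace_E_def sum_distrib_left)

lemma ptrace_lin_map: "lin_map (n * c) n (ptrace_E n c)"
  by (auto simp: lin_map_def ptrace_add ptrace_smult)

lemma psd_ptrace:
  assumes "psd (n * c) X"
  shows "psd n (ptrace_E n c X)"
  unfolding ptrace_eq_msum
  by (intro psd_msum) (use psd_carrier[OF assms] in \<open>simp add: slice_eq psd_conj[OF assms ket_carrier]\<close>)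

section \<open>Linear and completely positive maps\<close>

lemma lin_mapD:
  assumes "lin_map n m F" "A \<in> carrier_mat n n"
  shows "F A \<in> carrier_mat m m" "B \<in> carrier_mat n n \<Longrightarrow> F (A + B) = F A + F B" "F (c \<cdot>\<^sub>m A) = c \<cdot>\<^sub>m F A"
  using assms by (auto simp: lin_map_def)

lemma lin_map_zero:
  assumes "lin_map n m F"
  shows "F (0\<^sub>m n n) = 0\<^sub>m m m"
proof -
  have "F (0 \<cdot>\<^sub>m 0\<^sub>m n n) = 0 \<cdot>\<^sub>m F (0\<^sub>m n n)" by (rule lin_mapD(3)[OF assms]) simp
  moreover have "0 \<cdot>\<^sub>m F (0\<^sub>m n n) = 0\<^sub>m m m"
    using lin_mapD(1)[OF assms, of "0\<^sub>m n n"] by (intro eq_matI) auto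
  ultimately show ?thesis by simp
qed

lemma lin_map_minus:
  assumes "lin_map n m F" "A \<in> carrier_mat n n" "B \<in> carrier_mat n n"
  shows "F (A - B) = F A - F B"
proof -
  have "A - B = A + (-1) \<cdot>\<^sub>m B" using assms by (intro eq_matI) auto
  then have "F (A - B) = F A + (-1) \<cdot>\<^sub>m F B" using assms by (simp add: lin_mapD[OF assms(1)])
  also have "\<dots> = F A - F B"
    using lin_mapD(1)[OF assms(1,2)] lin_mapD(1)[OF assms(1,3)] by (intro eq_matI) auto
  finally show ?thesis .
qed

lemma lin_map_msum:
  assumes "lin_map n m F" "\<And>k. k < K \<Longrightarrow> f k \<in> carrier_mat n n"
  shows "F (msum n K f) = msum m K (\<lambda>k. F (f k))"
  using assms(2)
  by (induction K) (auto simp: msum_0 msum_Suc lin_map_zero[OF assms(1)] lin_mapD[OF assms(1)])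

text \<open>These blocks refer to the first tensor factor, the one amplified in \<open>ampl\<close>,
  whereas \<open>slice\<close> refers to the second.\<close>

lemma mblock_eq_msandwich:
  assumes "X \<in> carrier_mat (k * n) (k * n)" "a < k" "b < k"
  shows "mblock n X a b = (kron (ecol k a) (1\<^sub>m n))\<^sup>\<dagger> * X * kron (ecol k b) (1\<^sub>m n)"
proof (rule eq_matI)
  let ?E = "\<lambda>a. kron (ecol k a) (1\<^sub>m n)"
  have col: "(Y * ?E b) $$ (i,j) = Y $$ (i, b*n+j)"
    if "Y \<in> carrier_mat m (k * n)" "i < m" "j < n" "b < k" for Y m i j b
  proof -
    have "(Y * ?E b) $$ (i,j) = (\<Sum>l<k*n. Y $$ (i,l) * (if l div n = b \<and> l mod n = j then 1 else 0))"
      using that by (auto simp: index_mult_sum index_kron index_ecol div_mod_less intro!: sum.cong)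
    also have "\<dots> = (\<Sum>l<k*n. if l = b*n+j then Y $$ (i,l) else 0)"
    proof (intro sum.cong refl)
      fix l
      have "l div n = b \<and> l mod n = j \<longleftrightarrow> l = b*n+j" using that by auto
      then show "Y $$ (i,l) * (if l div n = b \<and> l mod n = j then 1 else 0) = (if l = b*n+j then Y $$ (i,l) else 0)"
        by auto
    qed
    finally show ?thesis using mult_add_less[OF that(4,3)] by simp
  qed
  fix i j assume "i < dim_row ((?E a)\<^sup>\<dagger> * X * ?E b)" "j < dim_col ((?E a)\<^sup>\<dagger> * X * ?E b)"
  then have ij: "i < n" "j < n" by auto
  have "((?E a)\<^sup>\<dagger> * X * ?E b) $$ (i,j) = ((?E a)\<^sup>\<dagger> * X) $$ (i,b*n+j)"
    by (rule col) (use assms ij in auto)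
  also have "\<dots> = (X\<^sup>\<dagger> * ?E a)\<^sup>\<dagger> $$ (i,b*n+j)" using assms by (simp add: mat_dist)
  also have "\<dots> = cnj ((X\<^sup>\<dagger> * ?E a) $$ (b*n+j,i))"
    using assms ij mult_add_less[OF assms(3) ij(2)] by (subst index_adjoint) auto
  also have "(X\<^sup>\<dagger> * ?E a) $$ (b*n+j,i) = X\<^sup>\<dagger> $$ (b*n+j, a*n+i)"
    by (rule col) (use assms ij mult_add_less[OF assms(3) ij(2)] in auto)
  finally show "mblock n X a b $$ (i,j) = ((?E a)\<^sup>\<dagger> * X * ?E b) $$ (i,j)"
    using assms ij mult_add_less[OF assms(3) ij(2)] mult_add_less[OF assms(2) ij(1)] by (simp add: mblock_def)
qed (auto simp: mblock_def)

lemma mblock_carrier [simp]: "mblock n X a b \<in> carrier_mat n n"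
  by (simp add: mblock_def)

text \<open>The amplification of conjugation by \<open>K\<close> is conjugation by 1 \<otimes> K,
  which preserves positivity. Sums and compositions of such maps supply all the complete positivity
  below.\<close>

lemma cp_map_conj:
  assumes K: "K \<in> carrier_mat m n"
  shows "cp_map n m (\<lambda>X. K * X * K\<^sup>\<dagger>)"
  unfolding cp_map_def
proof (intro allI impI)
  fix k X assume X: "psd (k * n) X"
  have Xc: "X \<in> carrier_mat (k * n) (k * n)" by (rule psd_carrier[OF X])
  define L where "L = kron (1\<^sub>m k) K"
  have L: "L \<in> carrier_mat (k * m) (k * n)" using K by (auto simp: L_def)
  have KE: "K * (kron (ecol k a) (1\<^sub>m n))\<^sup>\<dagger> = (kron (ecol k a) (1\<^sub>m m))\<^sup>\<dagger> * L" for a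
  proof -
    have "kron (1\<^sub>m 1) K = K" using K by (intro eq_matI) (auto simp: index_kron)
    then have "K * (kron (ecol k a) (1\<^sub>m n))\<^sup>\<dagger> = kron (1\<^sub>m 1) K * kron ((ecol k a)\<^sup>\<dagger>) (1\<^sub>m n)"
      by (simp add: kron_adjoint)
    also have "\<dots> = kron ((ecol k a)\<^sup>\<dagger>) (1\<^sub>m m) * kron (1\<^sub>m k) K" using K by (simp add: kron_mult)
    finally show ?thesis by (simp add: L_def kron_adjoint)
  qed
  have KE': "kron (ecol k a) (1\<^sub>m n) * K\<^sup>\<dagger> = L\<^sup>\<dagger> * kron (ecol k a) (1\<^sub>m m)" for a
    using arg_cong[OF KE, of adj a] K L by (simp add: adjoint_mult)
  have "ampl k n m (\<lambda>X. K * X * K\<^sup>\<dagger>) X = L * X * L\<^sup>\<dagger>"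
  proof (rule eq_matI)
    fix i j assume "i < dim_row (L * X * L\<^sup>\<dagger>)" "j < dim_col (L * X * L\<^sup>\<dagger>)"
    then have ij: "i < k * m" "j < k * m" using L by auto
    note d = div_mod_less[OF ij(1)] div_mod_less[OF ij(2)]
    let ?a = "i div m" and ?b = "j div m"
    have "K * mblock n X ?a ?b * K\<^sup>\<dagger> =
        (K * (kron (ecol k ?a) (1\<^sub>m n))\<^sup>\<dagger>) * X * (kron (ecol k ?b) (1\<^sub>m n) * K\<^sup>\<dagger>)"
      using K Xc d by (simp add: mblock_eq_msandwich mat_assoc)
    also have "\<dots> = (kron (ecol k ?a) (1\<^sub>m m))\<^sup>\<dagger> * (L * X * L\<^sup>\<dagger>) * kron (ecol k ?b) (1\<^sub>m m)"
      unfolding KE KE' using K Xc d L by (simp add: mat_assoc)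
    also have "\<dots> = mblock m (L * X * L\<^sup>\<dagger>) ?a ?b"
      using Xc d L by (subst mblock_eq_msandwich[of _ k]) auto
    finally show "ampl k n m (\<lambda>X. K * X * K\<^sup>\<dagger>) X $$ (i,j) = (L * X * L\<^sup>\<dagger>) $$ (i,j)"
      using ij d by (simp add: ampl_def mblock_def)
  qed (use L in \<open>auto simp: ampl_def\<close>)
  then show "psd (k * m) (ampl k n m (\<lambda>X. K * X * K\<^sup>\<dagger>) X)"
    using psd_conj'[OF X L] by simp
qed

lemma cp_map_msum:
  assumes "\<And>j. j < N \<Longrightarrow> cp_map n m (F j)"
  shows "cp_map n m (\<lambda>X. msum m N (\<lambda>j. F j X))"
  unfolding cp_map_def
proof (intro allI impI)
  fix k X assume X: "psd (k * n) X"
  have "ampl k n m (\<lambda>X. msum m N (\<lambda>j. F j X)) X = msum (k * m) N (\<lambda>j. ampl k n m (F j) X)"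
    by (rule eq_matI) (auto simp: ampl_def msum_def div_mod_less)
  then show "psd (k * m) (ampl k n m (\<lambda>X. msum m N (\<lambda>j. F j X)) X)"
    using assms X by (auto simp: cp_map_def intro!: psd_msum)
qed

text \<open>Amplifications evaluate the map on n x n blocks only, so its values elsewhere are
  irrelevant.\<close>

lemma cp_map_cong:
  assumes "\<And>X. X \<in> carrier_mat n n \<Longrightarrow> F X = G X" "cp_map n m F"
  shows "cp_map n m G"
proof -
  have "ampl k n m F = ampl k n m G" for k
    by (auto simp: ampl_def assms(1) fun_eq_iff)
  then show ?thesis using assms(2) by (simp add: cp_map_def)
qed

lemma cp_map_comp:
  assumes "cp_map n m F" "cp_map m p G" "\<And>X. X \<in> carrier_mat n n \<Longrightarrow> F X \<in> carrier_mat m m"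
  shows "cp_map n p (\<lambda>X. G (F X))"
  unfolding cp_map_def
proof (intro allI impI)
  fix k X assume X: "psd (k * n) X"
  have "mblock m (ampl k n m F X) a b = F (mblock n X a b)" if "a < k" "b < k" for a b
  proof -
    have "F (mblock n X a b) \<in> carrier_mat m m" by (rule assms(3)) simp
    then show ?thesis
      using that mult_add_less[of a k _ m] mult_add_less[of b k _ m]
      by (intro eq_matI) (auto simp: mblock_def[of m] ampl_def)
  qed
  then have "ampl k n p (\<lambda>X. G (F X)) X = ampl k m p G (ampl k n m F X)"
    unfolding ampl_def[of _ _ p] by (intro eq_matI) (auto simp: div_mod_less)
  then show "psd (k * p) (ampl k n p (\<lambda>X. G (F X)) X)"
    using assms X by (auto simp: cp_map_def)
qed

lemma cp_map_add:
  assumes "cp_map n m F" "cp_map n m G"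
    "\<And>X. X \<in> carrier_mat n n \<Longrightarrow> F X \<in> carrier_mat m m" "\<And>X. X \<in> carrier_mat n n \<Longrightarrow> G X \<in> carrier_mat m m"
  shows "cp_map n m (\<lambda>X. F X + G X)"
proof -
  have "cp_map n m (\<lambda>X. msum m 2 (\<lambda>j. if j = 0 then F X else G X))"
    using assms(1,2) cp_map_msum[of 2 n m "\<lambda>j. if j = 0 then F else G"] by (simp add: if_distrib[of "\<lambda>f. f _"] cong: if_cong)
  moreover have "msum m 2 (\<lambda>j. if j = 0 then F X else G X) = F X + G X" if "X \<in> carrier_mat n n" for X
    using assms(3,4)[OF that] by (intro eq_matI) (auto simp: msum_def numeral_2_eq_2)
  ultimately show ?thesis by (rule cp_map_cong[rotated]) 
qed

text \<open>Kraus form: the partial trace is a sum of conjugations by the bras of the second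
  factor.\<close>

lemma cp_map_ptrace: "cp_map (n * c) n (ptrace_E n c)"
proof (rule cp_map_cong)
  show "cp_map (n * c) n (\<lambda>X. msum n c (\<lambda>q. (ket n c q)\<^sup>\<dagger> * X * ((ket n c q)\<^sup>\<dagger>)\<^sup>\<dagger>))"
    by (intro cp_map_msum cp_map_conj) (auto intro: ket_carrier)
qed (auto simp: ptrace_eq_msum slice_eq intro!: msum_cong)

section \<open>Structure of matrix *-algebras\<close>

lemma index_adjoint_mult:
  assumes "X \<in> carrier_mat n x" "Y \<in> carrier_mat n y" "i < x" "j < y"
  shows "(X\<^sup>\<dagger> * Y) $$ (i,j) = (\<Sum>k<n. cnj (X $$ (k,i)) * Y $$ (k,j))"
  using assms by (auto simp: index_mult_sum)

definition star_algebra :: "nat \<Rightarrow> complex mat set \<Rightarrow> bool" where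
  "star_algebra n \<A> \<longleftrightarrow> \<A> \<subseteq> carrier_mat n n \<and> 1\<^sub>m n \<in> \<A> \<and>
     (\<forall>X\<in>\<A>. \<forall>Y\<in>\<A>. X + Y \<in> \<A> \<and> X * Y \<in> \<A>) \<and> (\<forall>X\<in>\<A>. X\<^sup>\<dagger> \<in> \<A> \<and> (\<forall>c. c \<cdot>\<^sub>m X \<in> \<A>))"

lemma star_algebraD:
  assumes "star_algebra n \<A>"
  shows "X \<in> \<A> \<Longrightarrow> X \<in> carrier_mat n n" "1\<^sub>m n \<in> \<A>" "X \<in> \<A> \<Longrightarrow> Y \<in> \<A> \<Longrightarrow> X + Y \<in> \<A>"
    "X \<in> \<A> \<Longrightarrow> Y \<in> \<A> \<Longrightarrow> X * Y \<in> \<A>" "X \<in> \<A> \<Longrightarrow> X\<^sup>\<dagger> \<in> \<A>" "X \<in> \<A> \<Longrightarrow> c \<cdot>\<^sub>m X \<in> \<A>"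
  using assms by (auto simp: star_algebra_def)

lemma star_algebra_minus:
  assumes "star_algebra n \<A>" "X \<in> \<A>" "Y \<in> \<A>"
  shows "X - Y \<in> \<A>"
proof -
  have "X - Y = X + (-1) \<cdot>\<^sub>m Y"
    using star_algebraD(1)[OF assms(1)] assms by (intro eq_matI) auto
  then show ?thesis using assms by (simp add: star_algebraD(3,6)[OF assms(1)])
qed

lemma star_algebra_msum:
  assumes "star_algebra n \<A>" "\<And>k. k < K \<Longrightarrow> f k \<in> \<A>"
  shows "msum n K f \<in> \<A>"
proof (rule msum_mem)
  have "0\<^sub>m n n = 0 \<cdot>\<^sub>m (1\<^sub>m n :: complex mat)" by (rule eq_matI) auto
  also have "\<dots> \<in> \<A>" using star_algebraD(2,6)[OF assms(1)] by simp
  finally show "0\<^sub>m n n \<in> \<A>" .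
qed (use star_algebraD[OF assms(1)] assms(2) in auto)

text \<open>Comparing traces of the two complementary projections gives the dimension count
  \<open>n = d + e\<close>, on which the later descents rely.\<close>

lemma complement_factor:
  assumes "isometry n d V"
  obtains e J where "isometry n e J" "J * J\<^sup>\<dagger> = 1\<^sub>m n - V * V\<^sup>\<dagger>" "V\<^sup>\<dagger> * J = 0\<^sub>m d e" "n = d + e"
proof -
  have V: "V \<in> carrier_mat n d" and o: "V\<^sup>\<dagger> * V = 1\<^sub>m d" using assms by (auto simp: isometry_def)
  let ?D = "1\<^sub>m n - V * V\<^sup>\<dagger>"
  have "?D * ?D = ?D" using V isometry_projection[OF assms] by (simp add: mat_dist)
  moreover have "?D\<^sup>\<dagger> = ?D" using V by (simp add: mat_dist)
  moreover have "?D \<in> carrier_mat n n" using V by (intro carrier_matI) auto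
  ultimately obtain e J where J: "isometry n e J" "J * J\<^sup>\<dagger> = ?D"
    using projection_factor[of ?D n] by blast
  have Jc: "J \<in> carrier_mat n e" and Jo: "J\<^sup>\<dagger> * J = 1\<^sub>m e" using J by (auto simp: isometry_def)
  have "V\<^sup>\<dagger> * J = V\<^sup>\<dagger> * (J * J\<^sup>\<dagger>) * J" using V Jc Jo by (simp add: mat_assoc)
  also have "V\<^sup>\<dagger> * (J * J\<^sup>\<dagger>) = 0\<^sub>m d n"
    unfolding J(2) using V o by (simp add: mat_minus_right mat_assoc[symmetric])
  finally have VJ: "V\<^sup>\<dagger> * J = 0\<^sub>m d e" using Jc by simp
  have "of_nat e = mtrace ?D" using isometry_trace[OF J(1)] J(2) by simp
  also have "\<dots> = of_nat n - of_nat d"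
    using V isometry_trace[OF assms] by (subst mtrace_minus[of _ n]) auto
  finally have "complex_of_nat n = of_nat (d + e)" by (simp add: algebra_simps)
  then have "n = d + e" by (simp only: of_nat_eq_iff)
  with J VJ that show thesis by blast
qed

text \<open>Existence of a minimal projection, with no spectral calculus inside the algebra:
  minimise the dimension of a subspace containing the range of a nonzero element. Any element living
  in that subspace that loses a direction must vanish, and applied to shifts by an eigenvalue this
  makes everything there scalar.\<close>

lemma minimal_projection:
  assumes alg: "star_algebra n \<A>" and n: "n > 0"
  shows "\<exists>b J. b > 0 \<and> isometry n b J \<and> J * J\<^sup>\<dagger> \<in> \<A> \<and> (\<forall>B\<in>\<A>. \<exists>c. J\<^sup>\<dagger> * B * J = c \<cdot>\<^sub>m 1\<^sub>m b)"
proof -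
  note algD = star_algebraD[OF alg]
  \<comment> \<open>\<open>R b\<close> says that some b-dimensional subspace contains the range of a
    nonzero element of the algebra; the least such \<open>b\<close> is used.\<close>
  define R where "R b \<longleftrightarrow> (\<exists>J Y. isometry n b J \<and> Y \<in> \<A> \<and> Y \<noteq> 0\<^sub>m n n \<and> J * (J\<^sup>\<dagger> * Y) = Y)" for b
  have "(1\<^sub>m n :: complex mat) $$ (0,0) \<noteq> 0\<^sub>m n n $$ (0,0)" using n by simp
  then have "1\<^sub>m n \<noteq> (0\<^sub>m n n :: complex mat)" by metis
  then have "R n" using algD(2) unfolding R_def isometry_def
    by (intro exI[of _ "1\<^sub>m n"]) auto
  define b where "b = (LEAST b. R b)"
  have "R b" unfolding b_def by (rule LeastI[of R, OF \<open>R n\<close>])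
  then obtain J Y where J: "isometry n b J" and Y: "Y \<in> \<A>" "Y \<noteq> 0\<^sub>m n n" "J * (J\<^sup>\<dagger> * Y) = Y"
    by (auto simp: R_def)
  have Jc: "J \<in> carrier_mat n b" and Jo: "J\<^sup>\<dagger> * J = 1\<^sub>m b" using J by (auto simp: isometry_def)
  have Jcan: "J\<^sup>\<dagger> * (J * X) = X" if "dim_row X = b" for X
    using that Jc Jo by (simp add: mat_assoc[symmetric])
  have Yc: "Y \<in> carrier_mat n n" using Y algD by auto
  have b0: "b > 0"
  proof (rule ccontr)
    assume "\<not> b > 0"
    then have "J * (J\<^sup>\<dagger> * Y) = 0\<^sub>m n n" using Yc Jc
      by (intro eq_matI) (auto simp: index_mult_sum[of _ J])
    then show False using Y by simp
  qed
  \<comment> \<open>If \<open>J * w\<close> were orthogonal to the range of a nonzero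
    \<open>Y'\<close>, removing that direction from the subspace would leave dimension b - 1,
    against minimality.\<close>
  have key: "Y' = 0\<^sub>m n n" if Y': "Y' \<in> \<A>" "J * (J\<^sup>\<dagger> * Y') = Y'"
    and w: "isometry b 1 w" "Y'\<^sup>\<dagger> * (J * w) = 0\<^sub>m n 1" for Y' w
  proof (rule ccontr)
    assume nz: "Y' \<noteq> 0\<^sub>m n n"
    have Y'c: "Y' \<in> carrier_mat n n" using Y' algD by auto
    have wc: "w \<in> carrier_mat b 1" using w by (auto simp: isometry_def)
    from complement_factor[OF w(1)] obtain e K where K: "isometry b e K" "K * K\<^sup>\<dagger> = 1\<^sub>m b - w * w\<^sup>\<dagger>" "b = 1 + e"
      by metis
    have Kc: "K \<in> carrier_mat b e" using K by (auto simp: isometry_def)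
    have "w\<^sup>\<dagger> * (J\<^sup>\<dagger> * Y') = (Y'\<^sup>\<dagger> * (J * w))\<^sup>\<dagger>" using wc Jc Y'c by (simp add: mat_dist)
    then have wz: "w\<^sup>\<dagger> * (J\<^sup>\<dagger> * Y') = 0\<^sub>m 1 n" using w by simp
    have "(J * K) * ((J * K)\<^sup>\<dagger> * Y') = J * ((K * K\<^sup>\<dagger>) * (J\<^sup>\<dagger> * Y'))"
      using Jc Kc Y'c by (simp add: mat_dist)
    also have "\<dots> = J * (J\<^sup>\<dagger> * Y') - J * (w * (w\<^sup>\<dagger> * (J\<^sup>\<dagger> * Y')))"
      unfolding K(2) using Jc wc Y'c by (simp add: mat_minus_right mat_minus_left mat_assoc)
    also have "\<dots> = Y'" unfolding wz Y'(2) using Jc wc Y'c by simp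
    finally have "R e" unfolding R_def using isometry_mult[OF J K(1)] Y' nz by blast
    then have "b \<le> e" unfolding b_def by (rule Least_le)
    then show False using K(3) by simp
  qed
  define A where "A = Y * Y\<^sup>\<dagger>"
  have A: "A \<in> \<A>" using Y algD by (simp add: A_def)
  have Ac: "A \<in> carrier_mat n n" and Ah: "A\<^sup>\<dagger> = A" using Yc by (auto simp: A_def mat_dist)
  have Anz: "A \<noteq> 0\<^sub>m n n"
  proof
    assume "A = 0\<^sub>m n n"
    then have "(Y\<^sup>\<dagger>)\<^sup>\<dagger> * Y\<^sup>\<dagger> = 0\<^sub>m n n" by (simp add: A_def)
    then have "Y\<^sup>\<dagger> = 0\<^sub>m n n" using gram_eq_0[of "Y\<^sup>\<dagger>" n n] Yc by simp
    then have "(Y\<^sup>\<dagger>)\<^sup>\<dagger> = 0\<^sub>m n n" by simp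
    then show False using Y(2) by simp
  qed
  have AJ: "J * (J\<^sup>\<dagger> * A) = A"
  proof -
    have "J * (J\<^sup>\<dagger> * A) = (J * (J\<^sup>\<dagger> * Y)) * Y\<^sup>\<dagger>" using Jc Yc by (simp add: A_def mat_assoc)
    then show ?thesis unfolding Y(3) by (simp add: A_def)
  qed
  obtain w l where w: "isometry b 1 w" "(J\<^sup>\<dagger> * (A * J)) * w = l \<cdot>\<^sub>m w"
    using eigen_column[of "J\<^sup>\<dagger> * (A * J)" b] Ac Jc b0 by auto
  have wc: "w \<in> carrier_mat b 1" using w by (auto simp: isometry_def)
  have Av: "A * (J * w) = l \<cdot>\<^sub>m (J * w)"
  proof -
    have "A * (J * w) = (J * (J\<^sup>\<dagger> * A)) * (J * w)" unfolding AJ ..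
    also have "\<dots> = J * ((J\<^sup>\<dagger> * (A * J)) * w)" using Ac Jc wc by (simp add: mat_assoc)
    also have "\<dots> = l \<cdot>\<^sub>m (J * w)" unfolding w(2) using Jc wc by (simp add: mat_dist)
    finally show ?thesis .
  qed
  \<comment> \<open>The adjoint of this element annihilates the eigenvector \<open>J * w\<close>, so
    \<open>key\<close> makes it zero and \<open>A\<close> becomes a multiple of a
    projection.\<close>
  have "A * A - cnj l \<cdot>\<^sub>m A = 0\<^sub>m n n"
  proof (rule key[OF _ _ w(1)])
    show "A * A - cnj l \<cdot>\<^sub>m A \<in> \<A>" using A algD star_algebra_minus[OF alg] by auto
    have "J * (J\<^sup>\<dagger> * (A * A - cnj l \<cdot>\<^sub>m A)) = (J * (J\<^sup>\<dagger> * A)) * A - cnj l \<cdot>\<^sub>m (J * (J\<^sup>\<dagger> * A))"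
      using Ac Jc by (simp add: mat_dist)
    then show "J * (J\<^sup>\<dagger> * (A * A - cnj l \<cdot>\<^sub>m A)) = A * A - cnj l \<cdot>\<^sub>m A" unfolding AJ .
    have "(A * A - cnj l \<cdot>\<^sub>m A)\<^sup>\<dagger> * (J * w) = A * (A * (J * w)) - l \<cdot>\<^sub>m (A * (J * w))"
      using Ac Ah Jc wc by (simp add: mat_dist)
    also have "\<dots> = 0\<^sub>m n 1" unfolding Av using Ac Jc wc by (simp add: mat_dist Av)
    finally show "(A * A - cnj l \<cdot>\<^sub>m A)\<^sup>\<dagger> * (J * w) = 0\<^sub>m n 1" .
  qed
  then have AA: "A * A = cnj l \<cdot>\<^sub>m A" using Ac by - (rule mat_eq_of_minus, assumption, auto)
  have l0: "l \<noteq> 0"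
  proof
    assume "l = 0"
    then have "cnj l \<cdot>\<^sub>m A = 0\<^sub>m n n" using Ac by (intro eq_matI) auto
    then have "A\<^sup>\<dagger> * A = 0\<^sub>m n n" unfolding Ah AA .
    then show False using gram_eq_0[OF Ac] Anz by simp
  qed
  obtain i j where ij: "i < n" "j < n" "A $$ (i,j) \<noteq> 0"
    using Ac Anz by (metis carrier_matD eq_matI index_zero_mat)
  have "(A * A)\<^sup>\<dagger> = A * A" using Ac Ah by (simp add: mat_dist)
  then have "l \<cdot>\<^sub>m A = cnj l \<cdot>\<^sub>m A" unfolding AA using Ah by simp
  then have "(l \<cdot>\<^sub>m A) $$ (i,j) = (cnj l \<cdot>\<^sub>m A) $$ (i,j)" by simp
  then have lr: "cnj l = l" using ij Ac by simp
  define e where "e = (1 / l) \<cdot>\<^sub>m A"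
  have e: "e \<in> \<A>" using A algD by (simp add: e_def)
  have ec: "e \<in> carrier_mat n n" using Ac by (simp add: e_def)
  have eh: "e\<^sup>\<dagger> = e" using Ah lr by (simp add: e_def)
  have ee: "e * e = e" using AA lr l0 Ac by (simp add: e_def mat_dist)
  have eJ: "J * (J\<^sup>\<dagger> * e) = e" using AJ Ac Jc by (simp add: e_def mat_dist)
  have enz: "e \<noteq> 0\<^sub>m n n"
  proof
    assume "e = 0\<^sub>m n n"
    then have "e $$ (i,j) = 0" using ij by simp
    then show False using ij l0 Ac by (simp add: e_def)
  qed
  have Je: "e * (J * J\<^sup>\<dagger>) = e"
    using arg_cong[OF eJ, of adj] ec Jc by (simp add: mat_dist eh)
  \<comment> \<open>Otherwise the subspace contains a unit vector orthogonal to the range of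
    \<open>e\<close>, and \<open>key\<close> would give \<open>e = 0\<close>.\<close>
  have eeq: "J * J\<^sup>\<dagger> = e"
  proof (rule ccontr)
    assume ne: "J * J\<^sup>\<dagger> \<noteq> e"
    define E where "E = J * J\<^sup>\<dagger> - e"
    have Ec: "E \<in> carrier_mat n n" using Jc ec by (auto simp: E_def)
    have eE: "e * E = 0\<^sub>m n n" using Je ee ec Jc by (simp add: E_def mat_minus_right)
    have JE: "(J * J\<^sup>\<dagger>) * E = E"
      using isometry_projection[OF J] eJ ec Jc unfolding E_def
      by (subst mat_minus_right) (auto simp: mat_assoc)
    have "E * E = (J * J\<^sup>\<dagger>) * E - e * E" using ec Jc Ec unfolding E_def by (subst mat_minus_left) auto
    then have EE: "E * E = E" using JE eE Ec by simp
    have "E \<noteq> 0\<^sub>m n n" using ne mat_eq_of_minus[of "J * J\<^sup>\<dagger>" e n n] Jc ec by (auto simp: E_def)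
    from projection_unit_column[OF Ec EE this] obtain v where v: "isometry n 1 v" "E * v = v" by auto
    have vc: "v \<in> carrier_mat n 1" using v by (auto simp: isometry_def)
    have "(J * J\<^sup>\<dagger>) * v = ((J * J\<^sup>\<dagger>) * E) * v" using v vc Ec Jc by (simp add: mat_assoc)
    then have Jv: "J * (J\<^sup>\<dagger> * v) = v" unfolding JE using v vc Jc by (simp add: mat_assoc)
    have "e * v = (e * E) * v" using v vc Ec ec by (simp add: mat_assoc)
    then have ev: "e * v = 0\<^sub>m n 1" unfolding eE using vc by simp
    have "(J\<^sup>\<dagger> * v)\<^sup>\<dagger> * (J\<^sup>\<dagger> * v) = v\<^sup>\<dagger> * (J * (J\<^sup>\<dagger> * v))" using vc Jc by (simp add: mat_dist)
    then have "isometry b 1 (J\<^sup>\<dagger> * v)" using v(1) vc Jc unfolding Jv by (auto simp: isometry_def)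
    from key[OF e eJ this] show False using ev enz Jv eh by simp
  qed
  have "\<exists>c. J\<^sup>\<dagger> * B * J = c \<cdot>\<^sub>m 1\<^sub>m b" if B: "B \<in> \<A>" for B
  proof -
    have Bc: "B \<in> carrier_mat n n" using B algD by auto
    define H where "H = e * (B * e)"
    have H: "H \<in> \<A>" using B e algD by (simp add: H_def)
    have Hc: "H \<in> carrier_mat n n" using H algD by auto
    obtain w l where w: "isometry b 1 w" "(J\<^sup>\<dagger> * (B\<^sup>\<dagger> * J)) * w = l \<cdot>\<^sub>m w"
      using eigen_column[of "J\<^sup>\<dagger> * (B\<^sup>\<dagger> * J)" b] Bc Jc b0 by auto
    have wc: "w \<in> carrier_mat b 1" using w by (auto simp: isometry_def)
    have ew: "e * (J * w) = J * w" unfolding eeq[symmetric] using Jc wc by (simp add: mat_assoc Jcan)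
    \<comment> \<open>\<open>key\<close> tests adjoints, so the eigenvector is one for the
      compression of \<open>B\<^sup>\<dagger>\<close>; the scalar obtained for \<open>B\<close> is
      the conjugate.\<close>
    have "H - cnj l \<cdot>\<^sub>m e = 0\<^sub>m n n"
    proof (rule key[OF _ _ w(1)])
      show "H - cnj l \<cdot>\<^sub>m e \<in> \<A>" using H e algD star_algebra_minus[OF alg] by auto
      have "J * (J\<^sup>\<dagger> * H) = (J * (J\<^sup>\<dagger> * e)) * (B * e)" using Jc ec Bc by (simp add: H_def mat_assoc)
      then have JH: "J * (J\<^sup>\<dagger> * H) = H" unfolding eJ by (simp add: H_def)
      show "J * (J\<^sup>\<dagger> * (H - cnj l \<cdot>\<^sub>m e)) = H - cnj l \<cdot>\<^sub>m e"
        using Jc Hc ec JH eJ by (simp add: mat_dist)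
      have "H\<^sup>\<dagger> * (J * w) = e * (B\<^sup>\<dagger> * (e * (J * w)))"
        using ec Bc Jc wc eh by (simp add: H_def mat_dist)
      also have "\<dots> = J * ((J\<^sup>\<dagger> * (B\<^sup>\<dagger> * J)) * w)"
        unfolding ew using Bc Jc wc by (simp add: eeq[symmetric] mat_assoc)
      also have "\<dots> = l \<cdot>\<^sub>m (J * w)" unfolding w(2) using Jc wc by (simp add: mat_dist)
      finally have Hv: "H\<^sup>\<dagger> * (J * w) = l \<cdot>\<^sub>m (J * w)" .
      have "(H - cnj l \<cdot>\<^sub>m e)\<^sup>\<dagger> * (J * w) = H\<^sup>\<dagger> * (J * w) - l \<cdot>\<^sub>m (e * (J * w))"
        using Hc ec Jc wc eh by (simp add: mat_dist)
      then show "(H - cnj l \<cdot>\<^sub>m e)\<^sup>\<dagger> * (J * w) = 0\<^sub>m n 1"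
        unfolding Hv ew using Jc wc by simp
    qed
    then have He: "H = cnj l \<cdot>\<^sub>m e" using Hc ec by - (rule mat_eq_of_minus, assumption, auto)
    have "J\<^sup>\<dagger> * B * J = J\<^sup>\<dagger> * H * J"
      using Jc Bc by (simp add: H_def eeq[symmetric] mat_assoc Jcan Jo)
    also have "\<dots> = cnj l \<cdot>\<^sub>m 1\<^sub>m b"
      unfolding He using Jc Jo by (simp add: eeq[symmetric] mat_dist Jcan)
    finally show ?thesis by blast
  qed
  then show ?thesis using b0 J e eeq by auto
qed

lemma mult_block_index:
  assumes "X \<in> carrier_mat m (a * b)" "y \<in> carrier_mat a c" "i < m" "j < c" "l < b"
  shows "(X * kron y (1\<^sub>m b)) $$ (i, j*b+l) = (\<Sum>k<a. y $$ (k,j) * X $$ (i, k*b+l))"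
proof -
  have jl: "j*b+l < c*b" by (rule mult_add_less[OF assms(4,5)])
  have "(X * kron y (1\<^sub>m b)) $$ (i, j*b+l) =
      (\<Sum>k<a*b. X $$ (i, k div b * b + k mod b) * (y $$ (k div b, j) * (if k mod b = l then 1 else 0)))"
    using assms jl by (auto simp: index_mult_sum index_kron div_mod_less intro!: sum.cong)
  also have "\<dots> = (\<Sum>k<a. \<Sum>p<b. X $$ (i, k*b+p) * (y $$ (k, j) * (if p = l then 1 else 0)))"
    by (rule sum_div_mod)
  also have "\<dots> = (\<Sum>k<a. \<Sum>p<b. if p = l then y $$ (k,j) * X $$ (i, k*b+p) else 0)"
    by (intro sum.cong) auto
  finally show ?thesis using assms(5) by simp
qed

lemma msum_mult_index:
  assumes "\<And>k. k < K \<Longrightarrow> f k \<in> carrier_mat N N" "A \<in> carrier_mat N m" "i < N" "j < m"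
  shows "(msum N K f * A) $$ (i,j) = (\<Sum>k<K. (f k * A) $$ (i,j))"
proof -
  have "(msum N K f * A) $$ (i,j) = (\<Sum>l<N. \<Sum>k<K. f k $$ (i,l) * A $$ (l,j))"
    using assms by (auto simp: index_mult_sum msum_def sum_distrib_right)
  also have "\<dots> = (\<Sum>k<K. \<Sum>l<N. f k $$ (i,l) * A $$ (l,j))" by (rule sum.swap)
  also have "\<dots> = (\<Sum>k<K. (f k * A) $$ (i,j))"
    using assms by (intro sum.cong) (auto simp: index_mult_sum dest!: assms(1))
  finally show ?thesis .
qed

text \<open>Collect as many mutually orthogonal copies of the minimal subspace as the algebra can
  produce. Minimality makes any remainder a multiple of an isometry, so by maximality the copies
  span an invariant subspace. The algebra permutes and mixes copies without touching the inside of a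
  copy, which is the form y \<otimes> 1.\<close>

lemma irreducible_block:
  assumes alg: "star_algebra n \<A>" and n: "n > 0"
  shows "\<exists>a b V. a > 0 \<and> b > 0 \<and> isometry n (a * b) V \<and>
    (\<forall>Y\<in>\<A>. \<exists>y\<in>carrier_mat a a. Y * V = V * kron y (1\<^sub>m b)) \<and>
    (\<forall>y\<in>carrier_mat a a. V * kron y (1\<^sub>m b) * V\<^sup>\<dagger> \<in> \<A>)"
proof -
  note algD = star_algebraD[OF alg]
  obtain b J where b0: "b > 0" and J: "isometry n b J" "J * J\<^sup>\<dagger> \<in> \<A>"
    and sc: "\<And>B. B \<in> \<A> \<Longrightarrow> \<exists>c. J\<^sup>\<dagger> * B * J = c \<cdot>\<^sub>m 1\<^sub>m b"
    using minimal_projection[OF assms] by blast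
  have Jc: "J \<in> carrier_mat n b" and Jo: "J\<^sup>\<dagger> * J = 1\<^sub>m b" using J by (auto simp: isometry_def)
  \<comment> \<open>Each \<open>Z j\<close> carries the range of \<open>J\<close> isometrically onto
    a copy, and different copies are orthogonal.\<close>
  define R where "R a Z \<longleftrightarrow> (\<forall>j<a. Z j \<in> \<A>) \<and>
    (\<forall>i<a. \<forall>j<a. (Z i * J)\<^sup>\<dagger> * (Z j * J) = (if i = j then 1\<^sub>m b else 0\<^sub>m b b))" for a :: nat and Z
  \<comment> \<open>Column j*b+l is column l of \<open>Z j * J\<close>: the first tensor index names
    the copy, the second the position in it, as in the ordering of \<open>kron\<close>.\<close>
  define W where "W a Z = mat n (a * b) (\<lambda>(i,q). (Z (q div b) * J) $$ (i, q mod b))" for a and Z :: "nat \<Rightarrow> complex mat"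
  have Wc: "W a Z \<in> carrier_mat n (a * b)" for a Z by (simp add: W_def)
  have Wi: "W a Z $$ (i, j*b+l) = (Z j * J) $$ (i,l)" if "i < n" "j < a" "l < b" for a Z i j l
    using that mult_add_less[OF that(2,3)] by (simp add: W_def)
  have Wiso: "isometry n (a * b) (W a Z)" if R: "R a Z" for a Z
  proof -
    have Zc: "Z j * J \<in> carrier_mat n b" if "j < a" for j using R that algD(1)[of "Z j"] Jc by (auto simp: R_def)
    have "(W a Z)\<^sup>\<dagger> * W a Z = 1\<^sub>m (a * b)"
    proof (rule eq_matI)
      fix p q assume "p < dim_row (1\<^sub>m (a*b) :: complex mat)" "q < dim_col (1\<^sub>m (a*b) :: complex mat)"
      then have pq: "p < a * b" "q < a * b" by auto
      note d = div_mod_less[OF pq(1)] div_mod_less[OF pq(2)]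
      have "((W a Z)\<^sup>\<dagger> * W a Z) $$ (p,q) = (\<Sum>k<n. cnj (W a Z $$ (k,p)) * W a Z $$ (k,q))"
        using pq Wc[of a Z] by (auto simp: index_mult_sum)
      also have "\<dots> = (\<Sum>k<n. cnj ((Z (p div b) * J) $$ (k, p mod b)) * (Z (q div b) * J) $$ (k, q mod b))"
        using pq by (intro sum.cong) (auto simp: W_def)
      also have "\<dots> = ((Z (p div b) * J)\<^sup>\<dagger> * (Z (q div b) * J)) $$ (p mod b, q mod b)"
        by (rule index_adjoint_mult[symmetric]) (use d Zc in auto)
      also have "\<dots> = (if p div b = q div b then 1\<^sub>m b else 0\<^sub>m b b) $$ (p mod b, q mod b)"
        using R d by (simp add: R_def)
      also have "\<dots> = 1\<^sub>m (a*b) $$ (p,q)"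
      proof -
        have "p = q" if "p div b = q div b" "p mod b = q mod b" using that by (metis div_mult_mod_eq)
        then show ?thesis using pq d by auto
      qed
      finally show "((W a Z)\<^sup>\<dagger> * W a Z) $$ (p,q) = 1\<^sub>m (a*b) $$ (p,q)" .
    qed (use Wc[of a Z] in auto)
    then show ?thesis using Wc by (simp add: isometry_def)
  qed
  have Rle: "a \<le> n" if "R a Z" for a Z
  proof -
    have "a \<le> a * b" using b0 by (cases b) auto
    then show ?thesis using isometry_le[OF Wiso[OF that]] by (rule le_trans)
  qed
  have "R 1 (\<lambda>_. J * J\<^sup>\<dagger>)"
  proof -
    have "J * J\<^sup>\<dagger> * J = J" using Jc Jo by (simp add: mat_assoc)
    then show ?thesis using J(2) Jo by (simp add: R_def)
  qed
  then have R1: "\<exists>Z. R 1 Z" by blast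
  have "\<exists>a. (\<exists>Z. R a Z) \<and> (\<forall>e. (\<exists>Z. R e Z) \<longrightarrow> e \<le> a)"
    using ex_has_greatest_nat[of "\<lambda>a. \<exists>Z. R a Z" 1 id "Suc n"] R1 Rle by (auto simp: less_Suc_eq_le)
  then obtain a Z where Z: "R a Z" and mx: "\<And>e Z. R e Z \<Longrightarrow> e \<le> a" by blast
  have a0: "a > 0" using mx R1 by fastforce
  have ZA: "Z j \<in> \<A>" "Z j \<in> carrier_mat n n" if "j < a" for j using Z that algD by (auto simp: R_def)
  define V where "V = W a Z"
  have Vc: "V \<in> carrier_mat n (a * b)" by (simp add: V_def Wc)
  have expand: "\<exists>c. Y * J = msum n a (\<lambda>i. c i \<cdot>\<^sub>m Z i) * J" if Y: "Y \<in> \<A>" for Y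
  proof -
    have Yc: "Y \<in> carrier_mat n n" using Y algD by auto
    have "\<forall>i<a. \<exists>c. J\<^sup>\<dagger> * ((Z i)\<^sup>\<dagger> * Y) * J = c \<cdot>\<^sub>m 1\<^sub>m b" using sc ZA Y algD by auto
    then obtain c where c: "\<And>i. i < a \<Longrightarrow> J\<^sup>\<dagger> * ((Z i)\<^sup>\<dagger> * Y) * J = c i \<cdot>\<^sub>m 1\<^sub>m b" by metis
    \<comment> \<open>\<open>S * J\<close> is the projection of \<open>Y * J\<close> to the copies;
      its coefficients are the scalars provided by minimality.\<close>
    define S where "S = msum n a (\<lambda>i. c i \<cdot>\<^sub>m Z i)"
    have S: "S \<in> \<A>" unfolding S_def by (intro star_algebra_msum[OF alg] algD(6) ZA)
    define D where "D = Y - S"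
    have D: "D \<in> \<A>" unfolding D_def by (rule star_algebra_minus[OF alg Y S])
    have Dc: "D \<in> carrier_mat n n" and Sc: "S \<in> carrier_mat n n" using D S algD by auto
    have orth: "(Z i * J)\<^sup>\<dagger> * (D * J) = 0\<^sub>m b b" if i: "i < a" for i
    proof -
      have Zi: "Z i \<in> carrier_mat n n" using ZA i by auto
      let ?L = "J\<^sup>\<dagger> * (Z i)\<^sup>\<dagger>"
      have "?L * S * J = msum b a (\<lambda>k. ?L * (c k \<cdot>\<^sub>m Z k) * J)"
        unfolding S_def using Jc Zi ZA by (intro msum_sandwich) auto
      also have "\<dots> = ?L * (c i \<cdot>\<^sub>m Z i) * J"
      proof (rule msum_single[OF i])
        fix k assume k: "k < a" "k \<noteq> i"
        have "?L * (c k \<cdot>\<^sub>m Z k) * J = c k \<cdot>\<^sub>m ((Z i * J)\<^sup>\<dagger> * (Z k * J))"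
          using Jc Zi ZA(2)[OF k(1)] by (simp add: mat_dist)
        then show "?L * (c k \<cdot>\<^sub>m Z k) * J = 0\<^sub>m b b" using Z k i by (simp add: R_def)
      qed (use Jc Zi in auto)
      also have "\<dots> = c i \<cdot>\<^sub>m ((Z i * J)\<^sup>\<dagger> * (Z i * J))"
        using Jc Zi by (simp add: mat_dist)
      also have "\<dots> = c i \<cdot>\<^sub>m 1\<^sub>m b" using Z i by (simp add: R_def)
      finally have LS: "?L * S * J = c i \<cdot>\<^sub>m 1\<^sub>m b" .
      have "(Z i * J)\<^sup>\<dagger> * (D * J) = J\<^sup>\<dagger> * ((Z i)\<^sup>\<dagger> * Y) * J - ?L * S * J"
        unfolding D_def using Jc Zi Yc Sc by (simp add: mat_dist)
      then show ?thesis unfolding LS c[OF i] by simp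
    qed
    \<comment> \<open>Minimality again: \<open>D * J\<close> is a multiple of an isometry, and if
      nonzero it could be normalised to one more copy.\<close>
    obtain d where d: "J\<^sup>\<dagger> * (D\<^sup>\<dagger> * D) * J = d \<cdot>\<^sub>m 1\<^sub>m b"
      using sc[OF algD(4)[OF algD(5)[OF D] D]] by blast
    have "(D * J)\<^sup>\<dagger> * (D * J) = J\<^sup>\<dagger> * (D\<^sup>\<dagger> * D) * J" using Dc Jc by (simp add: mat_dist)
    then have DD: "(D * J)\<^sup>\<dagger> * (D * J) = d \<cdot>\<^sub>m 1\<^sub>m b" using d by simp
    have "D * J = 0\<^sub>m n b"
    proof (rule ccontr)
      assume "D * J \<noteq> 0\<^sub>m n b"
      moreover have "D * J \<in> carrier_mat n b" using Dc Jc by auto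
      ultimately obtain t where t: "isometry n b (t \<cdot>\<^sub>m (D * J))"
        using isometry_scale[OF _ DD] by blast
      have tD: "(t \<cdot>\<^sub>m D) * J = t \<cdot>\<^sub>m (D * J)" using Dc Jc by (simp add: mat_dist)
      have o1: "(Z i * J)\<^sup>\<dagger> * (t \<cdot>\<^sub>m (D * J)) = 0\<^sub>m b b" if "i < a" for i
      proof -
        have "(Z i * J)\<^sup>\<dagger> * (t \<cdot>\<^sub>m (D * J)) = t \<cdot>\<^sub>m ((Z i * J)\<^sup>\<dagger> * (D * J))"
          using Dc Jc ZA(2)[OF that] by (intro mat_smult_right) auto
        then show ?thesis using orth[OF that] by simp
      qed
      have o2: "(t \<cdot>\<^sub>m (D * J))\<^sup>\<dagger> * (Z i * J) = 0\<^sub>m b b" if "i < a" for i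
      proof -
        have "(t \<cdot>\<^sub>m (D * J))\<^sup>\<dagger> * (Z i * J) = ((Z i * J)\<^sup>\<dagger> * (t \<cdot>\<^sub>m (D * J)))\<^sup>\<dagger>"
          using Dc Jc ZA(2)[OF that] by (simp add: adjoint_mult[of "(Z i * J)\<^sup>\<dagger>"])
        then show ?thesis using o1[OF that] by simp
      qed
      have "R (Suc a) (Z(a := t \<cdot>\<^sub>m D))"
        unfolding R_def using Z t o1 o2 algD(6)[OF D, of t]
        by (auto simp: less_Suc_eq R_def tD isometry_def)
      from mx[OF this] show False by simp
    qed
    then have "Y * J - S * J = 0\<^sub>m n b" using Yc Sc Jc by (simp add: D_def mat_minus_left)
    then have "Y * J = S * J" using Yc Sc Jc by - (rule mat_eq_of_minus, assumption, auto)
    then show ?thesis unfolding S_def by blast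
  qed
  have part1: "\<exists>y\<in>carrier_mat a a. Y * V = V * kron y (1\<^sub>m b)" if Y: "Y \<in> \<A>" for Y
  proof -
    have Yc: "Y \<in> carrier_mat n n" using Y algD by auto
    have "\<forall>j<a. \<exists>c. (Y * Z j) * J = msum n a (\<lambda>i. c i \<cdot>\<^sub>m Z i) * J"
      using expand[OF algD(4)[OF Y ZA(1)]] by blast
    then obtain c where c: "\<And>j. j < a \<Longrightarrow> (Y * Z j) * J = msum n a (\<lambda>i. c j i \<cdot>\<^sub>m Z i) * J" by metis
    define y where "y = mat a a (\<lambda>(i,j). c j i)"
    have y: "y \<in> carrier_mat a a" by (simp add: y_def)
    have "Y * V = V * kron y (1\<^sub>m b)"
    proof (rule eq_matI)
      fix r q assume "r < dim_row (V * kron y (1\<^sub>m b))" "q < dim_col (V * kron y (1\<^sub>m b))"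
      then have rq: "r < n" "q < a * b" using Vc y by auto
      define j l where "j = q div b" and "l = q mod b"
      have q: "q = j*b+l" "j < a" "l < b" using div_mod_less[OF rq(2)] by (auto simp: j_def l_def)
      have "(Y * V) $$ (r,q) = (\<Sum>k<n. Y $$ (r,k) * (Z j * J) $$ (k,l))"
        unfolding q(1) using rq q Vc Yc mult_add_less[OF q(2,3)]
        by (subst index_mult_sum) (auto simp: V_def Wi)
      also have "\<dots> = ((Y * Z j) * J) $$ (r,l)"
        using rq q Yc Jc ZA(2)[OF q(2)] by (simp add: mat_assoc index_mult_sum[of _ Y])
      also have "\<dots> = (\<Sum>i<a. ((c j i \<cdot>\<^sub>m Z i) * J) $$ (r,l))"
        unfolding c[OF q(2)] using ZA Jc rq q by (intro msum_mult_index) auto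
      also have "\<dots> = (\<Sum>i<a. c j i * (Z i * J) $$ (r,l))"
        using ZA(2) Jc rq q by (intro sum.cong) (auto simp: mat_smult_left dest!: ZA(2))
      also have "\<dots> = (\<Sum>i<a. y $$ (i,j) * V $$ (r, i*b+l))"
        using rq q by (intro sum.cong) (auto simp: V_def Wi y_def)
      also have "\<dots> = (V * kron y (1\<^sub>m b)) $$ (r,q)"
        unfolding q(1) using mult_block_index[OF Vc y rq(1) q(2,3)] by simp
      finally show "(Y * V) $$ (r,q) = (V * kron y (1\<^sub>m b)) $$ (r,q)" .
    qed (use Vc Yc y in auto)
    then show ?thesis using y by blast
  qed
  have part2: "V * kron y (1\<^sub>m b) * V\<^sup>\<dagger> \<in> \<A>" if y: "y \<in> carrier_mat a a" for y
  proof -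
    \<comment> \<open>The products
      \<open>Z i * (J * J\<^sup>\<dagger>) * (Z j)\<^sup>\<dagger>\<close> lie in the algebra and
      are the matrix units of the block, tensored with the identity.\<close>
    define T where "T = msum n a (\<lambda>j. msum n a (\<lambda>i. y $$ (i,j) \<cdot>\<^sub>m (Z i * (J * J\<^sup>\<dagger>) * (Z j)\<^sup>\<dagger>)))"
    have "T \<in> \<A>" unfolding T_def using J(2) ZA algD by (intro star_algebra_msum[OF alg]) auto
    moreover have "V * kron y (1\<^sub>m b) * V\<^sup>\<dagger> = T"
    proof (rule eq_matI)
      fix r s assume "r < dim_row T" "s < dim_col T"
      then have rs: "r < n" "s < n" by (auto simp: T_def)
      have "(V * kron y (1\<^sub>m b) * V\<^sup>\<dagger>) $$ (r,s) =
          (\<Sum>q<a*b. (V * kron y (1\<^sub>m b)) $$ (r, q div b * b + q mod b) * cnj (V $$ (s, q div b * b + q mod b)))"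
        using rs Vc y by (subst index_mult_sum) auto
      also have "\<dots> = (\<Sum>j<a. \<Sum>l<b. (V * kron y (1\<^sub>m b)) $$ (r, j*b+l) * cnj (V $$ (s, j*b+l)))"
        by (rule sum_div_mod)
      also have "\<dots> = (\<Sum>j<a. \<Sum>l<b. (\<Sum>i<a. y $$ (i,j) * (Z i * J) $$ (r,l)) * cnj ((Z j * J) $$ (s,l)))"
        using rs Vc y by (intro sum.cong) (auto simp: mult_block_index V_def Wi)
      also have "\<dots> = (\<Sum>j<a. \<Sum>i<a. y $$ (i,j) * (\<Sum>l<b. (Z i * J) $$ (r,l) * cnj ((Z j * J) $$ (s,l))))"
        by (rule sum.cong[OF refl], simp add: sum_distrib_left sum_distrib_right mult.assoc) (rule sum.swap)
      also have "\<dots> = (\<Sum>j<a. \<Sum>i<a. y $$ (i,j) * (Z i * (J * J\<^sup>\<dagger>) * (Z j)\<^sup>\<dagger>) $$ (r,s))"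
      proof (intro sum.cong refl)
        fix i j assume "j \<in> {..<a}" "i \<in> {..<a}"
        then have zc: "Z i \<in> carrier_mat n n" "Z j \<in> carrier_mat n n" using ZA by auto
        have "Z i * (J * J\<^sup>\<dagger>) * (Z j)\<^sup>\<dagger> = (Z i * J) * (Z j * J)\<^sup>\<dagger>" using zc Jc by (simp add: mat_dist)
        also have "\<dots> $$ (r,s) = (\<Sum>l<b. (Z i * J) $$ (r,l) * cnj ((Z j * J) $$ (s,l)))"
          using zc Jc rs by (subst index_mult_sum) auto
        finally show "y $$ (i,j) * (\<Sum>l<b. (Z i * J) $$ (r,l) * cnj ((Z j * J) $$ (s,l))) =
          y $$ (i,j) * (Z i * (J * J\<^sup>\<dagger>) * (Z j)\<^sup>\<dagger>) $$ (r,s)" by simp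
      qed
      also have "\<dots> = T $$ (r,s)"
        using rs ZA(2) Jc by (auto simp: T_def msum_def intro!: sum.cong index_smult_mat(1)[symmetric] dest!: ZA(2))
      finally show "(V * kron y (1\<^sub>m b) * V\<^sup>\<dagger>) $$ (r,s) = T $$ (r,s)" .
    qed (use Vc in \<open>auto simp: T_def\<close>)
    ultimately show ?thesis by simp
  qed
  show ?thesis using a0 b0 Wiso[OF Z] part1 part2 unfolding V_def by blast
qed

section \<open>Decomposition into full matrix blocks by induction on the dimension\<close>

lemma msum_Suc_shift:
  assumes "f 0 \<in> carrier_mat N N"
  shows "msum N (Suc K) f = f 0 + msum N K (\<lambda>k. f (Suc k))"
  using assms by (intro eq_matI) (auto simp: msum_def sum.lessThan_Suc_shift simp del: sum.lessThan_Suc)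

text \<open>The algebra is the direct sum of the M_(a k) \<otimes> 1_(b k): the last two clauses are
  the two inclusions. Positivity of the dimensions later guarantees that every block carries
  states.\<close>

definition blocks :: "nat \<Rightarrow> complex mat set \<Rightarrow> nat \<Rightarrow> (nat \<Rightarrow> nat) \<Rightarrow> (nat \<Rightarrow> nat) \<Rightarrow> (nat \<Rightarrow> complex mat) \<Rightarrow> bool" where
  "blocks n \<A> K a b V \<longleftrightarrow>
    (\<forall>k<K. a k > 0 \<and> b k > 0 \<and> V k \<in> carrier_mat n (a k * b k)) \<and>
    (\<forall>k<K. \<forall>l<K. (V k)\<^sup>\<dagger> * V l = (if k = l then 1\<^sub>m (a k * b k) else 0\<^sub>m (a k * b k) (a l * b l))) \<and>
    msum n K (\<lambda>k. V k * (V k)\<^sup>\<dagger>) = 1\<^sub>m n \<and>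
    (\<forall>k<K. \<forall>Y\<in>\<A>. \<exists>y\<in>carrier_mat (a k) (a k). Y * V k = V k * kron y (1\<^sub>m (b k))) \<and>
    (\<forall>k<K. \<forall>y\<in>carrier_mat (a k) (a k). V k * kron y (1\<^sub>m (b k)) * (V k)\<^sup>\<dagger> \<in> \<A>)"

lemma blocksD:
  assumes "blocks n \<A> K a b V" "k < K"
  shows "a k > 0" "b k > 0" "V k \<in> carrier_mat n (a k * b k)"
    "l < K \<Longrightarrow> (V k)\<^sup>\<dagger> * V l = (if k = l then 1\<^sub>m (a k * b k) else 0\<^sub>m (a k * b k) (a l * b l))"
    "Y \<in> \<A> \<Longrightarrow> \<exists>y\<in>carrier_mat (a k) (a k). Y * V k = V k * kron y (1\<^sub>m (b k))"
    "y \<in> carrier_mat (a k) (a k) \<Longrightarrow> V k * kron y (1\<^sub>m (b k)) * (V k)\<^sup>\<dagger> \<in> \<A>"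
  using assms unfolding blocks_def by blast+

lemma blocks_complete: "blocks n \<A> K a b V \<Longrightarrow> msum n K (\<lambda>k. V k * (V k)\<^sup>\<dagger>) = 1\<^sub>m n"
  unfolding blocks_def by blast

text \<open>Split off one irreducible block. Its projection lies in the algebra and commutes with
  it, so compression to the complement gives a star-algebra in smaller dimension.\<close>

theorem star_algebra_structure:
  assumes "star_algebra n \<A>"
  shows "\<exists>K a b V. blocks n \<A> K a b V"
  using assms
proof (induction n arbitrary: \<A> rule: less_induct)
  case (less n)
  note alg = less.prems
  note algD = star_algebraD[OF alg]
  show ?case
  proof (cases "n = 0")
    case True
    have "msum n 0 f = 1\<^sub>m n" for f using True by (intro eq_matI) auto
    then show ?thesis unfolding blocks_def by (intro exI[of _ 0]) auto
  next
    case False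
    then obtain a0 b0 V0 where pos: "a0 > 0" "b0 > 0" and V0: "isometry n (a0 * b0) V0"
      and V0y: "\<And>Y. Y \<in> \<A> \<Longrightarrow> \<exists>y\<in>carrier_mat a0 a0. Y * V0 = V0 * kron y (1\<^sub>m b0)"
      and V0m: "\<And>y. y \<in> carrier_mat a0 a0 \<Longrightarrow> V0 * kron y (1\<^sub>m b0) * V0\<^sup>\<dagger> \<in> \<A>"
      using irreducible_block[OF alg] by blast
    have V0c: "V0 \<in> carrier_mat n (a0 * b0)" and V0o: "V0\<^sup>\<dagger> * V0 = 1\<^sub>m (a0 * b0)"
      using V0 by (auto simp: isometry_def)
    obtain e J where J: "isometry n e J" "J * J\<^sup>\<dagger> = 1\<^sub>m n - V0 * V0\<^sup>\<dagger>" "V0\<^sup>\<dagger> * J = 0\<^sub>m (a0 * b0) e" "n = a0 * b0 + e"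
      using complement_factor[OF V0] by metis
    have Jc: "J \<in> carrier_mat n e" and Jo: "J\<^sup>\<dagger> * J = 1\<^sub>m e" using J by (auto simp: isometry_def)
    have en: "e < n" using J(4) pos by simp
    have P: "V0 * V0\<^sup>\<dagger> \<in> \<A>" using V0m[of "1\<^sub>m a0"] V0c by (simp add: kron_one)
    define D where "D = J * J\<^sup>\<dagger>"
    have D: "D \<in> \<A>" unfolding D_def J(2) by (intro star_algebra_minus[OF alg] algD(2) P)
    have Dc: "D \<in> carrier_mat n n" and Dh: "D\<^sup>\<dagger> = D" using Jc by (auto simp: D_def mat_dist)
    have DJ: "D * J = J" using Jc Jo by (simp add: D_def mat_assoc)
    have JD: "J\<^sup>\<dagger> * D = J\<^sup>\<dagger>" using arg_cong[OF DJ, of adj] Jc Dc Dh by (simp add: mat_dist)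
    \<comment> \<open>Products of compressions stay compressions because the inner projection
      \<open>D\<close> belongs to the algebra.\<close>
    define \<B> where "\<B> = (\<lambda>Y. J\<^sup>\<dagger> * Y * J) ` \<A>"
    have "star_algebra e \<B>"
      unfolding star_algebra_def
    proof (intro conjI ballI allI)
      show "\<B> \<subseteq> carrier_mat e e" using algD(1) Jc by (auto simp: \<B>_def)
      have "J\<^sup>\<dagger> * 1\<^sub>m n * J = 1\<^sub>m e" using Jc Jo by simp
      then show "1\<^sub>m e \<in> \<B>" unfolding \<B>_def using algD(2) by (metis imageI)
      fix X' assume "X' \<in> \<B>"
      then obtain X where X: "X \<in> \<A>" "X' = J\<^sup>\<dagger> * X * J" by (auto simp: \<B>_def)
      have Xc: "X \<in> carrier_mat n n" using X algD by auto
      have "X'\<^sup>\<dagger> = J\<^sup>\<dagger> * X\<^sup>\<dagger> * J" unfolding X(2) using Xc Jc by (simp add: mat_dist)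
      then show "X'\<^sup>\<dagger> \<in> \<B>" unfolding \<B>_def using algD(5)[OF X(1)] by blast
      show "c \<cdot>\<^sub>m X' \<in> \<B>" for c
      proof -
        have "c \<cdot>\<^sub>m X' = J\<^sup>\<dagger> * (c \<cdot>\<^sub>m X) * J" unfolding X(2) using Xc Jc by (simp add: mat_dist)
        then show ?thesis unfolding \<B>_def using algD(6)[OF X(1)] by blast
      qed
      fix Y' assume "Y' \<in> \<B>"
      then obtain Y where Y: "Y \<in> \<A>" "Y' = J\<^sup>\<dagger> * Y * J" by (auto simp: \<B>_def)
      have Yc: "Y \<in> carrier_mat n n" using Y algD by auto
      have "X' + Y' = J\<^sup>\<dagger> * (X + Y) * J" unfolding X(2) Y(2) using Xc Yc Jc by (simp add: mat_dist)
      then show "X' + Y' \<in> \<B>" unfolding \<B>_def using algD(3)[OF X(1) Y(1)] by blast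
      have "X' * Y' = J\<^sup>\<dagger> * (X * (D * Y)) * J" unfolding X(2) Y(2) D_def using Xc Yc Jc by (simp add: mat_assoc)
      then show "X' * Y' \<in> \<B>" unfolding \<B>_def using algD(4)[OF X(1) algD(4)[OF D Y(1)]] by blast
    qed
    from less.IH[OF en this] obtain K a b V where IH: "blocks e \<B> K a b V" by blast
    note IH1 = blocksD(1-3)[OF IH] and IH2 = blocksD(4)[OF IH] and IH3 = blocks_complete[OF IH]
      and IH4 = blocksD(5)[OF IH] and IH5 = blocksD(6)[OF IH]
    define a' where "a' = case_nat a0 a"
    define b' where "b' = case_nat b0 b"
    define V' where "V' = case_nat V0 (\<lambda>k. J * V k)"
    have s [simp]: "a' 0 = a0" "b' 0 = b0" "V' 0 = V0" "a' (Suc k) = a k" "b' (Suc k) = b k" "V' (Suc k) = J * V k" for k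
      by (auto simp: a'_def b'_def V'_def)
    \<comment> \<open>The range of \<open>V0\<close> is invariant under \<open>Y\<close> and under
      its adjoint; together these make the block projection commute with \<open>Y\<close>.\<close>
    have comm: "Y * D = D * Y" if Y: "Y \<in> \<A>" for Y
    proof -
      let ?P = "V0 * V0\<^sup>\<dagger>"
      have inv: "?P * (X * ?P) = X * ?P" if X: "X \<in> \<A>" for X
      proof -
        obtain y where y: "y \<in> carrier_mat a0 a0" "X * V0 = V0 * kron y (1\<^sub>m b0)" using V0y[OF X] by blast
        have Xc: "X \<in> carrier_mat n n" using X algD by auto
        have "X * ?P = (X * V0) * V0\<^sup>\<dagger>" using Xc V0c by (simp add: mat_assoc)
        then have "X * ?P = V0 * (kron y (1\<^sub>m b0) * V0\<^sup>\<dagger>)"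
          unfolding y(2) using y(1) V0c by (simp add: mat_assoc)
        moreover have "V0\<^sup>\<dagger> * (V0 * X) = X" if "dim_row X = a0 * b0" for X
          using that V0c V0o by (simp add: mat_assoc[symmetric])
        ultimately show ?thesis using V0c y by (simp add: mat_assoc)
      qed
      have Yc: "Y \<in> carrier_mat n n" using Y algD by auto
      have Pc: "?P \<in> carrier_mat n n" "?P\<^sup>\<dagger> = ?P" using V0c by (auto simp: mat_dist)
      have "(?P * (Y\<^sup>\<dagger> * ?P))\<^sup>\<dagger> = (Y\<^sup>\<dagger> * ?P)\<^sup>\<dagger>" using inv[OF algD(5)[OF Y]] by simp
      then have "?P * (Y * ?P) = ?P * Y" using Yc V0c by (simp add: mat_dist)
      then have "Y * ?P = ?P * Y" using inv[OF Y] by simp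
      then show ?thesis unfolding D_def J(2) using Yc V0c by (simp add: mat_minus_left mat_minus_right)
    qed
    have Vc: "V k \<in> carrier_mat e (a k * b k)" if "k < K" for k by (rule IH1(3)[OF that])
    have DJ': "D * (J * X) = J * X" if "dim_row X = e" for X
      using that Dc Jc by (simp add: DJ mat_assoc[symmetric])
    have "blocks n \<A> (Suc K) a' b' V'"
      unfolding blocks_def
    proof (intro conjI allI impI ballI)
      fix k assume k: "k < Suc K"
      show "a' k > 0" "b' k > 0" "V' k \<in> carrier_mat n (a' k * b' k)"
        using k pos V0c Jc IH1 by (cases k; auto)+
      show "(V' k)\<^sup>\<dagger> * V' l = (if k = l then 1\<^sub>m (a' k * b' k) else 0\<^sub>m (a' k * b' k) (a' l * b' l))"
        if l: "l < Suc K" for l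
      proof (cases k)
        case k0: 0
        show ?thesis
        proof (cases l)
          case (Suc l')
          then have "V l' \<in> carrier_mat e (a l' * b l')" using l Vc by auto
          then have "V0\<^sup>\<dagger> * (J * V l') = (V0\<^sup>\<dagger> * J) * V l'" using V0c Jc by (simp add: mat_assoc)
          then show ?thesis using J(3) \<open>V l' \<in> _\<close> k0 Suc by simp
        qed (use k0 V0o in simp)
      next
        case kS: (Suc k')
        have Vk: "V k' \<in> carrier_mat e (a k' * b k')" using k kS Vc by auto
        show ?thesis
        proof (cases l)
          case 0
          have "(J * V k')\<^sup>\<dagger> * V0 = (V0\<^sup>\<dagger> * J * V k')\<^sup>\<dagger>" using V0c Jc Vk by (simp add: mat_dist)
          then show ?thesis using J(3) Vk kS 0 by simp
        next
          case (Suc l')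
          have Vl: "V l' \<in> carrier_mat e (a l' * b l')" using l Suc Vc by auto
          have "(J * V k')\<^sup>\<dagger> * (J * V l') = (V k')\<^sup>\<dagger> * ((J\<^sup>\<dagger> * J) * V l')"
            using Jc Vk Vl by (simp add: mat_dist)
          also have "\<dots> = (V k')\<^sup>\<dagger> * V l'" unfolding Jo using Vl by simp
          finally show ?thesis using IH2[of k' l'] k l kS Suc by simp
        qed
      qed
    next
      have "msum n (Suc K) (\<lambda>k. V' k * (V' k)\<^sup>\<dagger>) = V0 * V0\<^sup>\<dagger> + msum n K (\<lambda>k. (J * V k) * (J * V k)\<^sup>\<dagger>)"
        using V0c by (subst msum_Suc_shift) auto
      also have "msum n K (\<lambda>k. (J * V k) * (J * V k)\<^sup>\<dagger>) = msum n K (\<lambda>k. J * (V k * (V k)\<^sup>\<dagger>) * J\<^sup>\<dagger>)"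
        using Jc Vc by (intro msum_cong) (auto simp: mat_dist dest!: Vc)
      also have "\<dots> = J * msum e K (\<lambda>k. V k * (V k)\<^sup>\<dagger>) * J\<^sup>\<dagger>"
        using Jc Vc by (intro msum_sandwich[symmetric]) (auto dest!: Vc)
      also have "\<dots> = 1\<^sub>m n - V0 * V0\<^sup>\<dagger>" unfolding IH3 using Jc J(2) by simp
      also have "V0 * V0\<^sup>\<dagger> + (1\<^sub>m n - V0 * V0\<^sup>\<dagger>) = 1\<^sub>m n" using V0c by (intro eq_matI) auto
      finally show "msum n (Suc K) (\<lambda>k. V' k * (V' k)\<^sup>\<dagger>) = 1\<^sub>m n" .
    next
      fix k Y assume k: "k < Suc K" and Y: "Y \<in> \<A>"
      show "\<exists>y\<in>carrier_mat (a' k) (a' k). Y * V' k = V' k * kron y (1\<^sub>m (b' k))"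
      proof (cases k)
        case 0
        then show ?thesis using V0y[OF Y] by simp
      next
        case (Suc k')
        have Vk: "V k' \<in> carrier_mat e (a k' * b k')" using k Suc Vc by auto
        have Yc: "Y \<in> carrier_mat n n" using Y algD by auto
        have "J\<^sup>\<dagger> * Y * J \<in> \<B>" using Y by (auto simp: \<B>_def)
        then obtain y where y: "y \<in> carrier_mat (a k') (a k')" "J\<^sup>\<dagger> * Y * J * V k' = V k' * kron y (1\<^sub>m (b k'))"
          using IH4[of k'] k Suc by auto
        have "Y * (J * V k') = (Y * D) * (J * V k')"
          using Yc Jc Vk Dc DJ' by (simp add: mat_assoc)
        also have "\<dots> = J * (J\<^sup>\<dagger> * Y * J * V k')"
          unfolding comm[OF Y] using Yc Jc Vk by (simp add: D_def mat_assoc)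
        also have "\<dots> = (J * V k') * kron y (1\<^sub>m (b k'))" unfolding y(2) using Jc Vk y(1) by (simp add: mat_assoc)
        finally show ?thesis using y(1) Suc by auto
      qed
    next
      fix k and y :: "complex mat" assume k: "k < Suc K" and y: "y \<in> carrier_mat (a' k) (a' k)"
      show "V' k * kron y (1\<^sub>m (b' k)) * (V' k)\<^sup>\<dagger> \<in> \<A>"
      proof (cases k)
        case 0
        then show ?thesis using V0m y by simp
      next
        case (Suc k')
        have Vk: "V k' \<in> carrier_mat e (a k' * b k')" using k Suc Vc by auto
        have yc: "y \<in> carrier_mat (a k') (a k')" using y Suc by simp
        obtain Y where Y: "Y \<in> \<A>" "V k' * kron y (1\<^sub>m (b k')) * (V k')\<^sup>\<dagger> = J\<^sup>\<dagger> * Y * J"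
          using IH5[of k' y] k yc Suc by (auto simp: \<B>_def)
        have Yc: "Y \<in> carrier_mat n n" using Y algD by auto
        have "(J * V k') * kron y (1\<^sub>m (b k')) * (J * V k')\<^sup>\<dagger> = J * (V k' * kron y (1\<^sub>m (b k')) * (V k')\<^sup>\<dagger>) * J\<^sup>\<dagger>"
          using Jc Vk yc by (simp add: mat_dist)
        \<comment> \<open>Going back from the compression to the full space costs two factors
          \<open>D\<close>, both in the algebra.\<close>
        also have "\<dots> = D * Y * D" unfolding Y(2) using Jc Yc by (simp add: D_def mat_assoc)
        also have "\<dots> \<in> \<A>" using D Y algD by simp
        finally show ?thesis using Suc by simp
      qed
    qed
    then show ?thesis by blast
  qed
qed

section \<open>Contractivity of positive maps in the KMS inner product\<close>

text \<open>\<open>\<langle>X, NX\<rangle> \<le> \<langle>X, X\<rangle>\<close> for a self-adjoint map with bounded orbits: otherwise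
  \<open>\<langle>X, N ^ (2 ^ k) X\<rangle>\<close> would grow without bound along the powers of two.\<close>

lemma bounded_orbit_contraction:
  fixes B :: "'a \<Rightarrow> 'a \<Rightarrow> real"
  assumes N: "\<And>x. x \<in> I \<Longrightarrow> N x \<in> I"
    and sa: "\<And>x y. x \<in> I \<Longrightarrow> y \<in> I \<Longrightarrow> B (N x) y = B x (N y)"
    and pos: "\<And>x y. x \<in> I \<Longrightarrow> y \<in> I \<Longrightarrow> 2 * B x y \<le> B x x + B y y"
    and bd: "\<And>x y. x \<in> I \<Longrightarrow> y \<in> I \<Longrightarrow> B x y \<le> M"
    and x: "x \<in> I"
  shows "B x (N x) \<le> B x x"
proof (rule ccontr)
  have I: "(N ^^ k) y \<in> I" if "y \<in> I" for k y using that by (induction k) (auto simp: N)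
  have shift: "B ((N ^^ k) y) z = B y ((N ^^ k) z)" if "y \<in> I" "z \<in> I" for k y z
    using that
  proof (induction k arbitrary: y)
    case (Suc k)
    have "B ((N ^^ Suc k) y) z = B ((N ^^ k) (N y)) z" by (simp add: funpow_swap1)
    also have "\<dots> = B (N y) ((N ^^ k) z)" using Suc N by simp
    also have "\<dots> = B y (N ((N ^^ k) z))" using Suc I by (intro sa) auto
    finally show ?case by simp
  qed simp
  define b where "b j = B x ((N ^^ (2 ^ j)) x)" for j
  assume "\<not> B x (N x) \<le> B x x"
  then have d: "b 0 - B x x > 0" by (simp add: b_def)
  \<comment> \<open>The inequality \<open>pos\<close> for x and its iterate, with self-adjointness
    moving all iterations to one side: the excess over \<open>B x x\<close> at least doubles with
    each j.\<close>
  have step: "b (Suc j) - B x x \<ge> 2 * (b j - B x x)" for j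
  proof -
    have "2 * b j \<le> B x x + B ((N ^^ (2 ^ j)) x) ((N ^^ (2 ^ j)) x)"
      unfolding b_def by (rule pos[OF x I[OF x]])
    also have "B ((N ^^ (2 ^ j)) x) ((N ^^ (2 ^ j)) x) = B x ((N ^^ (2 ^ j)) ((N ^^ (2 ^ j)) x))"
      by (rule shift[OF x I[OF x]])
    also have "(N ^^ (2 ^ j)) ((N ^^ (2 ^ j)) x) = (N ^^ (2 ^ Suc j)) x"
      by (simp add: funpow_add[symmetric, THEN fun_cong, simplified] mult_2)
    finally show ?thesis by (simp add: b_def)
  qed
  have "b j - B x x \<ge> 2 ^ j * (b 0 - B x x)" for j
  proof (induction j)
    case (Suc j)
    then show ?case using step[of j] by simp
  qed simp
  moreover have "b j \<le> M" for j unfolding b_def by (rule bd[OF x I[OF x]])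
  ultimately have *: "2 ^ j * (b 0 - B x x) \<le> M - B x x" for j by (smt (verit))
  obtain j where "(M - B x x) / (b 0 - B x x) < 2 ^ j"
    using real_arch_pow[of 2] by auto
  then have "M - B x x < 2 ^ j * (b 0 - B x x)" using d by (simp add: divide_less_eq)
  with * show False by (smt (verit))
qed


section \<open>Order intervals and the KMS form\<close>

lemma mtrace_minus_square:
  "dim_col A = dim_row A \<Longrightarrow> dim_row B = dim_row A \<Longrightarrow> dim_col B = dim_row A \<Longrightarrow>
    mtrace (A - B) = mtrace A - mtrace B"
  by (rule mtrace_minus[of _ "dim_row A"]) auto

text \<open>The order interval [0, A]. It serves as the invariant domain of the contraction
  argument: it bounds the form and forces its members to live on the support of
  \<open>A\<close>.\<close>

definition dominated :: "nat \<Rightarrow> complex mat \<Rightarrow> complex mat \<Rightarrow> bool" where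
  "dominated n A X \<longleftrightarrow> psd n X \<and> psd n (A - X)"

text \<open>Bilinear, without an adjoint on either argument, so symmetry is cyclicity of the trace;
  positivity is claimed for Hermitian arguments. The real part makes it a real form as
  \<open>bounded_orbit_contraction\<close> expects.\<close>

definition kms :: "complex mat \<Rightarrow> complex mat \<Rightarrow> complex mat \<Rightarrow> real" where
  "kms t X Y = Re (mtrace (X * (t * (Y * t))))"

text \<open>\<open>t\<close> is the pseudo-inverse of \<open>s\<close>, so it stands for \<open>A\<close> to the power \<open>- 1/2\<close>;
  \<open>P\<close> projects onto the support of \<open>A\<close>.\<close>

locale psd_sqrt =
  fixes n :: nat and A s t P r :: "complex mat"
  assumes carrier: "s \<in> carrier_mat n n" "t \<in> carrier_mat n n" "P \<in> carrier_mat n n" "r \<in> carrier_mat n n"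
    and herm: "s\<^sup>\<dagger> = s" "t\<^sup>\<dagger> = t" "P\<^sup>\<dagger> = P" "r\<^sup>\<dagger> = r"
    and mults: "s * s = A" "s * t = P" "t * s = P" "P * s = s" "s * P = s" "P * t = t" "t * P = t" "P * P = P" "r * r = t"
begin

lemma dims [simp]: "dim_row s = n" "dim_col s = n" "dim_row t = n" "dim_col t = n"
    "dim_row P = n" "dim_col P = n" "dim_row r = n" "dim_col r = n"
  using carrier by auto

lemma A_carrier: "A \<in> carrier_mat n n" "dim_row A = n" "dim_col A = n"
proof -
  show "A \<in> carrier_mat n n"
    unfolding mults(1)[symmetric] by (rule mult_carrier_mat[OF carrier(1) carrier(1)])
  then show "dim_row A = n" "dim_col A = n" by auto
qed

lemma cancels:
  assumes "dim_row X = n"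
  shows "s * (s * X) = A * X" "s * (t * X) = P * X" "t * (s * X) = P * X" "P * (s * X) = s * X"
    "s * (P * X) = s * X" "P * (t * X) = t * X" "t * (P * X) = t * X" "P * (P * X) = P * X" "r * (r * X) = t * X"
  using assms by (simp_all add: mat_assoc[symmetric] mults)

lemma tAt: "t * (A * t) = P"
proof -
  have "t * (A * t) = (t * s) * (s * t)" unfolding mults(1)[symmetric] by (simp add: mat_assoc)
  then show ?thesis by (simp add: mults)
qed

lemma psd_complement: "psd n (1\<^sub>m n - P)"
proof (rule psd_projection)
  show "1\<^sub>m n - P \<in> carrier_mat n n" using carrier(3) by (intro minus_carrier_mat)
  show "(1\<^sub>m n - P)\<^sup>\<dagger> = 1\<^sub>m n - P" by (simp add: adjoint_minus herm)
  show "(1\<^sub>m n - P) * (1\<^sub>m n - P) = 1\<^sub>m n - P"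
    by (simp add: mat_minus_left mat_minus_right mults)
qed

lemma A_complement: "A * (1\<^sub>m n - P) = 0\<^sub>m n n"
proof -
  have "A * (1\<^sub>m n - P) = s * (s * 1\<^sub>m n - s * P)"
    by (simp add: mults(1)[symmetric] mat_minus_right mat_assoc)
  then show ?thesis by (simp add: mults)
qed

text \<open>\<open>1\<^sub>m n - P\<close> maps into the kernel of \<open>A\<close>, which a smaller
  positive operator also annihilates; the other side follows by taking adjoints.\<close>

lemma dominated_support:
  assumes "dominated n A X"
  shows "P * X = X" "X * P = X"
proof -
  have X: "psd n X" "psd n (A - X)" using assms by (auto simp: dominated_def)
  have Xc: "X \<in> carrier_mat n n" by (rule psd_carrier[OF X(1)])
  have "1\<^sub>m n - P \<in> carrier_mat n n" by (rule carrier_matI) simp_all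
  from psd_dominated_kernel[OF X A_carrier(1) this A_complement]
  have "X * (1\<^sub>m n - P) = 0\<^sub>m n n" .
  then have z: "X - X * P = 0\<^sub>m n n" using Xc by (simp add: mat_minus_right)
  have "X * P \<in> carrier_mat n n" by (rule mult_carrier_mat[OF Xc carrier(3)])
  from mat_eq_of_minus[OF z Xc this] show XP: "X * P = X" by (rule sym)
  have "(X * P)\<^sup>\<dagger> = P * X" using Xc by (simp add: adjoint_mult herm psd_hermitian[OF X(1)])
  then show "P * X = X" unfolding XP psd_hermitian[OF X(1)] by (rule sym)
qed

lemma kms_sym:
  assumes "X \<in> carrier_mat n n" "Y \<in> carrier_mat n n"
  shows "kms t X Y = kms t Y X"
proof -
  have "mtrace ((X * t) * (Y * t)) = mtrace ((Y * t) * (X * t))"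
    using assms by (intro mtrace_mult_comm[of _ n n] carrier_matI) simp_all
  then show ?thesis using assms by (simp add: kms_def mat_assoc)
qed

lemma kms_minus:
  assumes "X \<in> carrier_mat n n" "Y \<in> carrier_mat n n" "Z \<in> carrier_mat n n"
  shows "kms t (X - Y) Z = kms t X Z - kms t Y Z" "kms t Z (X - Y) = kms t Z X - kms t Z Y"
  using assms by (simp_all add: kms_def mat_minus_left mat_minus_right mtrace_minus_square)

text \<open>Splitting \<open>t\<close> as \<open>r * r\<close> and cycling one \<open>r\<close>
  around the trace turns the form into a squared Hilbert-Schmidt norm. This is the purpose of the
  fourth root \<open>r\<close>.\<close>

lemma kms_square:
  assumes "D \<in> carrier_mat n n" "D\<^sup>\<dagger> = D"
  shows "kms t D D = Re (mtrace ((r * (D * r))\<^sup>\<dagger> * (r * (D * r))))"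
proof -
  have "mtrace (D * (t * (D * t))) = mtrace ((D * (r * (r * (D * r)))) * r)"
    using assms by (simp add: mults(9)[symmetric] mat_assoc)
  also have "\<dots> = mtrace (r * (D * (r * (r * (D * r)))))"
    using assms by (intro mtrace_mult_comm[of _ n n] carrier_matI) simp_all
  also have "\<dots> = mtrace ((r * (D * r))\<^sup>\<dagger> * (r * (D * r)))"
    using assms by (simp add: mat_dist herm)
  finally show ?thesis by (simp add: kms_def)
qed

lemma kms_nonneg:
  assumes "D \<in> carrier_mat n n" "D\<^sup>\<dagger> = D"
  shows "kms t D D \<ge> 0"
proof -
  have "r * (D * r) \<in> carrier_mat n n" using assms by (intro carrier_matI) simp_all
  from psd_mtrace[OF psd_gram[OF this]] show ?thesis
    unfolding kms_square[OF assms] by (simp add: less_eq_complex_def)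
qed

text \<open>The form sees only the part of \<open>D\<close> on the support of \<open>A\<close>,
  hence the two factors \<open>P\<close>.\<close>

lemma kms_eq_0:
  assumes "D \<in> carrier_mat n n" "D\<^sup>\<dagger> = D" "kms t D D \<le> 0"
  shows "P * (D * P) = 0\<^sub>m n n"
proof -
  have c: "r * (D * r) \<in> carrier_mat n n" using assms by (intro carrier_matI) simp_all
  have "0 \<le> mtrace ((r * (D * r))\<^sup>\<dagger> * (r * (D * r)))" by (rule psd_mtrace[OF psd_gram[OF c]])
  then have "mtrace ((r * (D * r))\<^sup>\<dagger> * (r * (D * r))) = 0"
    using assms(3) unfolding kms_square[OF assms(1,2)] by (simp add: less_eq_complex_def complex_eq_iff)
  then have z: "r * (D * r) = 0\<^sub>m n n" by (rule mtrace_gram_eq_0[OF c])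
  have "P * (D * P) = s * (r * ((r * (D * r)) * (r * s)))"
    using assms by (simp add: mat_assoc cancels mults)
  also have "\<dots> = 0\<^sub>m n n" unfolding z using carrier by simp
  finally show ?thesis .
qed

lemma kms_arith:
  assumes "X \<in> carrier_mat n n" "X\<^sup>\<dagger> = X" "Y \<in> carrier_mat n n" "Y\<^sup>\<dagger> = Y"
  shows "2 * kms t X Y \<le> kms t X X + kms t Y Y"
proof -
  have c: "X - Y \<in> carrier_mat n n" using assms by (intro minus_carrier_mat)
  have "0 \<le> kms t (X - Y) (X - Y)"
    using assms c by (intro kms_nonneg) (auto simp: adjoint_minus)
  also have "\<dots> = kms t X X - kms t X Y - (kms t Y X - kms t Y Y)"
    using assms c by (simp add: kms_minus)
  finally show ?thesis using kms_sym[OF assms(1,3)] by simp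
qed

text \<open>Conjugating Y \<le> A by \<open>t\<close> gives t Y t \<le> P, and P \<le> 1.\<close>

lemma psd_one_minus_conj:
  assumes "psd n (A - Y)" "Y \<in> carrier_mat n n"
  shows "psd n (1\<^sub>m n - t * (Y * t))"
proof -
  have "psd n (t\<^sup>\<dagger> * (A - Y) * t)" by (rule psd_conj[OF assms(1) carrier(2)])
  also have "t\<^sup>\<dagger> * (A - Y) * t = P - t * (Y * t)"
    using assms(2) A_carrier by (simp add: herm mat_minus_left mat_minus_right mat_assoc tAt)
  finally have "psd n ((1\<^sub>m n - P) + (P - t * (Y * t)))" by (rule psd_add[OF psd_complement])
  also have "(1\<^sub>m n - P) + (P - t * (Y * t)) = 1\<^sub>m n - t * (Y * t)"
    using assms(2) by (intro eq_matI) simp_all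
  finally show ?thesis .
qed

text \<open>The uniform bound on orbits: t Y t \<le> 1 gives <X, Y> \<le> tr X, and X \<le> A gives
  tr X \<le> tr A.\<close>

lemma kms_bound:
  assumes "dominated n A X" "dominated n A Y"
  shows "kms t X Y \<le> Re (mtrace A)"
proof -
  have X: "psd n X" "psd n (A - X)" and Y: "psd n Y" "psd n (A - Y)"
    using assms by (auto simp: dominated_def)
  have c: "X \<in> carrier_mat n n" "Y \<in> carrier_mat n n" using X Y psd_carrier by auto
  have "0 \<le> mtrace (X * (1\<^sub>m n - t * (Y * t)))"
    by (rule mtrace_psd_mult[OF X(1) psd_one_minus_conj[OF Y(2) c(2)]])
  also have "X * (1\<^sub>m n - t * (Y * t)) = X - X * (t * (Y * t))"
    using c by (simp add: mat_minus_right)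
  also have "mtrace (X - X * (t * (Y * t))) = mtrace X - mtrace (X * (t * (Y * t)))"
    using c by (simp add: mtrace_minus_square)
  finally have 1: "kms t X Y \<le> Re (mtrace X)" by (simp add: kms_def less_eq_complex_def)
  have "0 \<le> mtrace (A - X)" by (rule psd_mtrace[OF X(2)])
  also have "\<dots> = mtrace A - mtrace X" using c A_carrier by (simp add: mtrace_minus_square)
  finally show ?thesis using 1 by (simp add: less_eq_complex_def)
qed

text \<open>Adjointness rewrites the norm of F X as <X, G (F X)>. It is applied twice, once to the
  given lift with its dual, once to the Petz map with the partial trace; the two spaces may
  differ.\<close>

lemma kms_contraction:
  assumes T: "psd_sqrt m C s' t' P' r'"
    and F: "\<And>X. dominated n A X \<Longrightarrow> dominated m C (F X)"
    and G: "\<And>Y. dominated m C Y \<Longrightarrow> dominated n A (G Y)"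
    and adjoint: "\<And>X Y. dominated n A X \<Longrightarrow> dominated m C Y \<Longrightarrow> kms t' (F X) Y = kms t X (G Y)"
    and X: "dominated n A X"
  shows "kms t' (F X) (F X) \<le> kms t X X"
proof -
  interpret T: psd_sqrt m C s' t' P' r' by (rule T)
  have c: "X \<in> carrier_mat n n" "X\<^sup>\<dagger> = X" if "dominated n A X" for X
    using that psd_carrier psd_hermitian by (auto simp: dominated_def)
  have c': "X \<in> carrier_mat m m" if "dominated m C X" for X
    using that psd_carrier by (auto simp: dominated_def)
  have "kms t X (G (F X)) \<le> kms t X X"
  proof (rule bounded_orbit_contraction[where I = "{X. dominated n A X}"])
    fix x y assume "x \<in> {X. dominated n A X}" "y \<in> {X. dominated n A X}"
    then have xy: "dominated n A x" "dominated n A y" by auto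
    show "2 * kms t x y \<le> kms t x x + kms t y y" using xy c by (intro kms_arith) auto
    show "kms t x y \<le> Re (mtrace A)" by (rule kms_bound[OF xy])
    have "kms t (G (F x)) y = kms t y (G (F x))" using xy c F G by (intro kms_sym) auto
    also have "\<dots> = kms t' (F y) (F x)" using xy F by (intro adjoint[symmetric]) auto
    also have "\<dots> = kms t' (F x) (F y)" using xy c' F by (intro T.kms_sym) auto
    also have "\<dots> = kms t x (G (F y))" using xy F by (intro adjoint) auto
    finally show "kms t (G (F x)) y = kms t x (G (F y))" .
  qed (use F G X in auto)
  then show ?thesis using adjoint[OF X F[OF X]] by simp
qed

end

lemma psd_sqrt_exists:
  assumes "psd n A"
  shows "\<exists>s t P r. psd_sqrt n A s t P r"
  by (rule psd_root[OF assms], unfold psd_sqrt_def, blast)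

section \<open>Adjoints of linear maps\<close>

text \<open>The Hilbert-Schmidt dual (Heisenberg picture). The indices are swapped because tr(Z
  E_ji) is the (i,j) entry of Z.\<close>

definition trace_dual :: "nat \<Rightarrow> (complex mat \<Rightarrow> complex mat) \<Rightarrow> complex mat \<Rightarrow> complex mat" where
  "trace_dual n F Y = mat n n (\<lambda>(i,j). mtrace (Y * F (ecol n j * (ecol n i)\<^sup>\<dagger>)))"

lemma trace_dual_carrier [simp]: "trace_dual n F Y \<in> carrier_mat n n"
    "dim_row (trace_dual n F Y) = n" "dim_col (trace_dual n F Y) = n"
  by (simp_all add: trace_dual_def)

lemma index_ecol_outer: "k < n \<Longrightarrow> l < n \<Longrightarrow>
    (ecol n i * (ecol n j)\<^sup>\<dagger>) $$ (k,l) = (if k = i \<and> l = j then 1 else 0)"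
  by (subst index_mult_sum) (auto simp: index_ecol)

lemma matrix_units_expansion:
  assumes "X \<in> carrier_mat n n"
  shows "X = msum n n (\<lambda>j. msum n n (\<lambda>i. X $$ (i,j) \<cdot>\<^sub>m (ecol n i * (ecol n j)\<^sup>\<dagger>)))"
proof (rule eq_matI)
  let ?M = "msum n n (\<lambda>j. msum n n (\<lambda>i. X $$ (i,j) \<cdot>\<^sub>m (ecol n i * (ecol n j)\<^sup>\<dagger>)))"
  fix k l assume "k < dim_row ?M" "l < dim_col ?M"
  then have kl: "k < n" "l < n" by auto
  have "?M $$ (k,l) = (\<Sum>j<n. \<Sum>i<n. X $$ (i,j) * (ecol n i * (ecol n j)\<^sup>\<dagger>) $$ (k,l))"
    using kl by (auto simp: msum_def)
  also have "\<dots> = (\<Sum>j<n. \<Sum>i<n. if i = k then if j = l then X $$ (k,l) else 0 else 0)"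
    using kl by (intro sum.cong) (auto simp: index_ecol_outer)
  finally show "X $$ (k,l) = ?M $$ (k,l)" using kl by simp
qed (use assms in auto)

lemma trace_dual:
  assumes F: "lin_map n m F" and X: "X \<in> carrier_mat n n" and Y: "Y \<in> carrier_mat m m"
  shows "mtrace (trace_dual n F Y * X) = mtrace (Y * F X)"
proof -
  let ?E = "\<lambda>i j. ecol n i * (ecol n j)\<^sup>\<dagger>"
  have E: "?E i j \<in> carrier_mat n n" for i j by (rule carrier_matI) auto
  have FE: "F (?E i j) \<in> carrier_mat m m" for i j by (rule lin_mapD(1)[OF F E])
  have "F X = F (msum n n (\<lambda>j. msum n n (\<lambda>i. X $$ (i,j) \<cdot>\<^sub>m ?E i j)))"
    using matrix_units_expansion[OF X] by simp
  also have "\<dots> = msum m n (\<lambda>j. F (msum n n (\<lambda>i. X $$ (i,j) \<cdot>\<^sub>m ?E i j)))"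
    by (rule lin_map_msum[OF F]) simp
  also have "\<dots> = msum m n (\<lambda>j. msum m n (\<lambda>i. X $$ (i,j) \<cdot>\<^sub>m F (?E i j)))"
    using E by (intro msum_cong) (simp add: lin_map_msum[OF F] lin_mapD(3)[OF F])
  finally have FX: "F X = msum m n (\<lambda>j. msum m n (\<lambda>i. X $$ (i,j) \<cdot>\<^sub>m F (?E i j)))" .
  have "Y * F X = msum m n (\<lambda>j. msum m n (\<lambda>i. Y * (X $$ (i,j) \<cdot>\<^sub>m F (?E i j))))"
    unfolding FX using Y FE by (simp add: msum_left)
  then have "mtrace (Y * F X) = (\<Sum>j<n. \<Sum>i<n. mtrace (Y * (X $$ (i,j) \<cdot>\<^sub>m F (?E i j))))"
    using Y FE by (simp add: mtrace_msum)
  also have "\<dots> = (\<Sum>j<n. \<Sum>i<n. X $$ (i,j) * mtrace (Y * F (?E i j)))"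
  proof (intro sum.cong refl)
    fix i j
    have "Y * (X $$ (i,j) \<cdot>\<^sub>m F (?E i j)) = X $$ (i,j) \<cdot>\<^sub>m (Y * F (?E i j))"
      using Y FE[of i j] by (intro mat_smult_right) auto
    then show "mtrace (Y * (X $$ (i,j) \<cdot>\<^sub>m F (?E i j))) = X $$ (i,j) * mtrace (Y * F (?E i j))"
      using Y FE[of i j] by (simp add: mtrace_smult[of _ m])
  qed
  also have "\<dots> = (\<Sum>j<n. \<Sum>i<n. trace_dual n F Y $$ (j,i) * X $$ (i,j))"
    by (intro sum.cong) (auto simp: trace_dual_def mult.commute)
  also have "\<dots> = mtrace (trace_dual n F Y * X)"
    using X by (simp add: mtrace_def index_mult_sum)
  finally show ?thesis ..
qed

text \<open>Testing the dual against a vector v amounts to pairing \<open>Y\<close> with the image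
  of the positive rank-one operator of v, so positivity of \<open>F\<close> suffices.\<close>

lemma trace_dual_psd:
  assumes F: "lin_map n m F" "positive_map n m F" and Y: "psd m Y"
  shows "psd n (trace_dual n F Y)"
  unfolding psd_iff
proof (intro conjI ballI)
  fix v :: "complex mat" assume v: "v \<in> carrier_mat n 1"
  have vv: "psd n (v * v\<^sup>\<dagger>)" using psd_gram[of "v\<^sup>\<dagger>" 1 n] v by simp
  have "(v\<^sup>\<dagger> * trace_dual n F Y * v) $$ (0,0) = mtrace (v\<^sup>\<dagger> * (trace_dual n F Y * v))"
    using v by (simp add: mtrace_def mat_assoc)
  also have "\<dots> = mtrace ((trace_dual n F Y * v) * v\<^sup>\<dagger>)"
    using v by (intro mtrace_mult_comm[of _ 1 n]) auto
  also have "\<dots> = mtrace (trace_dual n F Y * (v * v\<^sup>\<dagger>))" using v by (simp add: mat_assoc)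
  also have "\<dots> = mtrace (Y * F (v * v\<^sup>\<dagger>))" by (rule trace_dual[OF F(1) psd_carrier[OF vv] psd_carrier[OF Y]])
  also have "\<dots> \<ge> 0" using F(2) vv Y by (intro mtrace_psd_mult[of m]) (auto simp: positive_map_def)
  finally show "0 \<le> (v\<^sup>\<dagger> * trace_dual n F Y * v) $$ (0,0)" .
qed simp

text \<open>Trace preservation dualises to unitality, which is what keeps the KMS adjoint inside the
  order interval.\<close>

lemma trace_dual_one:
  assumes "lin_map n m F" "trace_pres n F"
  shows "trace_dual n F (1\<^sub>m m) = 1\<^sub>m n"
proof (rule eq_matI)
  fix i j assume "i < dim_row (1\<^sub>m n :: complex mat)" "j < dim_col (1\<^sub>m n :: complex mat)"
  then have ij: "i < n" "j < n" by auto
  let ?E = "ecol n j * (ecol n i)\<^sup>\<dagger>"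
  have E: "?E \<in> carrier_mat n n" by (rule carrier_matI) auto
  have "trace_dual n F (1\<^sub>m m) $$ (i,j) = mtrace (F ?E)"
    using ij lin_mapD(1)[OF assms(1) E] by (simp add: trace_dual_def)
  also have "\<dots> = mtrace ?E" using assms(2) E by (simp add: trace_pres_def)
  also have "\<dots> = (\<Sum>k<n. if k = j then if i = j then 1 else 0 else 0)"
    by (auto simp: mtrace_def index_ecol_outer intro!: sum.cong)
  finally show "trace_dual n F (1\<^sub>m m) $$ (i,j) = 1\<^sub>m n $$ (i,j)" using ij by simp
qed (auto simp: trace_dual_def)

lemma trace_dual_minus:
  assumes "lin_map n m F" "X \<in> carrier_mat m m" "Y \<in> carrier_mat m m"
  shows "trace_dual n F (X - Y) = trace_dual n F X - trace_dual n F Y"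
proof (rule eq_matI)
  fix i j assume "i < dim_row (trace_dual n F X - trace_dual n F Y)" "j < dim_col (trace_dual n F X - trace_dual n F Y)"
  then have ij: "i < n" "j < n" by (auto simp: trace_dual_def)
  let ?E = "ecol n j * (ecol n i)\<^sup>\<dagger>"
  have "?E \<in> carrier_mat n n" by (rule carrier_matI) auto
  then have "F ?E \<in> carrier_mat m m" by (rule lin_mapD(1)[OF assms(1)])
  then show "trace_dual n F (X - Y) $$ (i,j) = (trace_dual n F X - trace_dual n F Y) $$ (i,j)"
    using ij assms by (simp add: trace_dual_def mat_minus_left mtrace_minus[of _ m])
qed (auto simp: trace_dual_def)

section \<open>Recovery by the Petz map\<close>

text \<open>The prefix \<open>S\<close> is for the marginal \<sigma> with \<open>s\<close>,
  \<open>t\<close>, \<open>P\<close>; the prefix \<open>E\<close> is for \<Sigma> on the joint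
  system, not for the environment alone, with \<open>z\<close>, \<open>u\<close>,
  \<open>Q\<close>.\<close>

locale petz = S: psd_sqrt dS \<sigma> s t P r + E: psd_sqrt "dS * dE" \<Sigma> z u Q q
  for dS dE \<sigma> s t P r \<Sigma> z u Q q +
  assumes marginal: "ptrace_E dS dE \<Sigma> = \<sigma>"
begin

definition petz_map :: "complex mat \<Rightarrow> complex mat" where
  "petz_map X = z * (lift dE (t * (X * t)) * z)"

lemma petz_map_carrier: "X \<in> carrier_mat dS dS \<Longrightarrow> petz_map X \<in> carrier_mat (dS * dE) (dS * dE)"
  unfolding petz_map_def by (intro carrier_matI) simp_all

lemma psd_lift: "psd dS X \<Longrightarrow> psd (dS * dE) (lift dE X)"
  by (intro psd_kron psd_one)

text \<open>From t X t \<le> 1 it follows that the image is at most z z = \<Sigma>.\<close>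

lemma petz_map_dominated:
  assumes "dominated dS \<sigma> X"
  shows "dominated (dS * dE) \<Sigma> (petz_map X)"
proof -
  have X: "psd dS X" "psd dS (\<sigma> - X)" using assms by (auto simp: dominated_def)
  have Xc: "X \<in> carrier_mat dS dS" by (rule psd_carrier[OF X(1)])
  have sand: "psd (dS * dE) (z * (lift dE Y * z))" if "psd dS Y" for Y
    using psd_conj[OF psd_lift[OF that] E.carrier(1)] psd_carrier[OF that] by (simp add: E.herm mat_assoc)
  have "psd dS (t\<^sup>\<dagger> * X * t)" by (rule psd_conj[OF X(1) S.carrier(2)])
  then have 1: "psd (dS * dE) (petz_map X)"
    unfolding petz_map_def using Xc by (intro sand) (simp add: S.herm mat_assoc)
  have "lift dE (1\<^sub>m dS - t * (X * t)) = 1\<^sub>m (dS * dE) - lift dE (t * (X * t))"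
    using Xc by (subst kron_minus_left) (auto simp: kron_one)
  then have "\<Sigma> - petz_map X = z * (lift dE (1\<^sub>m dS - t * (X * t)) * z)"
    using Xc by (simp add: petz_map_def E.mults(1)[symmetric] mat_minus_left mat_minus_right)
  then have 2: "psd (dS * dE) (\<Sigma> - petz_map X)"
    using sand[OF S.psd_one_minus_conj[OF X(2) Xc]] by simp
  show ?thesis using 1 2 by (simp add: dominated_def)
qed

lemma ptrace_dominated:
  assumes "dominated (dS * dE) \<Sigma> Y"
  shows "dominated dS \<sigma> (ptrace_E dS dE Y)"
proof -
  have Y: "psd (dS * dE) Y" "psd (dS * dE) (\<Sigma> - Y)" using assms by (auto simp: dominated_def)
  show ?thesis
    using psd_ptrace[OF Y(1)] psd_ptrace[OF Y(2)] psd_carrier[OF Y(1)] E.A_carrier(1) marginal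
    by (simp add: dominated_def ptrace_minus)
qed

text \<open>Cycling \<open>z\<close> around the trace leaves Q Y Q, which equals \<open>Y\<close>
  because \<open>Y\<close> lies below \<Sigma>; then the duality between lift and partial trace
  applies.\<close>

lemma petz_map_adjoint:
  assumes X: "X \<in> carrier_mat dS dS" and Y: "dominated (dS * dE) \<Sigma> Y"
  shows "kms u (petz_map X) Y = kms t X (ptrace_E dS dE Y)"
proof -
  have Yc: "Y \<in> carrier_mat (dS * dE) (dS * dE)" using Y psd_carrier by (auto simp: dominated_def)
  let ?L = "lift dE (t * (X * t))"
  have Lc: "?L \<in> carrier_mat (dS * dE) (dS * dE)" by (rule carrier_matI) auto
  have "mtrace (petz_map X * (u * (Y * u))) = mtrace (z * (?L * (Q * (Y * u))))"
    using Yc Lc by (simp add: petz_map_def mat_assoc E.cancels)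
  also have "\<dots> = mtrace ((?L * (Q * (Y * u))) * z)"
    using Yc Lc by (intro mtrace_mult_comm[of _ "dS * dE" "dS * dE"] carrier_matI) simp_all
  also have "\<dots> = mtrace (?L * Y)"
    using Yc Lc by (simp add: mat_assoc E.mults E.dominated_support[OF Y])
  also have "\<dots> = mtrace ((t * (X * t)) * ptrace_E dS dE Y)"
    using Yc X by (intro mtrace_lift) auto
  also have "\<dots> = mtrace (t * (X * (t * ptrace_E dS dE Y)))" using X by (simp add: mat_assoc)
  also have "\<dots> = mtrace ((X * (t * ptrace_E dS dE Y)) * t)"
    using X by (intro mtrace_mult_comm[of _ dS dS] carrier_matI) simp_all
  also have "\<dots> = mtrace (X * (t * (ptrace_E dS dE Y * t)))" using X by (simp add: mat_assoc)
  finally show ?thesis by (simp add: kms_def)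
qed

text \<open>With x the marginal of \<rho>, the square of R x - \<rho> expands to two squares, each
  at most <x, x> by contractivity, minus twice a cross term equal to <x, x>.\<close>

lemma petz_recovery:
  assumes L: "lin_map dS (dS * dE) \<Lambda>" "trace_pres dS \<Lambda>" "positive_map dS (dS * dE) \<Lambda>"
    and fixpt: "\<Lambda> \<sigma> = \<Sigma>" "\<Lambda> (ptrace_E dS dE \<rho>) = \<rho>"
    and rho: "dominated (dS * dE) \<Sigma> \<rho>"
  shows "petz_map (ptrace_E dS dE \<rho>) = \<rho>"
proof -
  define x where "x = ptrace_E dS dE \<rho>"
  have x: "dominated dS \<sigma> x" unfolding x_def by (rule ptrace_dominated[OF rho])
  have xc: "x \<in> carrier_mat dS dS" by (simp add: x_def)
  have rc: "\<rho> \<in> carrier_mat (dS * dE) (dS * dE)" and rh: "\<rho>\<^sup>\<dagger> = \<rho>"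
    using rho psd_carrier psd_hermitian by (auto simp: dominated_def)
  \<comment> \<open>The KMS adjoint of \<Lambda>: its Hilbert-Schmidt dual between the square roots
    of the two reference operators.\<close>
  define G where "G Y = s * (trace_dual dS \<Lambda> (u * (Y * u)) * s)" for Y
  have L_dom: "dominated (dS * dE) \<Sigma> (\<Lambda> X)" if "dominated dS \<sigma> X" for X
  proof -
    have X: "psd dS X" "psd dS (\<sigma> - X)" using that by (auto simp: dominated_def)
    have "\<Lambda> (\<sigma> - X) = \<Sigma> - \<Lambda> X"
      using lin_map_minus[OF L(1) S.A_carrier(1) psd_carrier[OF X(1)]] fixpt by simp
    then show ?thesis using X L(3) by (auto simp: dominated_def positive_map_def)
  qed
  have G_dom: "dominated dS \<sigma> (G Y)" if "dominated (dS * dE) \<Sigma> Y" for Y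
  proof -
    have Y: "psd (dS * dE) Y" "psd (dS * dE) (\<Sigma> - Y)" using that by (auto simp: dominated_def)
    have Yc: "Y \<in> carrier_mat (dS * dE) (dS * dE)" by (rule psd_carrier[OF Y(1)])
    have sand: "psd dS (s * (Z * s))" if "psd dS Z" for Z
      using psd_conj[OF that S.carrier(1)] psd_carrier[OF that] by (simp add: S.herm mat_assoc)
    have "psd (dS * dE) (u\<^sup>\<dagger> * Y * u)" by (rule psd_conj[OF Y(1) E.carrier(2)])
    then have uYu: "psd (dS * dE) (u * (Y * u))" using Yc by (simp add: E.herm mat_assoc)
    have 1: "psd dS (G Y)" unfolding G_def by (rule sand[OF trace_dual_psd[OF L(1,3) uYu]])
    have "trace_dual dS \<Lambda> (1\<^sub>m (dS * dE) - u * (Y * u)) = 1\<^sub>m dS - trace_dual dS \<Lambda> (u * (Y * u))"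
      using trace_dual_minus[OF L(1) one_carrier_mat psd_carrier[OF uYu]] trace_dual_one[OF L(1,2)] by simp
    then have "\<sigma> - G Y = s * (trace_dual dS \<Lambda> (1\<^sub>m (dS * dE) - u * (Y * u)) * s)"
      by (simp add: G_def S.mults(1)[symmetric] mat_minus_left mat_minus_right)
    then have 2: "psd dS (\<sigma> - G Y)"
      using sand[OF trace_dual_psd[OF L(1,3) E.psd_one_minus_conj[OF Y(2) Yc]]] by simp
    show ?thesis using 1 2 by (simp add: dominated_def)
  qed
  have G_adj: "kms u (\<Lambda> X) Y = kms t X (G Y)" if X: "dominated dS \<sigma> X" and Y: "dominated (dS * dE) \<Sigma> Y" for X Y
  proof -
    have Xc: "X \<in> carrier_mat dS dS" using X psd_carrier by (auto simp: dominated_def)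
    have Yc: "Y \<in> carrier_mat (dS * dE) (dS * dE)" using Y psd_carrier by (auto simp: dominated_def)
    have LX: "\<Lambda> X \<in> carrier_mat (dS * dE) (dS * dE)" by (rule lin_mapD(1)[OF L(1) Xc])
    let ?T = "trace_dual dS \<Lambda> (u * (Y * u))"
    have uYu: "u * (Y * u) \<in> carrier_mat (dS * dE) (dS * dE)" using Yc by (intro carrier_matI) simp_all
    have "mtrace (\<Lambda> X * (u * (Y * u))) = mtrace ((u * (Y * u)) * \<Lambda> X)"
      by (rule mtrace_mult_comm[OF LX uYu])
    also have "\<dots> = mtrace (?T * X)" by (rule trace_dual[OF L(1) Xc uYu, symmetric])
    also have "\<dots> = mtrace (X * ?T)" by (rule mtrace_mult_comm[OF trace_dual_carrier(1) Xc])
    \<comment> \<open>\<open>P\<close> is placed on both sides of \<open>X\<close> because unfolding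
      \<open>G\<close> between two factors \<open>t\<close> produces exactly these
      projections.\<close>
    also have "\<dots> = mtrace (P * ((X * P) * ?T))"
    proof -
      have "mtrace (P * (X * ?T)) = mtrace ((X * ?T) * P)"
        using Xc by (intro mtrace_mult_comm[of _ dS dS] carrier_matI) simp_all
      moreover have "P * (X * ?T) = X * ?T"
        using Xc S.dominated_support[OF X] by (simp add: mat_assoc[symmetric])
      ultimately show ?thesis using S.dominated_support[OF X] by simp
    qed
    also have "\<dots> = mtrace (((X * P) * ?T) * P)"
      using Xc by (intro mtrace_mult_comm[of _ dS dS] carrier_matI) simp_all
    also have "\<dots> = mtrace (X * (t * (G Y * t)))"
      using Xc by (simp add: G_def mat_assoc S.cancels S.mults)
    finally show ?thesis by (simp add: kms_def)
  qed
  have c1: "kms u (\<Lambda> x) (\<Lambda> x) \<le> kms t x x"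
    by (rule S.kms_contraction[OF E.psd_sqrt_axioms L_dom G_dom G_adj x])
  have c2: "kms u (petz_map x) (petz_map x) \<le> kms t x x"
  proof (rule S.kms_contraction[OF E.psd_sqrt_axioms petz_map_dominated ptrace_dominated _ x])
    show "kms u (petz_map X) Y = kms t X (ptrace_E dS dE Y)"
      if "dominated dS \<sigma> X" "dominated (dS * dE) \<Sigma> Y" for X Y
      using that petz_map_adjoint psd_carrier by (auto simp: dominated_def)
  qed
  have px: "dominated (dS * dE) \<Sigma> (petz_map x)" by (rule petz_map_dominated[OF x])
  have pc: "petz_map x \<in> carrier_mat (dS * dE) (dS * dE)" and ph: "(petz_map x)\<^sup>\<dagger> = petz_map x"
    using px psd_carrier psd_hermitian by (auto simp: dominated_def)
  define D where "D = petz_map x - \<rho>"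
  have Dc: "D \<in> carrier_mat (dS * dE) (dS * dE)" using pc rc by (auto simp: D_def)
  have Dh: "D\<^sup>\<dagger> = D" using pc rc ph rh by (simp add: D_def adjoint_minus)
  have cross: "kms u (petz_map x) \<rho> = kms t x x"
    using petz_map_adjoint[OF xc rho] by (simp add: x_def)
  have "kms u D D = kms u (petz_map x) (petz_map x) - kms u \<rho> (petz_map x) - (kms u (petz_map x) \<rho> - kms u \<rho> \<rho>)"
    using pc rc Dc unfolding D_def by (simp add: E.kms_minus)
  also have "\<dots> \<le> 0"
    using c1 c2 cross E.kms_sym[OF rc pc] fixpt(2) by (simp add: x_def)
  finally have "Q * (D * Q) = 0\<^sub>m (dS * dE) (dS * dE)" by (rule E.kms_eq_0[OF Dc Dh])
  \<comment> \<open>Both terms of \<open>D\<close> lie below \<Sigma>, so \<open>D\<close> lives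
    where the form is definite.\<close>
  also have "Q * (D * Q) = D"
    unfolding D_def using pc rc E.dominated_support[OF px] E.dominated_support[OF rho]
    by (simp add: mat_minus_left mat_minus_right)
  finally show ?thesis
    using pc rc unfolding D_def x_def[symmetric] by (rule mat_eq_of_minus)
qed

end

section \<open>The algebra commuting with the Petz map\<close>

lemma kron_add_left:
  assumes "A \<in> carrier_mat n m" "B \<in> carrier_mat n m"
  shows "kron (A + B) C = kron A C + kron B C"
proof (rule eq_matI)
  fix i j assume "i < dim_row (kron A C + kron B C)" "j < dim_col (kron A C + kron B C)"
  then have ij: "i < n * dim_row C" "j < m * dim_col C" using assms by auto
  then show "kron (A + B) C $$ (i,j) = (kron A C + kron B C) $$ (i,j)"
    using div_mod_less[OF ij(1)] div_mod_less[OF ij(2)] assms by (simp add: index_kron algebra_simps)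
qed (use assms in auto)

lemma ptrace_adjoint:
  assumes "X \<in> carrier_mat (n * c) (n * c)"
  shows "ptrace_E n c (X\<^sup>\<dagger>) = (ptrace_E n c X)\<^sup>\<dagger>"
proof (rule eq_matI)
  fix i j assume "i < dim_row ((ptrace_E n c X)\<^sup>\<dagger>)" "j < dim_col ((ptrace_E n c X)\<^sup>\<dagger>)"
  then have ij: "i < n" "j < n" by auto
  then show "ptrace_E n c (X\<^sup>\<dagger>) $$ (i,j) = (ptrace_E n c X)\<^sup>\<dagger> $$ (i,j)"
    using assms mult_add_less[OF ij(1)] mult_add_less[OF ij(2)] by (simp add: ptrace_E_def)
qed auto

context petz
begin

abbreviation L :: "complex mat \<Rightarrow> complex mat" where "L \<equiv> lift dE"

text \<open>A Stinespring-type operator of the Petz map: \<open>petz_map X\<close> is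
  \<open>G * L X * G\<^sup>\<dagger>\<close>, and by \<open>\<Phi>_alt\<close> the map \<Phi> is the
  partial trace of \<open>G\<^sup>\<dagger> * L W * G\<close>.\<close>

definition G :: "complex mat" where "G = z * L t"

text \<open>The composition tr_E R, transported by conjugation with \<open>t\<close>: if R recovers
  a state with marginal x, then \<open>t * (x * t)\<close> is a fixed point. Without full support it
  is unital only up to \<open>P\<close>.\<close>

definition \<Phi> :: "complex mat \<Rightarrow> complex mat" where "\<Phi> W = t * (ptrace_E dS dE (z * (L W * z)) * t)"

text \<open>Taking adjoints in the second equation shows that Y \<otimes> 1 commutes with both
  \<open>G\<close> and \<open>G\<^sup>\<dagger>\<close>, so the set is closed under
  adjoints.\<close>

definition alg :: "complex mat set" where
  "alg = {Y \<in> carrier_mat dS dS. L Y * G = G * L Y \<and> L (Y\<^sup>\<dagger>) * G = G * L (Y\<^sup>\<dagger>)}"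

lemma G_dims [simp]: "dim_row G = dS * dE" "dim_col G = dS * dE"
  by (simp_all add: G_def)

lemma \<Phi>_dims [simp]: "dim_row (\<Phi> W) = dS" "dim_col (\<Phi> W) = dS"
  by (simp_all add: \<Phi>_def)

lemma L_mult: "dim_col A = dim_row B \<Longrightarrow> L A * L B = L (A * B)"
  by (rule lift_mult)

text \<open>The joint support lies in the support of the marginal tensored with E: the trace of
  \<Sigma> against (1 - P) \<otimes> 1 is that of \<sigma> against 1 - P, which is zero.\<close>

lemma z_support: "z * L P = z" "L P * z = z"
proof -
  let ?K = "L (1\<^sub>m dS - P)"
  have Pc: "1\<^sub>m dS - P \<in> carrier_mat dS dS" by (rule carrier_matI) simp_all
  have Kc: "?K \<in> carrier_mat (dS * dE) (dS * dE)" by (rule carrier_matI) simp_all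
  have Kh: "?K\<^sup>\<dagger> = ?K" by (simp add: lift_adjoint adjoint_minus S.herm)
  have SK: "\<Sigma> * ?K \<in> carrier_mat (dS * dE) (dS * dE)" using E.A_carrier by (intro carrier_matI) simp_all
  have "mtrace (?K\<^sup>\<dagger> * \<Sigma> * ?K) = mtrace (?K * (\<Sigma> * ?K))" using E.A_carrier Kh by (simp add: mat_assoc)
  also have "\<dots> = mtrace ((1\<^sub>m dS - P) * ptrace_E dS dE (\<Sigma> * ?K))" by (rule mtrace_lift[OF SK Pc])
  also have "ptrace_E dS dE (\<Sigma> * ?K) = 0\<^sub>m dS dS"
    unfolding ptrace_lift(1)[OF E.A_carrier(1) Pc] marginal by (rule S.A_complement)
  finally have "mtrace (?K\<^sup>\<dagger> * \<Sigma> * ?K) = 0" by simp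
  moreover have "?K\<^sup>\<dagger> * \<Sigma> * ?K = (z * ?K)\<^sup>\<dagger> * (z * ?K)"
    by (simp add: E.mults(1)[symmetric] mat_assoc adjoint_mult E.herm)
  moreover have zK: "z * ?K \<in> carrier_mat (dS * dE) (dS * dE)" by (rule carrier_matI) simp_all
  ultimately have "z * ?K = 0\<^sub>m (dS * dE) (dS * dE)" using mtrace_gram_eq_0[OF zK] by simp
  moreover have "?K = 1\<^sub>m (dS * dE) - L P"
    using S.carrier(3) by (subst kron_minus_left[of _ dS dS]) (simp_all add: kron_one)
  ultimately have 0: "z - z * L P = 0\<^sub>m (dS * dE) (dS * dE)" by (simp add: mat_minus_right)
  have "z * L P \<in> carrier_mat (dS * dE) (dS * dE)" by (rule carrier_matI) simp_all
  from mat_eq_of_minus[OF 0 E.carrier(1) this] show 1: "z * L P = z" by (rule sym)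
  have "L P * z = (z * L P)\<^sup>\<dagger>" by (simp add: adjoint_mult lift_adjoint S.herm E.herm)
  then show "L P * z = z" unfolding 1 E.herm .
qed

lemma G_s: "G * L s = z"
  by (simp add: G_def mat_assoc L_mult S.mults z_support)

lemma G_P: "G * L P = G" "L P * G = G"
proof -
  show "G * L P = G" by (simp add: G_def mat_assoc L_mult S.mults)
  have "L P * G = (L P * z) * L t" by (simp add: G_def mat_assoc)
  then show "L P * G = G" by (simp add: z_support G_def)
qed

lemma G_adjoint: "G\<^sup>\<dagger> = L t * z"
  by (simp add: G_def adjoint_mult lift_adjoint S.herm E.herm)

lemma \<Phi>_alt:
  assumes "W \<in> carrier_mat dS dS"
  shows "\<Phi> W = ptrace_E dS dE (G\<^sup>\<dagger> * (L W * G))"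
proof -
  have c: "z * (L W * z) \<in> carrier_mat (dS * dE) (dS * dE)"
    "z * (L W * z) * L t \<in> carrier_mat (dS * dE) (dS * dE)"
    using assms by (intro carrier_matI; simp)+
  have "G\<^sup>\<dagger> * (L W * G) = L t * ((z * (L W * z)) * L t)"
    using assms by (simp add: G_adjoint) (simp add: G_def mat_assoc)
  then show ?thesis
    by (simp add: \<Phi>_def ptrace_lift(2)[OF c(2) S.carrier(2)] ptrace_lift(1)[OF c(1) S.carrier(2)])
qed

lemma \<Phi>_adjoint: "W \<in> carrier_mat dS dS \<Longrightarrow> \<Phi> (W\<^sup>\<dagger>) = (\<Phi> W)\<^sup>\<dagger>"
proof -
  assume W: "W \<in> carrier_mat dS dS"
  have c: "z * (L W * z) \<in> carrier_mat (dS * dE) (dS * dE)"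
    using W by (intro carrier_matI) simp_all
  have "z * (L (W\<^sup>\<dagger>) * z) = (z * (L W * z))\<^sup>\<dagger>"
    using W by (simp add: adjoint_mult lift_adjoint E.herm mat_assoc)
  then show ?thesis by (simp add: \<Phi>_def ptrace_adjoint[OF c] adjoint_mult S.herm mat_assoc)
qed

lemma \<Phi>_one: "\<Phi> (1\<^sub>m dS) = P"
proof -
  have "z * (L (1\<^sub>m dS) * z) = \<Sigma>" by (simp add: kron_one E.mults)
  then show ?thesis by (simp add: \<Phi>_def marginal S.tAt)
qed

text \<open>The outer factors \<open>t\<close> meet \<sigma> = s s and leave only \<open>P\<close>,
  which \<open>z\<close> absorbs. What remains is the trace of \<Sigma> against B \<otimes> 1, hence
  that of \<sigma> against \<open>B\<close>.\<close>

lemma \<Phi>_invariant: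
  assumes "B \<in> carrier_mat dS dS"
  shows "mtrace (\<sigma> * \<Phi> B) = mtrace (\<sigma> * B)"
proof -
  let ?X = "ptrace_E dS dE (z * (L B * z))"
  have c: "z * (L B * z) \<in> carrier_mat (dS * dE) (dS * dE)" using assms by (intro carrier_matI; simp)+
  have "mtrace (\<sigma> * \<Phi> B) = mtrace (s * (?X * t))"
    by (simp add: \<Phi>_def S.mults(1)[symmetric] mat_assoc S.cancels)
  also have "\<dots> = mtrace ((?X * t) * s)"
    by (rule mtrace_mult_comm[of _ dS dS]) (rule carrier_matI; simp)+
  also have "\<dots> = mtrace (?X * P)" by (simp add: mat_assoc S.mults)
  also have "\<dots> = mtrace (P * ?X)"
    by (rule mtrace_mult_comm[of _ dS dS]) (rule carrier_matI; simp)+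
  also have "\<dots> = mtrace (L P * (z * (L B * z)))" by (rule mtrace_lift[OF c S.carrier(3), symmetric])
  also have "L P * (z * (L B * z)) = (L P * z) * (L B * z)" using assms by (simp add: mat_assoc)
  also have "\<dots> = z * (L B * z)" unfolding z_support ..
  also have "mtrace \<dots> = mtrace ((L B * z) * z)"
    using assms by (intro mtrace_mult_comm[of _ "dS * dE" "dS * dE"] carrier_matI) simp_all
  also have "\<dots> = mtrace (L B * \<Sigma>)" using assms by (simp add: mat_assoc E.mults)
  also have "\<dots> = mtrace (B * \<sigma>)" using mtrace_lift[OF E.A_carrier(1) assms] marginal by simp
  also have "\<dots> = mtrace (\<sigma> * B)" by (rule mtrace_mult_comm[OF assms S.A_carrier(1)])
  finally show ?thesis .
qed

lemma ptrace_lifts: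
  assumes "X \<in> carrier_mat (dS * dE) (dS * dE)" "A \<in> carrier_mat dS dS" "B \<in> carrier_mat dS dS"
  shows "ptrace_E dS dE (L A * (X * L B)) = A * (ptrace_E dS dE X * B)"
proof -
  have "X * L B \<in> carrier_mat (dS * dE) (dS * dE)" using assms by (intro carrier_matI) simp_all
  then show ?thesis using assms by (simp add: ptrace_lift)
qed

text \<open>Equality in the Schwarz inequality \<open>\<Phi>(W\<^sup>\<dagger>W) \<ge> \<Phi>(W)\<^sup>\<dagger>\<Phi>(W)\<close>: the defect of a fixed point \<open>W\<close> is
  \<open>ptrace (D\<^sup>\<dagger>D)\<close> with \<open>D\<close> the commutator of \<open>W\<close> and \<open>G\<close>, and it vanishes because \<open>\<sigma>\<close> is invariant.\<close>

lemma fixed_point_commutes: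
  assumes W: "W \<in> carrier_mat dS dS" "P * W = W" "W * P = W" and fixed: "\<Phi> W = W"
  shows "L W * G = G * L W"
proof -
  define D where "D = L W * G - G * L W"
  have dW [simp]: "dim_row W = dS" "dim_col W = dS" using W(1) by auto
  have Dc: "D \<in> carrier_mat (dS * dE) (dS * dE)" by (rule carrier_matI) (simp_all add: D_def)
  have Dd [simp]: "dim_row D = dS * dE" "dim_col D = dS * dE" using Dc by auto
  have Wd: "W\<^sup>\<dagger> \<in> carrier_mat dS dS" using W by simp
  have WW: "W\<^sup>\<dagger> * W \<in> carrier_mat dS dS" by (rule carrier_matI) simp_all
  have fd: "\<Phi> (W\<^sup>\<dagger>) = W\<^sup>\<dagger>" using \<Phi>_adjoint[OF W(1)] fixed by simp
  have c: "G\<^sup>\<dagger> * (L X * G) \<in> carrier_mat (dS * dE) (dS * dE)" if "X \<in> carrier_mat dS dS" for X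
    using that by (intro carrier_matI) simp_all
  \<comment> \<open>The four terms of the Gram product of \<open>D\<close>, bracketed so that the
    outer lifts leave the partial trace and the inner part is a value of \<Phi>.\<close>
  define T1 where "T1 = G\<^sup>\<dagger> * (L (W\<^sup>\<dagger> * W) * G)"
  define T2 where "T2 = (G\<^sup>\<dagger> * (L (W\<^sup>\<dagger>) * G)) * L W"
  define T3 where "T3 = L (W\<^sup>\<dagger>) * (G\<^sup>\<dagger> * (L W * G))"
  define T4 where "T4 = L (W\<^sup>\<dagger>) * ((G\<^sup>\<dagger> * (L (1\<^sub>m dS) * G)) * L W)"
  have Tc: "T1 \<in> carrier_mat (dS * dE) (dS * dE)" "T2 \<in> carrier_mat (dS * dE) (dS * dE)"
    "T3 \<in> carrier_mat (dS * dE) (dS * dE)" "T4 \<in> carrier_mat (dS * dE) (dS * dE)"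
    unfolding T1_def T2_def T3_def T4_def by (rule carrier_matI; simp)+
  have DD: "D\<^sup>\<dagger> * D = (T1 - T3) - (T2 - T4)"
    by (simp add: D_def T1_def T2_def T3_def T4_def mat_dist lift_adjoint L_mult[symmetric] kron_one)
  have p1: "ptrace_E dS dE T1 = \<Phi> (W\<^sup>\<dagger> * W)" by (simp add: T1_def \<Phi>_alt[OF WW])
  have p2: "ptrace_E dS dE T2 = W\<^sup>\<dagger> * W"
    unfolding T2_def ptrace_lift(1)[OF c[OF Wd] W(1)] \<Phi>_alt[OF Wd, symmetric] fd ..
  have p3: "ptrace_E dS dE T3 = W\<^sup>\<dagger> * W"
    unfolding T3_def ptrace_lift(2)[OF c[OF W(1)] Wd] \<Phi>_alt[OF W(1), symmetric] fixed ..
  have p4: "ptrace_E dS dE T4 = W\<^sup>\<dagger> * W"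
    unfolding T4_def ptrace_lifts[OF c[OF one_carrier_mat] Wd W(1)] \<Phi>_alt[OF one_carrier_mat, symmetric] \<Phi>_one W(2) ..
  have "ptrace_E dS dE (D\<^sup>\<dagger> * D) = (\<Phi> (W\<^sup>\<dagger> * W) - W\<^sup>\<dagger> * W) - (W\<^sup>\<dagger> * W - W\<^sup>\<dagger> * W)"
    unfolding DD
    using Tc minus_carrier_mat[OF Tc(3), of T1] minus_carrier_mat[OF Tc(4), of T2]
    by (simp add: ptrace_minus p1 p2 p3 p4)
  also have "\<dots> = \<Phi> (W\<^sup>\<dagger> * W) - W\<^sup>\<dagger> * W" by (intro eq_matI) auto
  finally have pD: "ptrace_E dS dE (D\<^sup>\<dagger> * D) = \<Phi> (W\<^sup>\<dagger> * W) - W\<^sup>\<dagger> * W" .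
  have DDc: "D\<^sup>\<dagger> * D \<in> carrier_mat (dS * dE) (dS * dE)" by (rule carrier_matI) simp_all
  \<comment> \<open>The squared norm of \<open>R\<close> is the trace of \<sigma> against the
    defect, and invariance of \<sigma> makes it zero.\<close>
  define R where "R = L s * D\<^sup>\<dagger>"
  have Rc: "R \<in> carrier_mat (dS * dE) (dS * dE)" unfolding R_def by (rule carrier_matI) simp_all
  have "mtrace (R\<^sup>\<dagger> * R) = mtrace (D * (L \<sigma> * D\<^sup>\<dagger>))"
    by (simp add: R_def adjoint_mult lift_adjoint S.herm mat_assoc S.mults(1)[symmetric] L_mult[symmetric])
  also have "\<dots> = mtrace ((L \<sigma> * D\<^sup>\<dagger>) * D)"
    using S.A_carrier by (intro mtrace_mult_comm[of _ "dS * dE" "dS * dE"] carrier_matI) simp_all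
  also have "\<dots> = mtrace (L \<sigma> * (D\<^sup>\<dagger> * D))" using S.A_carrier by (simp add: mat_assoc)
  also have "\<dots> = mtrace (\<sigma> * (\<Phi> (W\<^sup>\<dagger> * W) - W\<^sup>\<dagger> * W))"
    unfolding mtrace_lift[OF DDc S.A_carrier(1)] pD ..
  also have "\<dots> = mtrace (\<sigma> * \<Phi> (W\<^sup>\<dagger> * W)) - mtrace (\<sigma> * (W\<^sup>\<dagger> * W))"
    using S.A_carrier by (simp add: mat_minus_right mtrace_minus_square)
  also have "\<dots> = 0" using \<Phi>_invariant[OF WW] by simp
  finally have "R = 0\<^sub>m (dS * dE) (dS * dE)" by (rule mtrace_gram_eq_0[OF Rc])
  then have "R\<^sup>\<dagger> = 0\<^sub>m (dS * dE) (dS * dE)" by simp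
  then have Ds: "D * L s = 0\<^sub>m (dS * dE) (dS * dE)"
    by (simp add: R_def adjoint_mult lift_adjoint S.herm)
  \<comment> \<open>So far \<open>D\<close> vanishes only on the support of \<sigma>. Since
    \<open>W\<close> and \<open>G\<close> absorb \<open>P\<close> on the right, that is all of
    \<open>D\<close>.\<close>
  have "D * L P = (D * L s) * L t" by (simp add: mat_assoc L_mult S.mults)
  then have "D * L P = 0\<^sub>m (dS * dE) (dS * dE)" unfolding Ds by simp
  moreover have "D * L P = D"
    by (simp add: D_def mat_minus_left mat_assoc G_P L_mult W(3))
  ultimately have "L W * G - G * L W = 0\<^sub>m (dS * dE) (dS * dE)" by (simp add: D_def)
  then show ?thesis by (rule mat_eq_of_minus) (rule carrier_matI; simp)+
qed

lemma fixed_point_mem: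
  assumes W: "W \<in> carrier_mat dS dS" "P * W = W" "W * P = W" and fixed: "\<Phi> W = W"
  shows "W \<in> alg"
proof -
  have "P * W\<^sup>\<dagger> = W\<^sup>\<dagger>" "W\<^sup>\<dagger> * P = W\<^sup>\<dagger>"
    using arg_cong[OF W(3), of adj] arg_cong[OF W(2), of adj] W(1) by (simp_all add: adjoint_mult S.herm)
  moreover have "\<Phi> (W\<^sup>\<dagger>) = W\<^sup>\<dagger>" using \<Phi>_adjoint[OF W(1)] fixed by simp
  ultimately have "L (W\<^sup>\<dagger>) * G = G * L (W\<^sup>\<dagger>)" using W(1) by (intro fixed_point_commutes) simp_all
  then show ?thesis using W(1) fixed_point_commutes[OF assms] by (simp add: alg_def)
qed

section \<open>The algebra and its modular invariance\<close>

lemma alg_star_algebra: "star_algebra dS alg"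
  unfolding star_algebra_def
proof (intro conjI ballI allI)
  show "alg \<subseteq> carrier_mat dS dS" by (auto simp: alg_def)
  show "1\<^sub>m dS \<in> alg" by (simp add: alg_def kron_one)
  fix X assume X: "X \<in> alg"
  then have Xc: "X \<in> carrier_mat dS dS" "dim_row X = dS" "dim_col X = dS"
    and XG: "L X * G = G * L X" "L (X\<^sup>\<dagger>) * G = G * L (X\<^sup>\<dagger>)" by (auto simp: alg_def)
  show "X\<^sup>\<dagger> \<in> alg" using Xc XG by (simp add: alg_def)
  show "c \<cdot>\<^sub>m X \<in> alg" for c
    using Xc XG by (simp add: alg_def kron_smult_left mat_smult_left mat_smult_right)
  fix Y assume Y: "Y \<in> alg"
  then have Yc: "Y \<in> carrier_mat dS dS" "dim_row Y = dS" "dim_col Y = dS"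
    and YG: "L Y * G = G * L Y" "L (Y\<^sup>\<dagger>) * G = G * L (Y\<^sup>\<dagger>)" by (auto simp: alg_def)
  show "X + Y \<in> alg"
    using Xc Yc XG YG
    by (simp add: alg_def adjoint_add kron_add_left[of _ dS dS] mat_add_left mat_add_right)
  have comm: "L (A * B) * G = G * L (A * B)"
    if "L A * G = G * L A" "L B * G = G * L B" "dim_row A = dS" "dim_col A = dS" "dim_row B = dS" "dim_col B = dS" for A B
  proof -
    have "L (A * B) * G = L A * (L B * G)" using that(3-6) by (simp add: L_mult[symmetric] mat_assoc)
    also have "\<dots> = (L A * G) * L B" unfolding that(2) using that(3-6) by (simp add: mat_assoc)
    also have "\<dots> = G * L (A * B)" unfolding that(1) using that(3-6) by (simp add: L_mult[symmetric] mat_assoc)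
    finally show ?thesis .
  qed
  have "X * Y \<in> carrier_mat dS dS" by (rule mult_carrier_mat[OF Xc(1) Yc(1)])
  then show "X * Y \<in> alg"
    using Xc Yc XG YG comm[of X Y] comm[of "Y\<^sup>\<dagger>" "X\<^sup>\<dagger>"] by (simp add: alg_def adjoint_mult)
qed

text \<open>This is \<sigma>^(-1/2) Y \<sigma>^(1/2), a modular translate of \<open>Y\<close> at
  imaginary time. It is a fixed point of \<Phi> because commuting Y past \<open>G\<close> turns the
  operator inside the partial trace into (Y \<otimes> 1) \<Sigma>.\<close>

lemma modular_mem:
  assumes Y: "Y \<in> alg"
  shows "t * (Y * s) \<in> alg"
proof (rule fixed_point_mem)
  have Yc: "Y \<in> carrier_mat dS dS" "dim_row Y = dS" "dim_col Y = dS"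
    and YG: "L Y * G = G * L Y" using Y by (auto simp: alg_def)
  let ?W = "t * (Y * s)"
  show "?W \<in> carrier_mat dS dS" using Yc by (intro carrier_matI) simp_all
  show "P * ?W = ?W" using Yc by (simp add: S.cancels)
  show "?W * P = ?W" using Yc by (simp add: mat_assoc S.mults)
  have "z * (L ?W * z) = (z * L t) * (L Y * (L s * z))"
    using Yc by (simp add: mat_assoc L_mult[symmetric])
  also have "\<dots> = (G * L Y) * (L s * z)" using Yc by (simp add: G_def mat_assoc)
  also have "\<dots> = (L Y * (G * L s)) * z" unfolding YG[symmetric] using Yc by (simp add: mat_assoc)
  also have "\<dots> = L Y * \<Sigma>" unfolding G_s using Yc by (simp add: mat_assoc E.mults)
  finally have "\<Phi> ?W = t * ((Y * \<sigma>) * t)"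
    using ptrace_lift(2)[OF E.A_carrier(1) Yc(1)] by (simp add: \<Phi>_def marginal)
  also have "\<dots> = ?W"
    using Yc by (simp add: S.mults(1)[symmetric] mat_assoc) (simp add: S.mults)
  finally show "\<Phi> ?W = ?W" .
qed

text \<open>Membership is \<open>modular_mem\<close> for the adjoint of \<open>Y\<close>. For the
  intertwining, write \<open>z = G * L s\<close> and move the translated element, which commutes
  with \<open>G\<close>, to the left.\<close>

lemma modular_intertwines:
  assumes Y: "Y \<in> alg"
  shows "s * (Y * t) \<in> alg" "z * L Y = L (s * (Y * t)) * z"
proof -
  have Yc: "Y \<in> carrier_mat dS dS" "dim_row Y = dS" "dim_col Y = dS"
    and YG: "L (Y\<^sup>\<dagger>) * G = G * L (Y\<^sup>\<dagger>)" using Y by (auto simp: alg_def)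
  have "(t * (Y\<^sup>\<dagger> * s))\<^sup>\<dagger> \<in> alg"
    using modular_mem[OF star_algebraD(5)[OF alg_star_algebra Y]] by (rule star_algebraD(5)[OF alg_star_algebra])
  moreover have "(t * (Y\<^sup>\<dagger> * s))\<^sup>\<dagger> = s * (Y * t)" using Yc by (simp add: adjoint_mult S.herm mat_assoc)
  ultimately show mem: "s * (Y * t) \<in> alg" by simp
  \<comment> \<open>\<open>Y\<close> need not commute with \<open>P\<close>. Writing the product as
    one starting with \<open>G\<close>, whose range lies in the support, shows that \<open>P\<close>
    may nevertheless be inserted after \<open>z * L Y\<close>.\<close>
  have Yz: "L (Y\<^sup>\<dagger>) * z = G * (L (Y\<^sup>\<dagger>) * L s)"
  proof -
    have "L (Y\<^sup>\<dagger>) * z = (L (Y\<^sup>\<dagger>) * G) * L s" using Yc by (simp add: G_s mat_assoc)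
    then show ?thesis unfolding YG using Yc by (simp add: mat_assoc)
  qed
  have "L P * (L (Y\<^sup>\<dagger>) * z) = (L P * G) * (L (Y\<^sup>\<dagger>) * L s)" unfolding Yz using Yc by (simp add: mat_assoc)
  then have "L P * (L (Y\<^sup>\<dagger>) * z) = L (Y\<^sup>\<dagger>) * z" unfolding G_P Yz .
  then have "(L P * (L (Y\<^sup>\<dagger>) * z))\<^sup>\<dagger> = (L (Y\<^sup>\<dagger>) * z)\<^sup>\<dagger>" by simp
  then have zYP: "z * (L Y * L P) = z * L Y"
    using Yc by (simp add: adjoint_mult lift_adjoint S.herm E.herm mat_assoc)
  have LG: "L (s * (Y * t)) * G = G * L (s * (Y * t))" using mem by (simp add: alg_def)
  have "z * (L Y * L P) = (G * L s) * (L Y * L P)" unfolding G_s ..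
  also have "\<dots> = (G * L (s * (Y * t))) * L s"
    using Yc by (simp add: mat_assoc L_mult S.mults)
  also have "\<dots> = L (s * (Y * t)) * (G * L s)"
    unfolding LG[symmetric] using Yc by (simp add: mat_assoc)
  also have "\<dots> = L (s * (Y * t)) * z" unfolding G_s ..
  finally show "z * L Y = L (s * (Y * t)) * z" unfolding zYP .
qed

text \<open>\<Sigma> consists of two factors \<open>z\<close>, each of which applies one modular
  translation; the result is \<sigma> Y \<sigma>^(-1) with the pseudo-inverse.\<close>

lemma alg_normalizes:
  assumes "Y \<in> alg"
  shows "\<exists>Y'\<in>alg. \<Sigma> * L Y = L Y' * \<Sigma>"
proof (rule bexI)
  let ?Y1 = "s * (Y * t)"
  let ?Y2 = "s * (?Y1 * t)"
  have m: "?Y1 \<in> alg" by (rule modular_intertwines(1)[OF assms])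
  show "?Y2 \<in> alg" by (rule modular_intertwines(1)[OF m])
  have Yc: "dim_row Y = dS" "dim_col Y = dS" using assms by (auto simp: alg_def)
  have "\<Sigma> * L Y = z * (z * L Y)" using Yc by (simp add: E.mults(1)[symmetric] mat_assoc)
  also have "\<dots> = (z * L ?Y1) * z" unfolding modular_intertwines(2)[OF assms] using Yc by (simp add: mat_assoc)
  also have "\<dots> = L ?Y2 * \<Sigma>" unfolding modular_intertwines(2)[OF m]
    using Yc by (simp add: E.mults(1)[symmetric] mat_assoc)
  finally show "\<Sigma> * L Y = L ?Y2 * \<Sigma>" .
qed

text \<open>Recovery makes X = t x t a fixed point and gives \<rho> = z (X \<otimes> 1) z;
  intertwining moves X out to the left of both factors \<open>z\<close>.\<close>

lemma recovered_factor:
  assumes rec: "petz_map (ptrace_E dS dE \<rho>) = \<rho>"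
  shows "\<exists>Y\<in>alg. \<rho> = L Y * \<Sigma>"
proof -
  let ?x = "ptrace_E dS dE \<rho>"
  let ?X = "t * (?x * t)"
  have X: "?X \<in> alg"
  proof (rule fixed_point_mem)
    show "?X \<in> carrier_mat dS dS" by (rule carrier_matI) simp_all
    show "P * ?X = ?X" by (simp add: S.cancels)
    show "?X * P = ?X" by (simp add: mat_assoc S.mults)
    show "\<Phi> ?X = ?X" using rec by (simp add: \<Phi>_def petz_map_def)
  qed
  have "\<rho> = (z * L ?X) * z" using rec by (simp add: petz_map_def mat_assoc)
  also have "\<dots> = L (s * (?X * t)) * \<Sigma>"
    unfolding modular_intertwines(2)[OF X] by (simp add: E.mults(1)[symmetric] mat_assoc)
  finally show ?thesis using modular_intertwines(1)[OF X] by blast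
qed

end

section \<open>Tensor splitting of the blocks\<close>

lemma mult_ecol_outer:
  assumes "M \<in> carrier_mat m n" "i < n" "k < m" "l < p"
  shows "(M * (ecol n i * (ecol p j)\<^sup>\<dagger>)) $$ (k,l) = (if l = j then M $$ (k,i) else 0)"
proof -
  have "(M * (ecol n i * (ecol p j)\<^sup>\<dagger>)) $$ (k,l) = ((M * ecol n i) * (ecol p j)\<^sup>\<dagger>) $$ (k,l)"
    using assms by (simp add: mat_assoc)
  also have "\<dots> = (M * ecol n i) $$ (k,0) * cnj (ecol p j $$ (l,0))"
    using assms by (subst index_mult_sum) simp_all
  also have "\<dots> = M $$ (k,i) * cnj (ecol p j $$ (l,0))"
    using mult_ecol[OF assms(1,2,3)] by simp
  finally show ?thesis using assms by (simp add: index_ecol)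
qed

lemma ecol_outer_mult:
  assumes "M \<in> carrier_mat n m" "j < n" "k < p" "l < m"
  shows "((ecol p i * (ecol n j)\<^sup>\<dagger>) * M) $$ (k,l) = (if k = i then M $$ (j,l) else 0)"
proof -
  have "(M\<^sup>\<dagger> * (ecol n j * (ecol p i)\<^sup>\<dagger>))\<^sup>\<dagger> = (ecol p i * (ecol n j)\<^sup>\<dagger>) * M"
    using assms by (simp add: adjoint_mult)
  then have "((ecol p i * (ecol n j)\<^sup>\<dagger>) * M) $$ (k,l) = (M\<^sup>\<dagger> * (ecol n j * (ecol p i)\<^sup>\<dagger>))\<^sup>\<dagger> $$ (k,l)"
    by simp
  also have "\<dots> = cnj ((M\<^sup>\<dagger> * (ecol n j * (ecol p i)\<^sup>\<dagger>)) $$ (l,k))"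
    using assms by (subst index_adjoint) simp_all
  also have "\<dots> = (if k = i then M $$ (j,l) else 0)"
    using assms by (subst mult_ecol_outer[of _ m]) simp_all
  finally show ?thesis .
qed

text \<open>Commuting with the matrix units E_(i0) already determines every entry from the one at
  (0,0).\<close>

lemma commutes_scalar:
  assumes M: "(M :: complex mat) \<in> carrier_mat n n" and c: "\<And>y. y \<in> carrier_mat n n \<Longrightarrow> M * y = y * M"
  shows "\<exists>c. M = c \<cdot>\<^sub>m 1\<^sub>m n"
proof (cases "n = 0")
  case True
  then show ?thesis using M by (intro exI[of _ 0] eq_matI) auto
next
  case False
  have E: "ecol n i * (ecol n j)\<^sup>\<dagger> \<in> carrier_mat n n" for i j by (rule carrier_matI) auto
  have e: "M $$ (k,i) = (if k = i then M $$ (0,0) else 0)" if "i < n" "k < n" for i k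
    using mult_ecol_outer[OF M that(1) that(2), where l = 0 and p = n and j = 0]
      ecol_outer_mult[OF M _ that(2), where i = i and j = 0 and l = 0] c[OF E[of i 0]] that False by simp
  define m where "m = M $$ (0,0)"
  have "M = m \<cdot>\<^sub>m 1\<^sub>m n"
    using M e[folded m_def] by (intro eq_matI) auto
  then show ?thesis by blast
qed

lemma psd_trace_eq_0: "psd n A \<Longrightarrow> mtrace A = 0 \<Longrightarrow> A = 0\<^sub>m n n"
  using psd_conj_eq_0[of n A "1\<^sub>m n" n] psd_carrier[of n A] by simp

lemma ptrace_kron:
  assumes "A \<in> carrier_mat a a" "T \<in> carrier_mat c c"
  shows "ptrace_E a c (kron A T) = mtrace T \<cdot>\<^sub>m A"
proof (rule eq_matI)
  fix i j assume "i < dim_row (mtrace T \<cdot>\<^sub>m A)" "j < dim_col (mtrace T \<cdot>\<^sub>m A)"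
  then have ij: "i < a" "j < a" using assms by auto
  then show "ptrace_E a c (kron A T) $$ (i,j) = (mtrace T \<cdot>\<^sub>m A) $$ (i,j)"
    using assms mult_add_less[OF ij(1)] mult_add_less[OF ij(2)]
    by (simp add: ptrace_E_def index_kron mtrace_def sum_distrib_right mult.commute[of "A $$ _"])
qed (use assms in auto)

text \<open>Tracing out the second factor leaves tr T times \<open>A\<close>, and tr T is positive
  for a nonzero positive \<open>T\<close>.\<close>

lemma psd_kron_left:
  assumes "psd (a * c) (kron A T)" "A \<in> carrier_mat a a" "psd c T" "T \<noteq> 0\<^sub>m c c"
  shows "psd a A"
proof -
  have Tc: "T \<in> carrier_mat c c" by (rule psd_carrier[OF assms(3)])
  have tr: "0 \<le> mtrace T" "mtrace T \<noteq> 0" using psd_mtrace[OF assms(3)] psd_trace_eq_0[OF assms(3)] assms(4) by auto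
  have "psd a (ptrace_E a c (kron A T))" by (rule psd_ptrace[OF assms(1)])
  then have "psd a (mtrace T \<cdot>\<^sub>m A)" unfolding ptrace_kron[OF assms(2) Tc] .
  moreover have "0 \<le> 1 / mtrace T" using tr by (auto simp: less_eq_complex_def complex_is_Real_iff Re_divide Im_divide)
  ultimately have "psd a ((1 / mtrace T) \<cdot>\<^sub>m (mtrace T \<cdot>\<^sub>m A))" by (rule psd_smult)
  then show ?thesis using tr by (simp add: mat_smult_smult)
qed

text \<open>A twisted Schur lemma. All slices of \<open>M\<close> intertwine y with the same y'. A
  diagonal slice S of nonzero trace turns out invertible, so y' = S y S^(-1). Every other slice
  multiplied by S^(-1) then commutes with all matrices, and the scalars obtained are the entries of
  the right factor.\<close>

lemma tensor_split:
  assumes M: "psd (a * c) M"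
    and nrm: "\<And>y. y \<in> carrier_mat a a \<Longrightarrow> \<exists>y'\<in>carrier_mat a a. M * lift c y = lift c y' * M"
  shows "\<exists>p T. psd a p \<and> psd c T \<and> M = kron p T"
proof (cases "M = 0\<^sub>m (a * c) (a * c)")
  case True
  then have "M = kron (0\<^sub>m a a) (0\<^sub>m c c)" by (simp add: kron_zero_left)
  then show ?thesis using psd_zero by blast
next
  case False
  have Mc: "M \<in> carrier_mat (a * c) (a * c)" by (rule psd_carrier[OF M])
  let ?S = "slice a c M"
  have psdS: "psd a (?S q q)" if "q < c" for q
    using slice_eq[OF Mc that that] psd_conj[OF M ket_carrier] by simp
  have "mtrace M \<noteq> 0" using psd_trace_eq_0[OF M] False by auto
  then have "mtrace (ptrace_E a c M) \<noteq> 0" using mtrace_ptrace[OF Mc] by simp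
  then have "(\<Sum>q<c. mtrace (?S q q)) \<noteq> 0" by (simp add: ptrace_eq_msum mtrace_msum)
  \<comment> \<open>The diagonal slices have traces adding up to the trace of \<open>M\<close>, so
    one of them is nonzero.\<close>
  then obtain q0 where "q0 \<in> {..<c}" and q0': "mtrace (?S q0 q0) \<noteq> 0"
    by (rule sum.not_neutral_contains_not_neutral)
  then have q0: "q0 < c" "mtrace (?S q0 q0) \<noteq> 0" by auto
  define S where "S = ?S q0 q0"
  have S: "psd a S" "mtrace S \<noteq> 0" and Sc: "S \<in> carrier_mat a a" using psdS q0 by (auto simp: S_def)
  obtain s t P r where "psd_sqrt a S s t P r" using psd_sqrt_exists[OF S(1)] by blast
  then interpret R: psd_sqrt a S s t P r .
  have int: "\<exists>y'\<in>carrier_mat a a. \<forall>q<c. \<forall>p<c. ?S q p * y = y' * ?S q p" if y: "y \<in> carrier_mat a a" for y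
  proof -
    obtain y' where y': "y' \<in> carrier_mat a a" "M * lift c y = lift c y' * M" using nrm[OF y] by blast
    have "?S q p * y = y' * ?S q p" if "q < c" "p < c" for q p
      using slice_mult_lift(1)[OF Mc y that] slice_mult_lift(2)[OF Mc y'(1) that] y'(2) by simp
    then show ?thesis using y' by blast
  qed
  have "(\<Sum>i<a. S $$ (i,i)) \<noteq> 0" using S(2) Sc by (simp add: mtrace_def)
  then obtain i0 where "i0 \<in> {..<a}" and i0': "S $$ (i0,i0) \<noteq> 0"
    by (rule sum.not_neutral_contains_not_neutral)
  then have i0: "i0 < a" "S $$ (i0,i0) \<noteq> 0" by auto
  have SP: "S * P = S" by (simp add: R.mults(1)[symmetric] mat_assoc) (simp add: R.mults)
  \<comment> \<open>From S y = y' S it follows that S y P = S y for every y; with y = E_(i0,k) the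
    row i0 of this equation reads off row k of \<open>P\<close>.\<close>
  have P1: "P = 1\<^sub>m a"
  proof (rule eq_matI)
    fix k l assume "k < dim_row (1\<^sub>m a :: complex mat)" "l < dim_col (1\<^sub>m a :: complex mat)"
    then have kl: "k < a" "l < a" by auto
    let ?y = "ecol a i0 * (ecol a k)\<^sup>\<dagger>"
    have y: "?y \<in> carrier_mat a a" by (rule carrier_matI) auto
    obtain y' where y': "y' \<in> carrier_mat a a" "S * ?y = y' * S" using int[OF y] q0(1) by (auto simp: S_def)
    have "S * ?y * P = y' * (S * P)" unfolding y'(2) using y'(1) Sc by (simp add: mat_assoc)
    then have "S * ?y * P = S * ?y" unfolding SP y'(2) .
    then have e: "(S * ?y * P) $$ (i0,l) = (S * ?y) $$ (i0,l)" by simp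
    have Sy: "(S * ?y) $$ (i0,j) = (if j = k then S $$ (i0,i0) else 0)" if "j < a" for j
      by (rule mult_ecol_outer[OF Sc i0(1) i0(1) that])
    have "(S * ?y * P) $$ (i0,l) = (\<Sum>j<a. (S * ?y) $$ (i0,j) * P $$ (j,l))"
      using Sc i0(1) kl by (subst index_mult_sum) simp_all
    also have "\<dots> = (\<Sum>j<a. if j = k then S $$ (i0,i0) * P $$ (k,l) else 0)"
      by (intro sum.cong refl) (simp add: Sy)
    finally have "(S * ?y * P) $$ (i0,l) = S $$ (i0,i0) * P $$ (k,l)" using kl by simp
    then have "S $$ (i0,i0) * P $$ (k,l) = (if l = k then S $$ (i0,i0) else 0)"
      using e Sy[OF kl(2)] kl by simp
    then show "P $$ (k,l) = 1\<^sub>m a $$ (k,l)" using i0(2) kl by (auto split: if_splits)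
  qed simp_all
  define N where "N = t * t"
  have Nc: "N \<in> carrier_mat a a" unfolding N_def by (rule carrier_matI) simp_all
  have SN: "S * N = 1\<^sub>m a"
  proof -
    have "S * N = s * (P * t)" by (simp add: N_def R.mults(1)[symmetric] mat_assoc R.cancels)
    then show ?thesis by (simp add: R.mults P1)
  qed
  have NS: "N * S = 1\<^sub>m a"
  proof -
    have "N * S = t * (P * s)" by (simp add: N_def R.mults(1)[symmetric] mat_assoc R.cancels)
    then show ?thesis by (simp add: R.mults P1)
  qed
  \<comment> \<open>It matters that y' does not depend on the slice: it is computed from
    \<open>S\<close> and then used for slice (q,p).\<close>
  have "\<exists>c'. ?S q p = c' \<cdot>\<^sub>m S" if qp: "q < c" "p < c" for q p
  proof -
    have "(N * ?S q p) * y = y * (N * ?S q p)" if y: "y \<in> carrier_mat a a" for y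
    proof -
      obtain y' where y': "y' \<in> carrier_mat a a" "S * y = y' * S" "?S q p * y = y' * ?S q p"
        using int[OF y] q0(1) qp by (auto simp: S_def)
      have "y' = (y' * S) * N" using y'(1) Sc Nc SN by (simp add: mat_assoc)
      then have y'': "y' = S * (y * N)" unfolding y'(2)[symmetric] using y Sc Nc by (simp add: mat_assoc)
      have "(N * ?S q p) * y = N * (y' * ?S q p)" using y Nc by (simp add: mat_assoc y'(3))
      also have "\<dots> = (N * S) * (y * (N * ?S q p))" unfolding y'' using y Nc Sc by (simp add: mat_assoc)
      finally show ?thesis unfolding NS using y Nc by simp
    qed
    moreover have "N * ?S q p \<in> carrier_mat a a" using Nc by (intro carrier_matI) simp_all
    ultimately obtain c' where c': "N * ?S q p = c' \<cdot>\<^sub>m 1\<^sub>m a" using commutes_scalar by blast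
    have "?S q p = (S * N) * ?S q p" unfolding SN by simp
    also have "\<dots> = S * (c' \<cdot>\<^sub>m 1\<^sub>m a)" using Sc Nc by (simp add: mat_assoc c')
    also have "\<dots> = c' \<cdot>\<^sub>m S" using Sc by (simp add: mat_smult_right)
    finally show ?thesis by blast
  qed
  then obtain f where f: "\<And>q p. q < c \<Longrightarrow> p < c \<Longrightarrow> ?S q p = f q p \<cdot>\<^sub>m S" by metis
  define T where "T = mat c c (\<lambda>(q,p). f q p)"
  have Tc: "T \<in> carrier_mat c c" by (simp add: T_def)
  have MT: "M = kron S T"
  proof (rule slice_ext[of _ a c])
    fix q p assume qp: "q < c" "p < c"
    have "slice a c (kron S T) q p = f q p \<cdot>\<^sub>m S"
      using qp Sc mult_add_less[OF _ qp(1)] mult_add_less[OF _ qp(2)]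
      by (intro eq_matI) (auto simp: slice_def index_kron T_def mult.commute[of "S $$ _"])
    then show "?S q p = slice a c (kron S T) q p" using f[OF qp] by simp
  qed (use Mc Sc Tc in auto)
  \<comment> \<open>Compressing the first factor to the basis vector i0 leaves a positive multiple
    of \<open>T\<close>, which proves \<open>T\<close> positive.\<close>
  have e1: "(ecol a i0)\<^sup>\<dagger> * (S * ecol a i0) = S $$ (i0,i0) \<cdot>\<^sub>m 1\<^sub>m 1"
    using Sc i0 ecol_form[OF Sc i0(1) i0(1)] by (intro eq_matI) auto
  have k1: "kron (1\<^sub>m 1) T = T" using Tc by (intro eq_matI) (auto simp: index_kron)
  let ?K = "kron (ecol a i0) (1\<^sub>m c)"
  have "?K\<^sup>\<dagger> * M * ?K = kron ((ecol a i0)\<^sup>\<dagger> * (S * ecol a i0)) T"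
    unfolding MT using Sc Tc by (simp add: kron_adjoint kron_mult mat_assoc)
  then have "?K\<^sup>\<dagger> * M * ?K = S $$ (i0,i0) \<cdot>\<^sub>m T" unfolding e1 kron_smult_left k1 .
  moreover have "psd c (?K\<^sup>\<dagger> * M * ?K)" by (rule psd_conj[OF M]) (rule carrier_matI; simp)
  ultimately have "psd c (S $$ (i0,i0) \<cdot>\<^sub>m T)" by simp
  moreover have "0 \<le> 1 / S $$ (i0,i0)"
    using psd_diag[OF S(1) i0(1)] i0(2) by (auto simp: less_eq_complex_def complex_is_Real_iff Re_divide Im_divide)
  ultimately have "psd c ((1 / S $$ (i0,i0)) \<cdot>\<^sub>m (S $$ (i0,i0) \<cdot>\<^sub>m T))" by (rule psd_smult)
  then have "psd c T" using i0(2) by (simp add: mat_smult_smult)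
  then show ?thesis using S(1) MT by blast
qed

lemma kron_msum_left:
  assumes "\<And>k. k < K \<Longrightarrow> f k \<in> carrier_mat n n" "B \<in> carrier_mat c c"
  shows "kron (msum n K f) B = msum (n * c) K (\<lambda>k. kron (f k) B)"
proof (rule eq_matI)
  fix i j assume "i < dim_row (msum (n * c) K (\<lambda>k. kron (f k) B))" "j < dim_col (msum (n * c) K (\<lambda>k. kron (f k) B))"
  then have ij: "i < n * c" "j < n * c" by auto
  have "(\<Sum>k<K. f k $$ (i div c, j div c)) * B $$ (i mod c, j mod c) = (\<Sum>k<K. kron (f k) B $$ (i,j))"
    unfolding sum_distrib_right using assms ij
    by (intro sum.cong refl, subst index_kron) (auto dest!: assms(1))
  then show "kron (msum n K f) B $$ (i,j) = msum (n * c) K (\<lambda>k. kron (f k) B) $$ (i,j)"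
    using ij div_mod_less[OF ij(1)] div_mod_less[OF ij(2)] assms(2) by (subst index_kron) (auto simp: msum_def)
qed (use assms in auto)

lemma kron_msum_right:
  assumes "\<And>k. k < K \<Longrightarrow> f k \<in> carrier_mat c c" "A \<in> carrier_mat n n"
  shows "kron A (msum c K f) = msum (n * c) K (\<lambda>k. kron A (f k))"
proof (rule eq_matI)
  fix i j assume "i < dim_row (msum (n * c) K (\<lambda>k. kron A (f k)))" "j < dim_col (msum (n * c) K (\<lambda>k. kron A (f k)))"
  then have ij: "i < n * c" "j < n * c" by auto
  have "A $$ (i div c, j div c) * (\<Sum>k<K. f k $$ (i mod c, j mod c)) = (\<Sum>k<K. kron A (f k) $$ (i,j))"
    unfolding sum_distrib_left using assms ij
    by (intro sum.cong refl, subst index_kron) (auto dest!: assms(1))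
  then show "kron A (msum c K f) $$ (i,j) = msum (n * c) K (\<lambda>k. kron A (f k)) $$ (i,j)"
    using ij div_mod_less[OF ij(1)] div_mod_less[OF ij(2)] assms(2) by (subst index_kron) (auto simp: msum_def)
qed (use assms in auto)

lemma msum_swap: "msum N K (\<lambda>k. msum N m (\<lambda>i. f i k)) = msum N m (\<lambda>i. msum N K (\<lambda>k. f i k))"
  by (rule eq_matI) (auto simp: msum_def intro: sum.swap)

section \<open>Markov form\<close>

lemma blocks_left:
  assumes "star_algebra n \<A>" "blocks n \<A> K a b V" "k < K" "Y \<in> \<A>"
  shows "\<exists>y\<in>carrier_mat (a k) (a k). (V k)\<^sup>\<dagger> * Y = kron y (1\<^sub>m (b k)) * (V k)\<^sup>\<dagger>"
proof -
  have Yc: "Y \<in> carrier_mat n n" by (rule star_algebraD(1)[OF assms(1,4)])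
  have V: "V k \<in> carrier_mat n (a k * b k)" by (rule blocksD(3)[OF assms(2,3)])
  obtain y where y: "y \<in> carrier_mat (a k) (a k)" "Y\<^sup>\<dagger> * V k = V k * kron y (1\<^sub>m (b k))"
    using blocksD(5)[OF assms(2,3) star_algebraD(5)[OF assms(1,4)]] by blast
  have "(V k)\<^sup>\<dagger> * Y = (Y\<^sup>\<dagger> * V k)\<^sup>\<dagger>" using Yc V by (simp add: adjoint_mult)
  also have "\<dots> = kron (y\<^sup>\<dagger>) (1\<^sub>m (b k)) * (V k)\<^sup>\<dagger>"
    unfolding y(2) using V y(1) by (simp add: adjoint_mult kron_adjoint)
  finally show ?thesis using y(1) by (intro bexI[of _ "y\<^sup>\<dagger>"]) simp_all
qed

lemma lift_lift: "lift d (lift c y) = lift (c * d) y"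
  by (simp add: kron_assoc kron_one)

locale normalized_blocks =
  fixes dS dE :: nat and \<Sigma> :: "complex mat" and \<A> K a b V
  assumes alg: "star_algebra dS \<A>" and psd_Sigma: "psd (dS * dE) \<Sigma>"
    and normalizes: "\<And>Y. Y \<in> \<A> \<Longrightarrow> \<exists>Y'\<in>\<A>. \<Sigma> * lift dE Y = lift dE Y' * \<Sigma>"
    and blocks: "blocks dS \<A> K a b V"
begin

definition W :: "nat \<Rightarrow> complex mat" where "W k = lift dE (V k)"

lemma Sigma_carrier: "\<Sigma> \<in> carrier_mat (dS * dE) (dS * dE)" "dim_row \<Sigma> = dS * dE" "dim_col \<Sigma> = dS * dE"
  using psd_carrier[OF psd_Sigma] by auto

lemma V_carrier: "k < K \<Longrightarrow> V k \<in> carrier_mat dS (a k * b k)"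
  by (rule blocksD(3)[OF blocks])

lemma V_dims: "k < K \<Longrightarrow> dim_row (V k) = dS" "k < K \<Longrightarrow> dim_col (V k) = a k * b k"
  using V_carrier by auto

lemma W_dims: "k < K \<Longrightarrow> dim_row (W k) = dS * dE" "k < K \<Longrightarrow> dim_col (W k) = a k * (b k * dE)"
  using V_dims by (auto simp: W_def mult.assoc)

lemma W_carrier: "k < K \<Longrightarrow> W k \<in> carrier_mat (dS * dE) (a k * (b k * dE))"
  by (rule carrier_matI) (auto simp: W_dims)

lemma W_orth:
  assumes "k < K" "l < K"
  shows "(W k)\<^sup>\<dagger> * W l = (if k = l then 1\<^sub>m (a k * (b k * dE)) else 0\<^sub>m (a k * (b k * dE)) (a l * (b l * dE)))"
proof -
  have "(W k)\<^sup>\<dagger> * W l = lift dE ((V k)\<^sup>\<dagger> * V l)"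
    using V_dims assms by (simp add: W_def lift_adjoint lift_mult)
  then show ?thesis using blocksD(4)[OF blocks assms] by (auto simp: kron_one kron_zero_left mult.assoc)
qed

lemma projection_mem: "k < K \<Longrightarrow> V k * (V k)\<^sup>\<dagger> \<in> \<A>"
  using blocksD(6)[OF blocks, of k "1\<^sub>m (a k)"] V_dims by (simp add: kron_one)

text \<open>Let P_k be the block projection, so \<Sigma> P_k = D \<Sigma> with D acting on block l
  as some Y. Compressing to block l gives Y times the (l,l) block of \<Sigma> equal to zero. For
  \<Sigma> = z z this means that R = Y W_l^\<dagger> z satisfies R R^\<dagger> = 0, hence R = 0. The
  (l,k) block equals R z W_k.\<close>

lemma off_diagonal:
  assumes k: "k < K" and l: "l < K" and ne: "l \<noteq> k"
  shows "(W l)\<^sup>\<dagger> * (\<Sigma> * W k) = 0\<^sub>m (a l * (b l * dE)) (a k * (b k * dE))"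
proof -
  note [simp] = V_dims[OF k] V_dims[OF l] W_dims[OF k] W_dims[OF l] Sigma_carrier(2,3)
  let ?C = "V k * (V k)\<^sup>\<dagger>"
  obtain D where D: "D \<in> \<A>" "\<Sigma> * lift dE ?C = lift dE D * \<Sigma>" using normalizes[OF projection_mem[OF k]] by blast
  have Dd [simp]: "dim_row D = dS" "dim_col D = dS" using star_algebraD(1)[OF alg D(1)] by auto
  obtain y where y: "y \<in> carrier_mat (a l) (a l)" "(V l)\<^sup>\<dagger> * D = kron y (1\<^sub>m (b l)) * (V l)\<^sup>\<dagger>"
    using blocks_left[OF alg blocks l D(1)] by blast
  have yd [simp]: "dim_row y = a l" "dim_col y = a l" using y(1) by auto
  define Y where "Y = lift dE (kron y (1\<^sub>m (b l)))"
  have Yd [simp]: "dim_row Y = a l * (b l * dE)" "dim_col Y = a l * (b l * dE)" by (simp_all add: Y_def mult.assoc)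
  have WD: "(W l)\<^sup>\<dagger> * lift dE D = Y * (W l)\<^sup>\<dagger>"
  proof -
    have "(W l)\<^sup>\<dagger> * lift dE D = lift dE ((V l)\<^sup>\<dagger> * D)" by (simp add: W_def lift_adjoint lift_mult)
    also have "\<dots> = Y * (W l)\<^sup>\<dagger>" unfolding y(2) by (simp add: W_def lift_adjoint lift_mult Y_def)
    finally show ?thesis .
  qed
  obtain z where z: "z \<in> carrier_mat (dS * dE) (dS * dE)" "z\<^sup>\<dagger> = z" "\<Sigma> = z\<^sup>\<dagger> * z"
    using psd_factor[OF psd_Sigma] by blast
  have zz: "\<Sigma> = z * z" using z by simp
  have zd [simp]: "dim_row z = dS * dE" "dim_col z = dS * dE" using z(1) by auto
  have "?C * V l = V k * ((V k)\<^sup>\<dagger> * V l)" by (simp add: mat_assoc)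
  also have "(V k)\<^sup>\<dagger> * V l = 0\<^sub>m (a k * b k) (a l * b l)" using blocksD(4)[OF blocks k l] ne by simp
  finally have Cl: "lift dE ?C * W l = 0\<^sub>m (dS * dE) (a l * (b l * dE))"
    by (simp add: W_def lift_mult kron_zero_left mult.assoc)
  have "?C * V k = V k * ((V k)\<^sup>\<dagger> * V k)" by (simp add: mat_assoc)
  also have "(V k)\<^sup>\<dagger> * V k = 1\<^sub>m (a k * b k)" using blocksD(4)[OF blocks k k] by simp
  finally have Ck: "lift dE ?C * W k = W k" by (simp add: W_def lift_mult)
  define R where "R = Y * ((W l)\<^sup>\<dagger> * z)"
  have Rd [simp]: "dim_row R = a l * (b l * dE)" "dim_col R = dS * dE" by (simp_all add: R_def)
  have "R * (z * W l) = (Y * (W l)\<^sup>\<dagger>) * (\<Sigma> * W l)" by (simp add: R_def zz mat_assoc)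
  also have "\<dots> = (W l)\<^sup>\<dagger> * ((lift dE D * \<Sigma>) * W l)" unfolding WD[symmetric] by (simp add: mat_assoc)
  also have "\<dots> = (W l)\<^sup>\<dagger> * (\<Sigma> * (lift dE ?C * W l))" unfolding D(2)[symmetric] by (simp add: mat_assoc)
  also have "\<dots> = 0\<^sub>m (a l * (b l * dE)) (a l * (b l * dE))" unfolding Cl by simp
  finally have Rz: "R * (z * W l) = 0\<^sub>m (a l * (b l * dE)) (a l * (b l * dE))" .
  have "(R\<^sup>\<dagger>)\<^sup>\<dagger> * R\<^sup>\<dagger> = R * ((z * W l) * Y\<^sup>\<dagger>)"
    using z(2) by (simp add: R_def adjoint_mult mat_assoc)
  also have "\<dots> = (R * (z * W l)) * Y\<^sup>\<dagger>" by (simp add: mat_assoc)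
  also have "\<dots> = 0\<^sub>m (a l * (b l * dE)) (a l * (b l * dE))" unfolding Rz by simp
  finally have "(R\<^sup>\<dagger>)\<^sup>\<dagger> * R\<^sup>\<dagger> = 0\<^sub>m (a l * (b l * dE)) (a l * (b l * dE))" .
  moreover have "R\<^sup>\<dagger> \<in> carrier_mat (dS * dE) (a l * (b l * dE))" by (rule carrier_matI) simp_all
  ultimately have "R\<^sup>\<dagger> = 0\<^sub>m (dS * dE) (a l * (b l * dE))" using gram_eq_0 by blast
  then have "(R\<^sup>\<dagger>)\<^sup>\<dagger> = 0\<^sub>m (a l * (b l * dE)) (dS * dE)" by (simp only: adjoint_zero)
  then have R0: "R = 0\<^sub>m (a l * (b l * dE)) (dS * dE)" by simp
  have "(W l)\<^sup>\<dagger> * (\<Sigma> * W k) = (W l)\<^sup>\<dagger> * (\<Sigma> * (lift dE ?C * W k))" unfolding Ck ..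
  also have "\<dots> = (W l)\<^sup>\<dagger> * ((\<Sigma> * lift dE ?C) * W k)" by (simp add: mat_assoc)
  also have "\<dots> = ((W l)\<^sup>\<dagger> * lift dE D) * (\<Sigma> * W k)" unfolding D(2) by (simp add: mat_assoc)
  also have "\<dots> = R * (z * W k)" unfolding WD by (simp add: R_def zz mat_assoc)
  also have "\<dots> = 0\<^sub>m (a l * (b l * dE)) (a k * (b k * dE))" unfolding R0 by simp
  finally show ?thesis .
qed

text \<open>Each diagonal block inherits the normalisation: matrices on the left factor pass through
  it into such matrices, with b k and E together playing the second factor in
  \<open>tensor_split\<close>.\<close>

lemma block_split:
  assumes k: "k < K"
  shows "\<exists>p T. psd (a k) p \<and> psd (b k * dE) T \<and> (W k)\<^sup>\<dagger> * \<Sigma> * W k = kron p T"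
proof (rule tensor_split)
  note [simp] = V_dims[OF k] W_dims[OF k] Sigma_carrier(2,3)
  show "psd (a k * (b k * dE)) ((W k)\<^sup>\<dagger> * \<Sigma> * W k)" by (rule psd_conj[OF psd_Sigma W_carrier[OF k]])
  fix y :: "complex mat" assume y: "y \<in> carrier_mat (a k) (a k)"
  then have yd [simp]: "dim_row y = a k" "dim_col y = a k" by auto
  let ?Y = "V k * kron y (1\<^sub>m (b k)) * (V k)\<^sup>\<dagger>"
  obtain D where D: "D \<in> \<A>" "\<Sigma> * lift dE ?Y = lift dE D * \<Sigma>"
    using normalizes[OF blocksD(6)[OF blocks k y]] by blast
  have Dd [simp]: "dim_row D = dS" "dim_col D = dS" using star_algebraD(1)[OF alg D(1)] by auto
  obtain x where x: "x \<in> carrier_mat (a k) (a k)" "(V k)\<^sup>\<dagger> * D = kron x (1\<^sub>m (b k)) * (V k)\<^sup>\<dagger>"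
    using blocks_left[OF alg blocks k D(1)] by blast
  have xd [simp]: "dim_row x = a k" "dim_col x = a k" using x(1) by auto
  have "?Y * V k = V k * (kron y (1\<^sub>m (b k)) * ((V k)\<^sup>\<dagger> * V k))" by (simp add: mat_assoc)
  also have "(V k)\<^sup>\<dagger> * V k = 1\<^sub>m (a k * b k)" using blocksD(4)[OF blocks k k] by simp
  finally have YV: "?Y * V k = V k * kron y (1\<^sub>m (b k))" by simp
  have Wy: "W k * lift (b k * dE) y = lift dE ?Y * W k"
  proof -
    have "lift dE ?Y * W k = lift dE (?Y * V k)" by (simp add: W_def lift_mult)
    also have "\<dots> = W k * lift (b k * dE) y"
      unfolding YV by (simp add: W_def lift_lift[symmetric] lift_mult)
    finally show ?thesis ..
  qed
  have Wx: "(W k)\<^sup>\<dagger> * lift dE D = lift (b k * dE) x * (W k)\<^sup>\<dagger>"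
  proof -
    have "(W k)\<^sup>\<dagger> * lift dE D = lift dE ((V k)\<^sup>\<dagger> * D)" by (simp add: W_def lift_adjoint lift_mult)
    also have "\<dots> = lift (b k * dE) x * (W k)\<^sup>\<dagger>"
      unfolding x(2) by (simp add: W_def lift_adjoint lift_mult lift_lift[symmetric])
    finally show ?thesis .
  qed
  have "(W k)\<^sup>\<dagger> * \<Sigma> * W k * lift (b k * dE) y = (W k)\<^sup>\<dagger> * ((\<Sigma> * lift dE ?Y) * W k)"
    by (simp add: mat_assoc Wy)
  also have "\<dots> = ((W k)\<^sup>\<dagger> * lift dE D) * (\<Sigma> * W k)" unfolding D(2) by (simp add: mat_assoc)
  also have "\<dots> = lift (b k * dE) x * ((W k)\<^sup>\<dagger> * \<Sigma> * W k)" unfolding Wx by (simp add: mat_assoc)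
  finally show "\<exists>y'\<in>carrier_mat (a k) (a k). (W k)\<^sup>\<dagger> * \<Sigma> * W k * lift (b k * dE) y = lift (b k * dE) y' * ((W k)\<^sup>\<dagger> * \<Sigma> * W k)"
    using x(1) by blast
qed

lemma W_complete: "msum (dS * dE) K (\<lambda>k. W k * (W k)\<^sup>\<dagger>) = 1\<^sub>m (dS * dE)"
proof -
  have "msum (dS * dE) K (\<lambda>k. W k * (W k)\<^sup>\<dagger>) = msum (dS * dE) K (\<lambda>k. lift dE (V k * (V k)\<^sup>\<dagger>))"
    by (intro msum_cong) (simp add: W_def lift_adjoint lift_mult V_dims)
  also have "\<dots> = lift dE (msum dS K (\<lambda>k. V k * (V k)\<^sup>\<dagger>))"
    using star_algebraD(1)[OF alg projection_mem] by (intro kron_msum_left[symmetric]) auto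
  also have "\<dots> = 1\<^sub>m (dS * dE)" unfolding blocks_complete[OF blocks] by (simp add: kron_one)
  finally show ?thesis .
qed

text \<open>Inserting the resolution of the identity on the left leaves only the term of block k,
  since the others are off-diagonal.\<close>

lemma Sigma_block:
  assumes k: "k < K"
  shows "\<Sigma> * (W k * (W k)\<^sup>\<dagger>) = W k * ((W k)\<^sup>\<dagger> * \<Sigma> * W k) * (W k)\<^sup>\<dagger>"
proof -
  note [simp] = W_dims Sigma_carrier(2,3)
  let ?X = "\<Sigma> * (W k * (W k)\<^sup>\<dagger>)"
  have Xc: "?X \<in> carrier_mat (dS * dE) (dS * dE)" using k by (intro carrier_matI) simp_all
  have "?X = msum (dS * dE) K (\<lambda>l. W l * (W l)\<^sup>\<dagger>) * ?X" unfolding W_complete using k by simp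
  also have "\<dots> = msum (dS * dE) K (\<lambda>l. (W l * (W l)\<^sup>\<dagger>) * ?X)"
    using Xc by (intro msum_right) (auto intro!: carrier_matI)
  also have "\<dots> = (W k * (W k)\<^sup>\<dagger>) * ?X"
  proof (rule msum_single[OF k])
    fix l assume l: "l < K" "l \<noteq> k"
    have "(W l * (W l)\<^sup>\<dagger>) * ?X = W l * (((W l)\<^sup>\<dagger> * (\<Sigma> * W k)) * (W k)\<^sup>\<dagger>)" using k l by (simp add: mat_assoc)
    then show "(W l * (W l)\<^sup>\<dagger>) * ?X = 0\<^sub>m (dS * dE) (dS * dE)" unfolding off_diagonal[OF k l] using k l by simp
  next
    show "(W k * (W k)\<^sup>\<dagger>) * ?X \<in> carrier_mat (dS * dE) (dS * dE)" using k by (intro carrier_matI) simp_all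
  qed
  finally show ?thesis using k by (simp add: mat_assoc)
qed

text \<open>An element of the algebra acts on left factors only, so all products with \<Sigma> share
  the right factors \<open>T k\<close>. The left factors are products of two matrices and are not
  yet known to be positive.\<close>

lemma factor_blocks:
  assumes T: "\<And>k. k < K \<Longrightarrow> psd (a k) (p k) \<and> psd (b k * dE) (T k) \<and> (W k)\<^sup>\<dagger> * \<Sigma> * W k = kron (p k) (T k)"
    and Y: "Y \<in> \<A>"
  shows "\<exists>x. (\<forall>k<K. x k \<in> carrier_mat (a k) (a k)) \<and>
    lift dE Y * \<Sigma> = msum (dS * dE) K (\<lambda>k. W k * kron (x k) (T k) * (W k)\<^sup>\<dagger>)"
proof -
  note [simp] = W_dims V_dims Sigma_carrier(2,3)
  have Yd [simp]: "dim_row Y = dS" "dim_col Y = dS" using star_algebraD(1)[OF alg Y] by auto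
  have "\<forall>k<K. \<exists>y. y \<in> carrier_mat (a k) (a k) \<and> Y * V k = V k * kron y (1\<^sub>m (b k))"
    using blocksD(5)[OF blocks _ Y] by blast
  then obtain y where y: "\<And>k. k < K \<Longrightarrow> y k \<in> carrier_mat (a k) (a k)" "\<And>k. k < K \<Longrightarrow> Y * V k = V k * kron (y k) (1\<^sub>m (b k))"
    by metis
  have pc: "p k \<in> carrier_mat (a k) (a k)" "T k \<in> carrier_mat (b k * dE) (b k * dE)" if "k < K" for k
    using T[OF that] psd_carrier by auto
  have WW: "W k * (W k)\<^sup>\<dagger> \<in> carrier_mat (dS * dE) (dS * dE)" if "k < K" for k
    using that by (intro carrier_matI) simp_all
  have SW: "\<Sigma> * (W k * (W k)\<^sup>\<dagger>) \<in> carrier_mat (dS * dE) (dS * dE)" if "k < K" for k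
    using that by (intro carrier_matI) simp_all
  have LY: "lift dE Y \<in> carrier_mat (dS * dE) (dS * dE)" by (intro carrier_matI) simp_all
  have "\<Sigma> = \<Sigma> * msum (dS * dE) K (\<lambda>k. W k * (W k)\<^sup>\<dagger>)" unfolding W_complete by simp
  also have "\<dots> = msum (dS * dE) K (\<lambda>k. \<Sigma> * (W k * (W k)\<^sup>\<dagger>))"
    using WW by (rule msum_left[OF Sigma_carrier(1)])
  finally have "lift dE Y * \<Sigma> = lift dE Y * msum (dS * dE) K (\<lambda>k. \<Sigma> * (W k * (W k)\<^sup>\<dagger>))" by simp
  also have "\<dots> = msum (dS * dE) K (\<lambda>k. lift dE Y * (\<Sigma> * (W k * (W k)\<^sup>\<dagger>)))"
    using SW by (intro msum_left[OF LY])
  also have "\<dots> = msum (dS * dE) K (\<lambda>k. W k * kron (y k * p k) (T k) * (W k)\<^sup>\<dagger>)"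
  proof (rule msum_cong)
    fix k assume k: "k < K"
    have d [simp]: "dim_row (y k) = a k" "dim_col (y k) = a k" "dim_row (p k) = a k" "dim_col (p k) = a k"
      "dim_row (T k) = b k * dE" "dim_col (T k) = b k * dE"
      using y(1)[OF k] pc[OF k] by auto
    have LW: "lift dE Y * W k = W k * lift (b k * dE) (y k)"
    proof -
      have "lift dE Y * W k = lift dE (Y * V k)" using k by (simp add: W_def lift_mult)
      also have "\<dots> = W k * lift (b k * dE) (y k)" unfolding y(2)[OF k]
        using k by (simp add: W_def lift_mult lift_lift[symmetric])
      finally show ?thesis .
    qed
    have "lift dE Y * (\<Sigma> * (W k * (W k)\<^sup>\<dagger>)) = (lift dE Y * W k) * (kron (p k) (T k) * (W k)\<^sup>\<dagger>)"
      unfolding Sigma_block[OF k] using T[OF k] k by (simp add: mat_assoc)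
    also have "\<dots> = W k * ((lift (b k * dE) (y k) * kron (p k) (T k)) * (W k)\<^sup>\<dagger>)"
      unfolding LW using k by (simp add: mat_assoc)
    also have "lift (b k * dE) (y k) * kron (p k) (T k) = kron (y k * p k) (T k)"
      by (simp add: kron_mult)
    finally show "lift dE Y * (\<Sigma> * (W k * (W k)\<^sup>\<dagger>)) = W k * kron (y k * p k) (T k) * (W k)\<^sup>\<dagger>"
      using k by (simp add: mat_assoc)
  qed
  finally show ?thesis
    using y(1) pc(1) by (intro exI[of _ "\<lambda>k. y k * p k"]) (auto intro!: mult_carrier_mat)
qed

end

section \<open>From product blocks to probabilities and states\<close>

lemma psd_ecol_outer: "psd n (ecol n i * (ecol n i)\<^sup>\<dagger>)"
proof -
  have "(ecol n i)\<^sup>\<dagger> \<in> carrier_mat 1 n" by (simp only: adjoint_carrier ecol_carrier)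
  from psd_gram[OF this] show ?thesis by simp
qed

lemma density_carrier: "A \<in> density n \<Longrightarrow> A \<in> carrier_mat n n"
  using psd_carrier by (simp add: density_def)

lemma density_exists:
  assumes "n > 0"
  shows "\<exists>D. D \<in> density n"
proof -
  let ?D = "ecol n 0 * (ecol n 0)\<^sup>\<dagger>"
  have "psd n ?D" by (rule psd_ecol_outer)
  moreover have "mtrace ?D = (\<Sum>k<n. if k = 0 then 1 else 0)"
    by (auto simp: mtrace_def index_ecol_outer intro!: sum.cong)
  ultimately show ?thesis using assms by (auto simp: density_def)
qed

lemma density_scale:
  assumes "psd n A" "mtrace A \<noteq> 0"
  shows "(1 / mtrace A) \<cdot>\<^sub>m A \<in> density n"
proof -
  have "0 \<le> 1 / mtrace A"
    using psd_mtrace[OF assms(1)] assms(2) by (auto simp: less_eq_complex_def complex_is_Real_iff Re_divide Im_divide)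
  then show ?thesis
    using assms psd_carrier[OF assms(1)] by (simp add: density_def psd_smult mtrace_smult[of _ n])
qed

text \<open>Positivity of the left factor is recovered from that of the product. A block of weight
  zero receives arbitrary states, since the Markov form asks for states in every block.\<close>

lemma product_normalize:
  assumes psd: "psd (n * c) (kron A T)" "A \<in> carrier_mat n n" "psd c T" and pos: "n > 0" "c > 0"
  shows "\<exists>A' B'. A' \<in> density n \<and> B' \<in> density c \<and>
    kron A T = complex_of_real (Re (mtrace (kron A T))) \<cdot>\<^sub>m kron A' B'"
proof -
  have Tc: "T \<in> carrier_mat c c" by (rule psd_carrier[OF psd(3)])
  have tr: "mtrace (kron A T) = mtrace A * mtrace T" by (rule mtrace_kron[OF psd(2) Tc])
  have re: "complex_of_real (Re (mtrace (kron A T))) = mtrace (kron A T)"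
    using psd_mtrace[OF psd(1)] by (auto simp: less_eq_complex_def complex_eq_iff)
  show ?thesis
  proof (cases "mtrace (kron A T) = 0")
    case True
    then have "kron A T = 0\<^sub>m (n * c) (n * c)" by (rule psd_trace_eq_0[OF psd(1)])
    moreover obtain A' B' where AB: "A' \<in> density n" "B' \<in> density c" using density_exists pos by blast
    moreover have "0 \<cdot>\<^sub>m kron A' B' = 0\<^sub>m (n * c) (n * c)"
      using density_carrier[OF AB(1)] density_carrier[OF AB(2)] by (intro eq_matI) auto
    ultimately have "kron A T = complex_of_real (Re (mtrace (kron A T))) \<cdot>\<^sub>m kron A' B'"
      using True by simp
    with AB show ?thesis by blast
  next
    case False
    then have nz: "mtrace A \<noteq> 0" "mtrace T \<noteq> 0" unfolding tr by auto
    then have "T \<noteq> 0\<^sub>m c c" by auto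
    then have "psd n A" by (rule psd_kron_left[OF psd])
    then have "(1 / mtrace A) \<cdot>\<^sub>m A \<in> density n" "(1 / mtrace T) \<cdot>\<^sub>m T \<in> density c"
      using nz psd(3) by (auto intro!: density_scale)
    moreover have "kron A T = mtrace (kron A T) \<cdot>\<^sub>m kron ((1 / mtrace A) \<cdot>\<^sub>m A) ((1 / mtrace T) \<cdot>\<^sub>m T)"
      unfolding tr using nz by (simp add: kron_smult_left kron_smult_right mat_smult_smult)
    ultimately show ?thesis unfolding re by blast
  qed
qed

lemma ketbra_eq: "l < m \<Longrightarrow> ketbra m l = ecol m l * (ecol m l)\<^sup>\<dagger>"
  by (rule eq_matI) (auto simp: ketbra_def index_ecol_outer)

lemma ketbra_density: "l < m \<Longrightarrow> ketbra m l \<in> density m"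
proof -
  assume l: "l < m"
  have "mtrace (ketbra m l) = (\<Sum>k<m. if k = l then 1 else 0)"
    by (auto simp: mtrace_def ketbra_def intro!: sum.cong)
  moreover have "psd m (ketbra m l)"
    using psd_ecol_outer l by (simp add: ketbra_eq)
  ultimately show ?thesis using l by (simp add: density_def)
qed

lemma omega_density:
  assumes "\<rho> \<noteq> []" "set \<rho> \<subseteq> density (dS * dE)"
  shows "omega_RSE dS dE \<rho> \<in> density (length \<rho> * (dS * dE))"
proof -
  let ?m = "length \<rho>" let ?N = "?m * (dS * dE)"
  let ?f = "\<lambda>l. (1 / of_nat ?m) \<cdot>\<^sub>m kron (ketbra ?m l) (\<rho> ! l)"
  have d: "psd (dS * dE) (\<rho> ! l)" "mtrace (\<rho> ! l) = 1" if "l < ?m" for l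
    using assms(2) nth_mem[OF that] by (auto simp: density_def)
  have k: "psd ?m (ketbra ?m l)" "mtrace (ketbra ?m l) = 1" if "l < ?m" for l
    using ketbra_density[OF that] by (auto simp: density_def)
  have kk: "kron (ketbra ?m l) (\<rho> ! l) \<in> carrier_mat ?N ?N" if "l < ?m" for l
    using psd_carrier[OF psd_kron[OF k(1)[OF that] d(1)[OF that]]] .
  have m: "0 \<le> 1 / complex_of_nat ?m" by (simp add: less_eq_complex_def complex_is_Real_iff Re_divide Im_divide)
  have "psd ?N (msum ?N ?m ?f)" by (intro psd_msum psd_smult[OF _ m] psd_kron k d)
  moreover have "mtrace (msum ?N ?m ?f) = (\<Sum>l<?m. mtrace (?f l))"
    using kk by (intro mtrace_msum) simp
  moreover have "mtrace (?f l) = 1 / of_nat ?m" if "l < ?m" for l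
    using kk[OF that] mtrace_kron[OF psd_carrier[OF k(1)[OF that]] psd_carrier[OF d(1)[OF that]]] k(2)[OF that] d(2)[OF that]
    by (simp add: mtrace_smult[of _ ?N])
  ultimately show ?thesis using assms(1) by (simp add: density_def omega_RSE_def mult.assoc)
qed

text \<open>Since all \<rho>_i have the same right factors, the sum over the classical label can be
  carried out inside the left factors, separately in each block.\<close>

lemma (in normalized_blocks) markov:
  assumes \<rho>: "\<rho> \<noteq> []" "set \<rho> \<subseteq> density (dS * dE)"
    and factor: "\<And>i. i < length \<rho> \<Longrightarrow> \<exists>Y\<in>\<A>. \<rho> ! i = lift dE Y * \<Sigma>" and dE: "dE > 0"
  shows "markov_state (length \<rho>) dS dE (omega_RSE dS dE \<rho>)"
proof -
  define m where "m = length \<rho>"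
  define N where "N = m * (dS * dE)"
  have m0: "m > 0" using \<rho>(1) by (simp add: m_def)
  have "\<forall>k<K. \<exists>p T. psd (a k) p \<and> psd (b k * dE) T \<and> (W k)\<^sup>\<dagger> * \<Sigma> * W k = kron p T"
    using block_split by blast
  then obtain p T where pT: "\<And>k. k < K \<Longrightarrow> psd (a k) (p k) \<and> psd (b k * dE) (T k) \<and> (W k)\<^sup>\<dagger> * \<Sigma> * W k = kron (p k) (T k)"
    by metis
  have T: "psd (b k * dE) (T k)" "T k \<in> carrier_mat (b k * dE) (b k * dE)" if "k < K" for k
    using pT[OF that] psd_carrier by auto
  have "\<forall>i<m. \<exists>x. (\<forall>k<K. x k \<in> carrier_mat (a k) (a k)) \<and>
      \<rho> ! i = msum (dS * dE) K (\<lambda>k. W k * kron (x k) (T k) * (W k)\<^sup>\<dagger>)"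
  proof (intro allI impI)
    fix i assume "i < m"
    then obtain Y where Y: "Y \<in> \<A>" "\<rho> ! i = lift dE Y * \<Sigma>" using factor by (auto simp: m_def)
    show "\<exists>x. (\<forall>k<K. x k \<in> carrier_mat (a k) (a k)) \<and>
        \<rho> ! i = msum (dS * dE) K (\<lambda>k. W k * kron (x k) (T k) * (W k)\<^sup>\<dagger>)"
      unfolding Y(2) by (rule factor_blocks[OF pT Y(1)])
  qed
  then obtain x where x: "\<And>i k. i < m \<Longrightarrow> k < K \<Longrightarrow> x i k \<in> carrier_mat (a k) (a k)"
    and rx: "\<And>i. i < m \<Longrightarrow> \<rho> ! i = msum (dS * dE) K (\<lambda>k. W k * kron (x i k) (T k) * (W k)\<^sup>\<dagger>)"
    by metis
  \<comment> \<open>The unnormalised state of R and the left factor of block k; R enters only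
    here.\<close>
  define A where "A k = msum (m * a k) m (\<lambda>i. (1 / of_nat m) \<cdot>\<^sub>m kron (ketbra m i) (x i k))" for k
  define X where "X k = kron (1\<^sub>m m) (W k)" for k
  define \<omega> where "\<omega> = omega_RSE dS dE \<rho>"
  have kc: "ketbra m i \<in> carrier_mat m m" for i by (simp add: ketbra_def)
  have Ac: "A k \<in> carrier_mat (m * a k) (m * a k)" for k by (simp add: A_def)
  have Xc: "X k \<in> carrier_mat N (m * (a k * (b k * dE)))" if "k < K" for k
    using W_dims[OF that] by (intro carrier_matI) (simp_all add: X_def N_def)
  have Xd: "dim_row (X k) = N" "dim_col (X k) = m * (a k * (b k * dE))" if "k < K" for k
    using Xc[OF that] by auto
  have AT: "kron (A k) (T k) \<in> carrier_mat (m * (a k * (b k * dE))) (m * (a k * (b k * dE)))" if "k < K" for k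
    using T(2)[OF that] Ac[of k] by (intro carrier_matI) (auto simp: mult.assoc)
  have ATd: "dim_row (kron (A k) (T k)) = m * (a k * (b k * dE))" "dim_col (kron (A k) (T k)) = m * (a k * (b k * dE))" if "k < K" for k
    using AT[OF that] by auto
  have XX: "(X k)\<^sup>\<dagger> * X l = (if k = l then 1\<^sub>m (m * (a k * (b k * dE))) else 0\<^sub>m (m * (a k * (b k * dE))) (m * (a l * (b l * dE))))"
    if "k < K" "l < K" for k l
  proof -
    have "(X k)\<^sup>\<dagger> * X l = kron (1\<^sub>m m) ((W k)\<^sup>\<dagger> * W l)"
      using W_dims that by (simp add: X_def kron_adjoint kron_mult)
    moreover have "kron (1\<^sub>m m) (0\<^sub>m r c) = 0\<^sub>m (m * r) (m * c)" for r c
      by (rule eq_matI) (auto simp: index_kron div_mod_less)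
    ultimately show ?thesis using W_orth[OF that] by (simp add: kron_one)
  qed
  have summand: "X k * kron (A k) (T k) * (X k)\<^sup>\<dagger> =
      msum N m (\<lambda>i. (1 / of_nat m) \<cdot>\<^sub>m kron (ketbra m i) (W k * kron (x i k) (T k) * (W k)\<^sup>\<dagger>))" if k: "k < K" for k
  proof -
    have xc: "x i k \<in> carrier_mat (a k) (a k)" "dim_row (x i k) = a k" "dim_col (x i k) = a k" if "i < m" for i
      using x[OF that k] by auto
    note [simp] = W_dims[OF k] Xd[OF k]
    have Td [simp]: "dim_row (T k) = b k * dE" "dim_col (T k) = b k * dE" using T(2)[OF k] by auto
    have kd [simp]: "dim_row (ketbra m i) = m" "dim_col (ketbra m i) = m" for i using kc by auto
    let ?g = "\<lambda>i. (1 / of_nat m) \<cdot>\<^sub>m kron (ketbra m i) (kron (x i k) (T k))"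
    have "kron (A k) (T k) = msum (m * a k * (b k * dE)) m (\<lambda>i. kron ((1 / of_nat m) \<cdot>\<^sub>m kron (ketbra m i) (x i k)) (T k))"
      unfolding A_def by (intro kron_msum_left T(2)[OF k] smult_carrier_mat kron_carrier kc x[OF _ k])
    also have "\<dots> = msum (m * (a k * (b k * dE))) m ?g"
      by (simp add: kron_smult_left kron_assoc mult.assoc)
    finally have "X k * kron (A k) (T k) * (X k)\<^sup>\<dagger> = X k * msum (m * (a k * (b k * dE))) m ?g * (X k)\<^sup>\<dagger>" by simp
    also have "\<dots> = msum N m (\<lambda>i. X k * ?g i * (X k)\<^sup>\<dagger>)"
      using Xc[OF k] xc by (intro msum_sandwich) (auto intro!: carrier_matI)
    also have "\<dots> = msum N m (\<lambda>i. (1 / of_nat m) \<cdot>\<^sub>m kron (ketbra m i) (W k * kron (x i k) (T k) * (W k)\<^sup>\<dagger>))"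
    proof (rule msum_cong)
      fix i assume i: "i < m"
      note [simp] = xc[OF i]
      have "X k * ?g i * (X k)\<^sup>\<dagger> = (1 / of_nat m) \<cdot>\<^sub>m (X k * kron (ketbra m i) (kron (x i k) (T k)) * (X k)\<^sup>\<dagger>)"
        by (simp add: mat_smult_left mat_smult_right)
      also have "X k * kron (ketbra m i) (kron (x i k) (T k)) * (X k)\<^sup>\<dagger> =
          kron (ketbra m i) (W k * kron (x i k) (T k) * (W k)\<^sup>\<dagger>)"
        by (simp add: X_def kron_adjoint kron_mult)
      finally show "X k * ?g i * (X k)\<^sup>\<dagger> =
          (1 / of_nat m) \<cdot>\<^sub>m kron (ketbra m i) (W k * kron (x i k) (T k) * (W k)\<^sup>\<dagger>)" .
    qed
    finally show ?thesis .
  qed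
  have WTc: "W k * kron (x i k) (T k) * (W k)\<^sup>\<dagger> \<in> carrier_mat (dS * dE) (dS * dE)" if "i < m" "k < K" for i k
    using W_dims[OF that(2)] by (intro carrier_matI) simp_all
  have \<omega>: "\<omega> = msum N K (\<lambda>k. X k * kron (A k) (T k) * (X k)\<^sup>\<dagger>)"
  proof -
    have "\<omega> = msum N m (\<lambda>i. (1 / of_nat m) \<cdot>\<^sub>m kron (ketbra m i) (\<rho> ! i))"
      by (simp add: \<omega>_def omega_RSE_def m_def N_def mult.assoc)
    also have "\<dots> = msum N m (\<lambda>i. msum N K (\<lambda>k. (1 / of_nat m) \<cdot>\<^sub>m kron (ketbra m i) (W k * kron (x i k) (T k) * (W k)\<^sup>\<dagger>)))"
    proof (rule msum_cong)
      fix i assume i: "i < m"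
      have "kron (ketbra m i) (\<rho> ! i) = msum N K (\<lambda>k. kron (ketbra m i) (W k * kron (x i k) (T k) * (W k)\<^sup>\<dagger>))"
        unfolding rx[OF i] N_def using WTc[OF i] kc by (intro kron_msum_right)
      then show "(1 / of_nat m) \<cdot>\<^sub>m kron (ketbra m i) (\<rho> ! i) =
          msum N K (\<lambda>k. (1 / of_nat m) \<cdot>\<^sub>m kron (ketbra m i) (W k * kron (x i k) (T k) * (W k)\<^sup>\<dagger>))"
        using kron_carrier[OF kc WTc[OF i]] by (simp add: msum_smult N_def)
    qed
    also have "\<dots> = msum N K (\<lambda>k. X k * kron (A k) (T k) * (X k)\<^sup>\<dagger>)"
      unfolding msum_swap[of N m] by (intro msum_cong) (simp add: summand)
    finally show ?thesis .
  qed
  have tc: "X k * kron (A k) (T k) * (X k)\<^sup>\<dagger> \<in> carrier_mat N N" if "k < K" for k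
    using Xd[OF that] by (intro carrier_matI) simp_all
  have \<omega>d: "psd N \<omega>" "mtrace \<omega> = 1"
    using omega_density[OF \<rho>] by (auto simp: \<omega>_def density_def N_def m_def)
  \<comment> \<open>Block k is the compression of the positive operator \<omega>, which settles
    positivity although the single \<open>x i k\<close> are not known to be positive.\<close>
  have pAT: "psd (m * a k * (b k * dE)) (kron (A k) (T k))" if k: "k < K" for k
  proof -
    have "(X k)\<^sup>\<dagger> * \<omega> * X k = msum (m * (a k * (b k * dE))) K (\<lambda>l. (X k)\<^sup>\<dagger> * (X l * kron (A l) (T l) * (X l)\<^sup>\<dagger>) * X k)"
      unfolding \<omega> using Xc[OF k] tc by (intro msum_sandwich) auto
    also have "\<dots> = (X k)\<^sup>\<dagger> * (X k * kron (A k) (T k) * (X k)\<^sup>\<dagger>) * X k"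
    proof (rule msum_single[OF k])
      fix l assume l: "l < K" "l \<noteq> k"
      have "(X k)\<^sup>\<dagger> * (X l * kron (A l) (T l) * (X l)\<^sup>\<dagger>) * X k =
          ((X k)\<^sup>\<dagger> * X l) * (kron (A l) (T l) * ((X l)\<^sup>\<dagger> * X k))"
        using Xd[OF k] Xd[OF l(1)] ATd[OF l(1)] by (simp add: mat_assoc del: dim_kron)
      then show "(X k)\<^sup>\<dagger> * (X l * kron (A l) (T l) * (X l)\<^sup>\<dagger>) * X k = 0\<^sub>m (m * (a k * (b k * dE))) (m * (a k * (b k * dE)))"
        using XX[OF k l(1)] XX[OF l(1) k] l(2) Xd[OF k] Xd[OF l(1)] ATd[OF l(1)] by (simp del: dim_kron)
    qed (use Xd[OF k] in \<open>intro carrier_matI; simp\<close>)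
    also have "\<dots> = ((X k)\<^sup>\<dagger> * X k) * (kron (A k) (T k) * ((X k)\<^sup>\<dagger> * X k))"
      using Xd[OF k] ATd[OF k] by (simp add: mat_assoc del: dim_kron)
    also have "\<dots> = kron (A k) (T k)" using XX[OF k k] ATd[OF k] by (simp del: dim_kron)
    finally have "(X k)\<^sup>\<dagger> * \<omega> * X k = kron (A k) (T k)" .
    then show ?thesis using psd_conj[OF \<omega>d(1) Xc[OF k]] by (simp add: mult.assoc)
  qed
  \<comment> \<open>The weight of a block is its trace; compression by the isometries
    \<open>X k\<close> shows that the weights add up to tr \<omega> = 1.\<close>
  define lam where "lam k = Re (mtrace (kron (A k) (T k)))" for k
  have "\<forall>k<K. \<exists>A' B'. A' \<in> density (m * a k) \<and> B' \<in> density (b k * dE) \<and>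
      kron (A k) (T k) = complex_of_real (lam k) \<cdot>\<^sub>m kron A' B'"
    unfolding lam_def
    using product_normalize[OF pAT Ac T(1)] m0 dE blocksD(1,2)[OF blocks] by auto
  then obtain A' B' where AB: "\<And>k. k < K \<Longrightarrow> A' k \<in> density (m * a k)" "\<And>k. k < K \<Longrightarrow> B' k \<in> density (b k * dE)"
    "\<And>k. k < K \<Longrightarrow> kron (A k) (T k) = complex_of_real (lam k) \<cdot>\<^sub>m kron (A' k) (B' k)"
    by metis
  have lam0: "0 \<le> lam k" if "k < K" for k
    using psd_mtrace[OF pAT[OF that]] by (simp add: lam_def less_eq_complex_def)
  have "1 = Re (mtrace \<omega>)" using \<omega>d(2) by simp
  also have "\<dots> = (\<Sum>k<K. Re (mtrace (X k * kron (A k) (T k) * (X k)\<^sup>\<dagger>)))"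
    unfolding \<omega> using tc by (subst mtrace_msum) auto
  also have "\<dots> = (\<Sum>k<K. lam k)"
  proof (intro sum.cong refl)
    fix k assume "k \<in> {..<K}"
    then have k: "k < K" by simp
    have "mtrace (X k * kron (A k) (T k) * (X k)\<^sup>\<dagger>) = mtrace ((X k)\<^sup>\<dagger> * (X k * kron (A k) (T k)))"
      using Xc[OF k] AT[OF k] by (intro mtrace_mult_comm[of _ N "m * (a k * (b k * dE))"]) auto
    also have "(X k)\<^sup>\<dagger> * (X k * kron (A k) (T k)) = ((X k)\<^sup>\<dagger> * X k) * kron (A k) (T k)"
      using Xd[OF k] ATd[OF k] by (simp add: mat_assoc del: dim_kron)
    also have "\<dots> = kron (A k) (T k)" using XX[OF k k] ATd[OF k] by (simp del: dim_kron)
    finally show "Re (mtrace (X k * kron (A k) (T k) * (X k)\<^sup>\<dagger>)) = lam k" by (simp add: lam_def)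
  qed
  finally have lam1: "(\<Sum>k<K. lam k) = 1" ..
  have \<omega>': "\<omega> = msum (m * dS * dE) K (\<lambda>k. let Wk = kron (kron (1\<^sub>m m) (V k)) (1\<^sub>m dE)
      in complex_of_real (lam k) \<cdot>\<^sub>m (Wk * kron (A' k) (B' k) * mat_adjoint Wk))"
    unfolding \<omega> N_def mult.assoc
  proof (rule msum_cong)
    fix k assume k: "k < K"
    have Xe: "kron (kron (1\<^sub>m m) (V k)) (1\<^sub>m dE) = X k" by (simp add: X_def W_def kron_assoc)
    have d: "dim_row (kron (A' k) (B' k)) = m * (a k * (b k * dE))" "dim_col (kron (A' k) (B' k)) = m * (a k * (b k * dE))"
      using density_carrier[OF AB(1)[OF k]] density_carrier[OF AB(2)[OF k]] by (auto simp: mult.assoc)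
    show "X k * kron (A k) (T k) * (X k)\<^sup>\<dagger> = (let Wk = kron (kron (1\<^sub>m m) (V k)) (1\<^sub>m dE)
      in complex_of_real (lam k) \<cdot>\<^sub>m (Wk * kron (A' k) (B' k) * mat_adjoint Wk))"
      unfolding Let_def Xe AB(3)[OF k] using d Xd[OF k] by (simp add: mat_smult_left mat_smult_right del: dim_kron)
  qed
  have "\<exists>K a b V (lam :: nat \<Rightarrow> real) A B.
       (\<forall>k<K. V k \<in> carrier_mat dS (a k * b k)) \<and>
       (\<forall>k<K. \<forall>l<K. mat_adjoint (V k) * V l =
           (if k = l then 1\<^sub>m (a k * b k) else 0\<^sub>m (a k * b k) (a l * b l))) \<and>
       msum dS K (\<lambda>k. V k * mat_adjoint (V k)) = 1\<^sub>m dS \<and>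
       (\<forall>k<K. 0 \<le> lam k) \<and> (\<Sum>k<K. lam k) = 1 \<and>
       (\<forall>k<K. A k \<in> density (m * a k) \<and> B k \<in> density (b k * dE)) \<and>
       \<omega> = msum (m * dS * dE) K (\<lambda>k.
              let W = kron (kron (1\<^sub>m m) (V k)) (1\<^sub>m dE)
              in complex_of_real (lam k) \<cdot>\<^sub>m (W * kron (A k) (B k) * mat_adjoint W))"
    apply (rule exI[of _ K], rule exI[of _ a], rule exI[of _ b], rule exI[of _ V],
        rule exI[of _ lam], rule exI[of _ A'], rule exI[of _ B'])
    using blocksD(3)[OF blocks] blocksD(4)[OF blocks] blocks_complete[OF blocks] lam0 lam1 AB(1,2) \<omega>'
    by (intro conjI allI impI) auto
  then show ?thesis unfolding markov_state_def m_def \<omega>_def .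
qed

section \<open>Complete positivity of the recovery map\<close>

lemma one_eq_msum: "1\<^sub>m n = msum n n (\<lambda>q. ecol n q * (ecol n q)\<^sup>\<dagger>)"
proof (rule eq_matI)
  fix i j assume "i < dim_row (msum n n (\<lambda>q. ecol n q * (ecol n q)\<^sup>\<dagger>))" "j < dim_col (msum n n (\<lambda>q. ecol n q * (ecol n q)\<^sup>\<dagger>))"
  then have ij: "i < n" "j < n" by auto
  have "(\<Sum>q<n. (ecol n q * (ecol n q)\<^sup>\<dagger>) $$ (i,j)) = (\<Sum>q<n. if q = i then if i = j then 1 else 0 else 0)"
    using ij by (intro sum.cong refl) (auto simp: index_ecol_outer)
  then show "(1\<^sub>m n :: complex mat) $$ (i,j) = msum n n (\<lambda>q. ecol n q * (ecol n q)\<^sup>\<dagger>) $$ (i,j)"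
    using ij by (simp add: msum_def)
qed auto

text \<open>Kraus form with the kets of the second factor, resolving the identity there.\<close>

lemma cp_map_lift: "cp_map n (n * c) (lift c)"
proof (rule cp_map_cong)
  show "cp_map n (n * c) (\<lambda>X. msum (n * c) c (\<lambda>q. ket n c q * X * (ket n c q)\<^sup>\<dagger>))"
    by (intro cp_map_msum cp_map_conj ket_carrier)
  fix X :: "complex mat" assume X: "X \<in> carrier_mat n n"
  then have d: "dim_row X = n" "dim_col X = n" by auto
  have "kron X (1\<^sub>m 1) = X" using X by (intro eq_matI) (auto simp: index_kron)
  then have "ket n c q * X * (ket n c q)\<^sup>\<dagger> = ket n c q * kron X (1\<^sub>m 1) * (ket n c q)\<^sup>\<dagger>" for q by simp
  also have "ket n c q * kron X (1\<^sub>m 1) * (ket n c q)\<^sup>\<dagger> = kron X (ecol c q * (ecol c q)\<^sup>\<dagger>)" for q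
    using d by (simp add: kron_adjoint kron_mult)
  finally have "msum (n * c) c (\<lambda>q. ket n c q * X * (ket n c q)\<^sup>\<dagger>) = msum (n * c) c (\<lambda>q. kron X (ecol c q * (ecol c q)\<^sup>\<dagger>))"
    by simp
  also have "\<dots> = kron X (msum c c (\<lambda>q. ecol c q * (ecol c q)\<^sup>\<dagger>))"
    by (intro kron_msum_right[symmetric] X) (rule carrier_matI; simp)
  finally show "msum (n * c) c (\<lambda>q. ket n c q * X * (ket n c q)\<^sup>\<dagger>) = lift c X"
    unfolding one_eq_msum[symmetric] .
qed

text \<open>Each diagonal entry of X is a 1 x 1 compression; tensoring it with the identity and
  conjugating by a square root of \<tau> gives that entry times \<tau>, and the sum over entries is
  the map.\<close>

lemma cp_map_trace:
  assumes "psd N \<tau>"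
  shows "cp_map n N (\<lambda>X. mtrace X \<cdot>\<^sub>m \<tau>)"
proof -
  obtain B where B: "B \<in> carrier_mat N N" "B\<^sup>\<dagger> = B" "\<tau> = B\<^sup>\<dagger> * B" using psd_factor[OF assms] by blast
  have Bd: "dim_row B = N" "dim_col B = N" using B by auto
  have e: "(ecol n j)\<^sup>\<dagger> \<in> carrier_mat 1 n" for j by (simp only: adjoint_carrier ecol_carrier)
  let ?f = "\<lambda>j X. B * lift N ((ecol n j)\<^sup>\<dagger> * X * ((ecol n j)\<^sup>\<dagger>)\<^sup>\<dagger>) * B\<^sup>\<dagger>"
  have "cp_map n N (?f j)" for j
  proof (rule cp_map_comp[where m = "1 * N" and F = "\<lambda>X. lift N ((ecol n j)\<^sup>\<dagger> * X * ((ecol n j)\<^sup>\<dagger>)\<^sup>\<dagger>)"])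
    show "cp_map n (1 * N) (\<lambda>X. lift N ((ecol n j)\<^sup>\<dagger> * X * ((ecol n j)\<^sup>\<dagger>)\<^sup>\<dagger>))"
      by (rule cp_map_comp[where m = 1, OF cp_map_conj[OF e] cp_map_lift]) (rule carrier_matI; simp)
    show "cp_map (1 * N) N (\<lambda>X. B * X * B\<^sup>\<dagger>)" using B(1) by (intro cp_map_conj) simp
  qed (rule carrier_matI; simp)
  then have "cp_map n N (\<lambda>X. msum N n (\<lambda>j. ?f j X))" by (rule cp_map_msum)
  then show ?thesis
  proof (rule cp_map_cong[rotated])
    fix X :: "complex mat" assume X: "X \<in> carrier_mat n n"
    then have Xd: "dim_row X = n" "dim_col X = n" by auto
    have "?f j X = X $$ (j,j) \<cdot>\<^sub>m \<tau>" if j: "j < n" for j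
    proof -
      have "(ecol n j)\<^sup>\<dagger> * X * ((ecol n j)\<^sup>\<dagger>)\<^sup>\<dagger> = X $$ (j,j) \<cdot>\<^sub>m 1\<^sub>m 1"
        using Xd ecol_form[OF X j j] by (intro eq_matI) (auto simp: mat_assoc)
      then have "?f j X = X $$ (j,j) \<cdot>\<^sub>m (B * (kron (1\<^sub>m 1) (1\<^sub>m N)) * B\<^sup>\<dagger>)"
        using Bd by (simp add: kron_smult_left mat_smult_left mat_smult_right)
      then show ?thesis using Bd B(2,3) by (simp add: kron_one)
    qed
    then have "msum N n (\<lambda>j. ?f j X) = msum N n (\<lambda>j. X $$ (j,j) \<cdot>\<^sub>m \<tau>)" by (rule msum_cong)
    also have "\<dots> = mtrace X \<cdot>\<^sub>m \<tau>"
      using X psd_carrier[OF assms] by (intro eq_matI) (auto simp: msum_def mtrace_def sum_distrib_right)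
    finally show "msum N n (\<lambda>j. ?f j X) = mtrace X \<cdot>\<^sub>m \<tau>" .
  qed
qed

context petz
begin

text \<open>The Petz map only preserves the trace on the support of \<open>\<sigma>\<close>; the second summand repairs this.\<close>

definition recovery :: "complex mat \<Rightarrow> complex mat \<Rightarrow> complex mat" where
  "recovery \<tau> X = petz_map X + mtrace ((1\<^sub>m dS - P) * X) \<cdot>\<^sub>m \<tau>"

lemma recovery_carrier:
  assumes "\<tau> \<in> carrier_mat (dS * dE) (dS * dE)" "X \<in> carrier_mat dS dS"
  shows "recovery \<tau> X \<in> carrier_mat (dS * dE) (dS * dE)"
  unfolding recovery_def using assms by (intro add_carrier_mat smult_carrier_mat)

lemma recovery_lin_map:
  assumes "\<tau> \<in> carrier_mat (dS * dE) (dS * dE)"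
  shows "lin_map dS (dS * dE) (recovery \<tau>)"
  unfolding lin_map_def
proof (intro conjI ballI allI)
  fix A :: "complex mat" assume A: "A \<in> carrier_mat dS dS"
  have Ad: "dim_row A = dS" "dim_col A = dS" using A by auto
  have td: "dim_row \<tau> = dS * dE" "dim_col \<tau> = dS * dE" using assms by auto
  show "recovery \<tau> A \<in> carrier_mat (dS * dE) (dS * dE)" by (rule recovery_carrier[OF assms A])
  have QA: "(1\<^sub>m dS - P) * A \<in> carrier_mat dS dS" using Ad by (intro carrier_matI) simp_all
  show "recovery \<tau> (c \<cdot>\<^sub>m A) = c \<cdot>\<^sub>m recovery \<tau> A" for c
  proof -
    have "petz_map (c \<cdot>\<^sub>m A) = c \<cdot>\<^sub>m petz_map A"
      using Ad by (simp add: petz_map_def mat_smult_left mat_smult_right kron_smult_left)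
    moreover have "mtrace ((1\<^sub>m dS - P) * (c \<cdot>\<^sub>m A)) = c * mtrace ((1\<^sub>m dS - P) * A)"
      using Ad by (simp add: mat_smult_right mtrace_smult[OF QA])
    moreover have "dim_row (petz_map A) = dS * dE" "dim_col (petz_map A) = dS * dE"
      using petz_map_carrier[OF A] by auto
    ultimately show ?thesis using td unfolding recovery_def
      by (intro eq_matI) (simp_all add: algebra_simps)
  qed
  fix B :: "complex mat" assume B: "B \<in> carrier_mat dS dS"
  have Bd: "dim_row B = dS" "dim_col B = dS" using B by auto
  have QB: "(1\<^sub>m dS - P) * B \<in> carrier_mat dS dS" using Bd by (intro carrier_matI) simp_all
  show "recovery \<tau> (A + B) = recovery \<tau> A + recovery \<tau> B"
  proof -
    have tt: "t * (X * t) \<in> carrier_mat dS dS" if "dim_row X = dS" "dim_col X = dS" for X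
      using that by (intro carrier_matI) simp_all
    have "petz_map (A + B) = petz_map A + petz_map B"
      using Ad Bd kron_add_left[OF tt[OF Ad] tt[OF Bd], of "1\<^sub>m dE"]
      by (simp add: petz_map_def mat_add_left mat_add_right)
    moreover have "mtrace ((1\<^sub>m dS - P) * (A + B)) = mtrace ((1\<^sub>m dS - P) * A) + mtrace ((1\<^sub>m dS - P) * B)"
      using Ad Bd by (simp add: mat_add_right mtrace_add[OF QA QB])
    moreover have "dim_row (petz_map A) = dS * dE" "dim_col (petz_map A) = dS * dE"
      "dim_row (petz_map B) = dS * dE" "dim_col (petz_map B) = dS * dE"
      using petz_map_carrier[OF A] petz_map_carrier[OF B] by auto
    ultimately show ?thesis using td unfolding recovery_def
      by (intro eq_matI) (simp_all add: algebra_simps)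
  qed
qed

text \<open>Under the trace the two factors \<open>z\<close> combine to \<Sigma>, whose marginal
  \<sigma> cancels the factors \<open>t\<close> up to \<open>P\<close>. The deficit is what the
  second summand of \<open>recovery\<close> supplies.\<close>

lemma petz_map_trace:
  assumes X: "X \<in> carrier_mat dS dS"
  shows "mtrace (petz_map X) = mtrace (P * X)"
proof -
  have Xd: "dim_row X = dS" "dim_col X = dS" using X by auto
  let ?Y = "t * (X * t)"
  have t\<sigma>: "t * \<sigma> = s" unfolding S.mults(1)[symmetric] by (simp add: S.cancels S.mults(4))
  have Y: "?Y \<in> carrier_mat dS dS" using Xd by (intro carrier_matI) simp_all
  have "mtrace (petz_map X) = mtrace ((L ?Y * z) * z)"
    unfolding petz_map_def using Xd by (intro mtrace_mult_comm[of _ "dS * dE" "dS * dE"] carrier_matI) simp_all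
  also have "\<dots> = mtrace (L ?Y * \<Sigma>)" using Xd by (simp add: mat_assoc E.mults)
  also have "\<dots> = mtrace (?Y * \<sigma>)" using mtrace_lift[OF E.A_carrier(1) Y] marginal by simp
  also have "\<dots> = mtrace (t * (X * s))"
    using Xd S.A_carrier by (simp add: mat_assoc t\<sigma>)
  also have "\<dots> = mtrace ((X * s) * t)"
    using Xd by (intro mtrace_mult_comm[of _ dS dS] carrier_matI) simp_all
  also have "\<dots> = mtrace (X * P)" using Xd by (simp add: mat_assoc S.mults)
  also have "\<dots> = mtrace (P * X)" by (rule mtrace_mult_comm[OF X S.carrier(3)])
  finally show ?thesis .
qed

lemma recovery_trace_pres:
  assumes "\<tau> \<in> density (dS * dE)"
  shows "trace_pres dS (recovery \<tau>)"
  unfolding trace_pres_def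
proof
  fix X :: "complex mat" assume X: "X \<in> carrier_mat dS dS"
  have Xd: "dim_row X = dS" "dim_col X = dS" using X by auto
  have \<tau>: "\<tau> \<in> carrier_mat (dS * dE) (dS * dE)" "mtrace \<tau> = 1"
    using density_carrier[OF assms] assms by (auto simp: density_def)
  have "mtrace (recovery \<tau> X) = mtrace (P * X) + mtrace ((1\<^sub>m dS - P) * X)"
    unfolding recovery_def
    using mtrace_add[OF petz_map_carrier[OF X] smult_carrier_mat[OF \<tau>(1)]] \<tau>(2)
    by (simp add: petz_map_trace[OF X] mtrace_smult[OF \<tau>(1)])
  also have "(1\<^sub>m dS - P) * X = X - P * X" using Xd by (simp add: mat_minus_left)
  also have "mtrace (X - P * X) = mtrace X - mtrace (P * X)" using Xd by (simp add: mtrace_minus_square)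
  finally show "mtrace (recovery \<tau> X) = mtrace X" by simp
qed

lemma recovery_cp:
  assumes "psd (dS * dE) \<tau>"
  shows "cp_map dS (dS * dE) (recovery \<tau>)"
proof -
  let ?Q = "1\<^sub>m dS - P"
  have Qc: "?Q \<in> carrier_mat dS dS" by (rule carrier_matI) simp_all
  have QQ: "?Q * ?Q = ?Q" by (simp add: mat_minus_left mat_minus_right S.mults)
  have Qh: "?Q\<^sup>\<dagger> = ?Q" by (simp add: adjoint_minus S.herm)
  have 1: "cp_map dS (dS * dE) (\<lambda>X. z * lift dE (t * X * t\<^sup>\<dagger>) * z\<^sup>\<dagger>)"
  proof (rule cp_map_comp[OF _ cp_map_conj[OF E.carrier(1)], where F = "\<lambda>X. lift dE (t * X * t\<^sup>\<dagger>)"])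
    show "cp_map dS (dS * dE) (\<lambda>X. lift dE (t * X * t\<^sup>\<dagger>))"
      by (rule cp_map_comp[OF cp_map_conj[OF S.carrier(2)] cp_map_lift]) (rule carrier_matI; simp)
  qed (rule carrier_matI; simp)
  have 2: "cp_map dS (dS * dE) (\<lambda>X. mtrace (?Q * X * ?Q\<^sup>\<dagger>) \<cdot>\<^sub>m \<tau>)"
    by (rule cp_map_comp[OF cp_map_conj[OF Qc] cp_map_trace[OF assms]]) (rule carrier_matI; simp)
  have "cp_map dS (dS * dE) (\<lambda>X. z * lift dE (t * X * t\<^sup>\<dagger>) * z\<^sup>\<dagger> + mtrace (?Q * X * ?Q\<^sup>\<dagger>) \<cdot>\<^sub>m \<tau>)"
  proof (rule cp_map_add[OF 1 2])
    show "z * lift dE (t * X * t\<^sup>\<dagger>) * z\<^sup>\<dagger> \<in> carrier_mat (dS * dE) (dS * dE)" for X by (rule carrier_matI) simp_all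
    show "mtrace (?Q * X * ?Q\<^sup>\<dagger>) \<cdot>\<^sub>m \<tau> \<in> carrier_mat (dS * dE) (dS * dE)" for X
      by (rule smult_carrier_mat[OF psd_carrier[OF assms]])
  qed
  then show ?thesis
  proof (rule cp_map_cong[rotated])
    fix X :: "complex mat" assume X: "X \<in> carrier_mat dS dS"
    have Xd: "dim_row X = dS" "dim_col X = dS" using X by auto
    have "mtrace (?Q * X * ?Q) = mtrace (?Q * (?Q * X))"
      using Xd by (intro mtrace_mult_comm[of _ dS dS] carrier_matI) simp_all
    also have "?Q * (?Q * X) = (?Q * ?Q) * X" using Xd by (intro mat_assoc[symmetric]) simp_all
    finally have "mtrace (?Q * X * ?Q) = mtrace (?Q * X)" unfolding QQ .
    moreover have "z * lift dE (t * X * t\<^sup>\<dagger>) * z\<^sup>\<dagger> = petz_map X"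
      using Xd by (simp add: petz_map_def S.herm E.herm mat_assoc)
    ultimately show "z * lift dE (t * X * t\<^sup>\<dagger>) * z\<^sup>\<dagger> + mtrace (?Q * X * ?Q\<^sup>\<dagger>) \<cdot>\<^sub>m \<tau> = recovery \<tau> X"
      unfolding recovery_def Qh by simp
  qed
qed

lemma recovery_fixed:
  assumes \<tau>: "\<tau> \<in> carrier_mat (dS * dE) (dS * dE)"
    and dom: "dominated (dS * dE) \<Sigma> \<rho>" and rec: "petz_map (ptrace_E dS dE \<rho>) = \<rho>"
  shows "recovery \<tau> (ptrace_E dS dE \<rho>) = \<rho>"
proof -
  let ?x = "ptrace_E dS dE \<rho>"
  have "P * ?x = ?x" by (rule S.dominated_support(1)[OF ptrace_dominated[OF dom]])
  then have "(1\<^sub>m dS - P) * ?x = 0\<^sub>m dS dS" by (simp add: mat_minus_left)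
  moreover have "\<rho> \<in> carrier_mat (dS * dE) (dS * dE)" using dom psd_carrier by (simp add: dominated_def)
  ultimately show ?thesis unfolding recovery_def rec using \<tau> by (intro eq_matI) auto
qed

end

section \<open>Spans\<close>

lemma lincomb_msum:
  assumes "set l \<subseteq> carrier_mat N N"
  shows "lincomb N c l = msum N (length l) (\<lambda>k. c k \<cdot>\<^sub>m (l ! k))"
proof -
  have "l ! k \<in> carrier_mat N N" if "k < length l" for k using that assms nth_mem by blast
  then have d: "dim_row (l ! k) = N" "dim_col (l ! k) = N" if "k < length l" for k
    using that by (blast dest: carrier_matD)+
  show ?thesis
    by (rule eq_matI) (simp_all add: lincomb_def msum_def d)
qed

lemma lin_map_lincomb:
  assumes F: "lin_map N M F" and l: "set l \<subseteq> carrier_mat N N"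
  shows "F (lincomb N c l) = lincomb M c (map F l)"
proof -
  have lk: "l ! k \<in> carrier_mat N N" if "k < length l" for k using that l nth_mem by blast
  have "set (map F l) \<subseteq> carrier_mat M M" using l lin_mapD(1)[OF F] by auto
  then have "lincomb M c (map F l) = msum M (length l) (\<lambda>k. c k \<cdot>\<^sub>m F (l ! k))"
    by (subst lincomb_msum) (auto intro!: msum_cong)
  also have "\<dots> = msum M (length l) (\<lambda>k. F (c k \<cdot>\<^sub>m (l ! k)))"
    by (intro msum_cong) (simp add: lin_mapD(3)[OF F lk])
  also have "\<dots> = F (lincomb N c l)"
    unfolding lincomb_msum[OF l] using lk by (intro lin_map_msum[OF F, symmetric]) simp
  finally show ?thesis ..
qed

lemma maximal_spans:
  assumes S: "S \<subseteq> carrier_mat N N" and mx: "max_lin_indep_subset N S l" and X: "X \<in> S"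
  shows "\<exists>d. X = lincomb N d l"
proof -
  have ls: "set l \<subseteq> S" "lin_indep N l" using mx by (auto simp: max_lin_indep_subset_def)
  have Xd: "dim_row X = N" "dim_col X = N" using S X by auto
  show ?thesis
  proof (cases "X \<in> set l")
    case True
    then obtain k where k: "k < length l" "l ! k = X" by (auto simp: in_set_conv_nth)
    have "(\<Sum>j<length l. (if j = k then 1 else 0) * (l ! j) $$ (i, i')) = X $$ (i, i')" for i i'
    proof -
      have "(\<Sum>j<length l. (if j = k then 1 else 0) * (l ! j) $$ (i, i')) = (\<Sum>j<length l. if j = k then X $$ (i, i') else 0)"
        by (intro sum.cong) (auto simp: k(2))
      then show ?thesis using k(1) by simp
    qed
    then have "X = lincomb N (\<lambda>j. if j = k then 1 else 0) l"
      using Xd by (intro eq_matI) (simp_all add: lincomb_def)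
    then show ?thesis by blast
  next
    case False
    then have "\<not> lin_indep N (l @ [X])" using mx X by (auto simp: max_lin_indep_subset_def)
    moreover have "set (l @ [X]) \<subseteq> carrier_mat N N" using ls S X by auto
    ultimately obtain c k where c: "lincomb N c (l @ [X]) = 0\<^sub>m N N" "k < length (l @ [X])" "c k \<noteq> 0"
      unfolding lin_indep_def by blast
    let ?n = "length l"
    have e: "(\<Sum>j<?n. c j * (l ! j) $$ (i,i')) + c ?n * X $$ (i,i') = 0" if "i < N" "i' < N" for i i'
    proof -
      have "lincomb N c (l @ [X]) $$ (i,i') = 0" using c(1) that by simp
      then show ?thesis using that by (simp add: lincomb_def nth_append)
    qed
    \<comment> \<open>A relation without \<open>X\<close> would be a nontrivial relation inside
      \<open>l\<close>.\<close>
    have cn: "c ?n \<noteq> 0"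
    proof
      assume 0: "c ?n = 0"
      have "lincomb N c l = 0\<^sub>m N N" using e 0 by (intro eq_matI) (simp_all add: lincomb_def)
      then have "\<forall>k<?n. c k = 0" using ls(2) by (auto simp: lin_indep_def)
      then show False using c(2,3) 0 by (auto simp: less_Suc_eq)
    qed
    have "X = lincomb N (\<lambda>j. - c j / c ?n) l"
    proof (rule eq_matI)
      fix i i' assume "i < dim_row (lincomb N (\<lambda>j. - c j / c ?n) l)" "i' < dim_col (lincomb N (\<lambda>j. - c j / c ?n) l)"
      then have ii: "i < N" "i' < N" by (auto simp: lincomb_def)
      have "(\<Sum>j<?n. - c j / c ?n * (l ! j) $$ (i,i')) = - (\<Sum>j<?n. c j * (l ! j) $$ (i,i')) / c ?n"
        by (simp add: sum_divide_distrib sum_negf)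
      also have "\<dots> = X $$ (i,i')" using e[OF ii] cn by (simp add: field_simps add_eq_0_iff)
      finally show "X $$ (i,i') = lincomb N (\<lambda>j. - c j / c ?n) l $$ (i,i')" using ii by (simp add: lincomb_def)
    qed (use Xd in \<open>simp_all add: lincomb_def\<close>)
    then show ?thesis by blast
  qed
qed

lemma cspan_maximal:
  assumes S: "S \<subseteq> carrier_mat N N" and mx: "max_lin_indep_subset N S l" and r: "r \<in> cspan N S"
  shows "\<exists>d. r = lincomb N d l"
proof -
  obtain c h where h: "r = lincomb N c h" "set h \<subseteq> S" using r by (auto simp: cspan_def)
  have "\<forall>k<length h. \<exists>d. h ! k = lincomb N d l"
    using maximal_spans[OF S mx] h(2) nth_mem by blast
  then obtain d where d: "\<And>k. k < length h \<Longrightarrow> h ! k = lincomb N (d k) l" by metis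
  have "r = lincomb N (\<lambda>j. \<Sum>k<length h. c k * d k j) l"
  proof (rule eq_matI)
    fix i i' assume "i < dim_row (lincomb N (\<lambda>j. \<Sum>k<length h. c k * d k j) l)"
      "i' < dim_col (lincomb N (\<lambda>j. \<Sum>k<length h. c k * d k j) l)"
    then have ii: "i < N" "i' < N" by (auto simp: lincomb_def)
    have "r $$ (i,i') = (\<Sum>k<length h. c k * (\<Sum>j<length l. d k j * (l ! j) $$ (i,i')))"
      using ii d by (simp add: h(1) lincomb_def)
    also have "\<dots> = (\<Sum>j<length l. (\<Sum>k<length h. c k * d k j) * (l ! j) $$ (i,i'))"
      by (simp add: sum_distrib_left sum_distrib_right mult.assoc) (rule sum.swap)
    finally show "r $$ (i,i') = lincomb N (\<lambda>j. \<Sum>k<length h. c k * d k j) l $$ (i,i')"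
      using ii by (simp add: lincomb_def)
  qed (simp_all add: h(1) lincomb_def)
  then show ?thesis by blast
qed

theorem theorem3p1:
  fixes dS dE :: nat and \<S> :: "complex mat set" and \<rho> :: "complex mat list"
  defines "m \<equiv> length \<rho>"
  defines "V \<equiv> cspan (dS * dE) \<S>"
  defines "VS \<equiv> cspan dS (set (map (ptrace_E dS dE) \<rho>))"
  assumes "\<S> \<noteq> {}"
    and "\<S> \<subseteq> density (dS * dE)"
    and "max_lin_indep_subset (dS * dE) \<S> \<rho>"
    and "lin_indep dS (map (ptrace_E dS dE) \<rho>)"
    and "\<exists>\<Lambda>P. lin_map dS (dS * dE) \<Lambda>P \<and> trace_pres dS \<Lambda>P \<and> positive_map dS (dS * dE) \<Lambda>P \<and>
           (\<forall>i<m. \<Lambda>P (ptrace_E dS dE (\<rho> ! i)) = \<rho> ! i)"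
  shows "markov_state m dS dE (omega_RSE dS dE \<rho>) \<and>
    (\<exists>\<Lambda>CP. lin_map dS (dS * dE) \<Lambda>CP \<and> trace_pres dS \<Lambda>CP \<and> cp_map dS (dS * dE) \<Lambda>CP \<and>
       (\<forall>i<m. \<Lambda>CP (ptrace_E dS dE (\<rho> ! i)) = \<rho> ! i) \<and>
       (\<forall>U. unitary_mat (dS * dE) U \<longrightarrow>
          (let \<E> = (\<lambda>X. ptrace_E dS dE (U * \<Lambda>CP X * mat_adjoint U)) in
             cp_map dS dS \<E> \<and>
             (\<forall>r\<in>density (dS * dE) \<inter> V.
                \<E> (ptrace_E dS dE r) = ptrace_E dS dE (U * r * mat_adjoint U))))) \<and>
    ptrace_E dS dE ` (density (dS * dE) \<inter> V) = density dS \<inter> VS"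
proof -
  let ?N = "dS * dE"
  obtain \<Lambda> where \<Lambda>: "lin_map dS ?N \<Lambda>" "trace_pres dS \<Lambda>" "positive_map dS ?N \<Lambda>"
    and \<Lambda>fix: "\<And>i. i < m \<Longrightarrow> \<Lambda> (ptrace_E dS dE (\<rho> ! i)) = \<rho> ! i"
    using assms(8) by blast
  have Sc: "\<S> \<subseteq> carrier_mat ?N ?N" using assms(5) density_carrier by blast
  have \<rho>S: "set \<rho> \<subseteq> \<S>" using assms(6) by (simp add: max_lin_indep_subset_def)
  have \<rho>dens: "set \<rho> \<subseteq> density ?N" using \<rho>S assms(5) by blast
  have \<rho>c: "set \<rho> \<subseteq> carrier_mat ?N ?N" using \<rho>S Sc by blast
  have \<rho>i: "psd ?N (\<rho> ! i)" "mtrace (\<rho> ! i) = 1" "\<rho> ! i \<in> carrier_mat ?N ?N" if "i < m" for i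
  proof -
    have "\<rho> ! i \<in> density ?N" using \<rho>dens that nth_mem unfolding m_def by blast
    then show "psd ?N (\<rho> ! i)" "mtrace (\<rho> ! i) = 1" "\<rho> ! i \<in> carrier_mat ?N ?N"
      using density_carrier by (simp_all add: density_def)
  qed
  \<comment> \<open>Any state will do: it is the output of \<open>recovery\<close> on the complement
    of the support of \<sigma>.\<close>
  obtain \<tau> where \<tau>: "\<tau> \<in> density ?N" using assms(4,5) by blast
  have \<tau>': "psd ?N \<tau>" "\<tau> \<in> carrier_mat ?N ?N" "mtrace \<tau> = 1"
    using \<tau> density_carrier[OF \<tau>] by (simp_all add: density_def)
  \<comment> \<open>Needed for states to exist on every right factor tensored with E, including
    blocks of weight zero.\<close>
  have dE: "dE > 0"
  proof (rule ccontr)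
    assume "\<not> dE > 0"
    then have "mtrace \<tau> = 0" using \<tau>'(2) by (simp add: mtrace_def)
    then show False using \<tau>'(3) by simp
  qed
  \<comment> \<open>The empty list spans only the zero matrix, whose trace is not 1.\<close>
  have \<rho>ne: "\<rho> \<noteq> []"
  proof
    assume "\<rho> = []"
    then have "\<tau> = 0\<^sub>m ?N ?N" if "\<tau> \<in> \<S>" for \<tau>
      using maximal_spans[OF Sc assms(6) that] by (auto simp: lincomb_def)
    moreover obtain \<tau> where "\<tau> \<in> \<S>" using assms(4) by blast
    ultimately have "mtrace (0\<^sub>m ?N ?N) = 1" using assms(5) by (auto simp: density_def)
    then show False by simp
  qed
  define \<Sigma> where "\<Sigma> = msum ?N m (\<lambda>i. \<rho> ! i)"
  define \<sigma> where "\<sigma> = ptrace_E dS dE \<Sigma>"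
  have \<Sigma>: "psd ?N \<Sigma>" unfolding \<Sigma>_def using \<rho>i by (intro psd_msum)
  have \<sigma>: "psd dS \<sigma>" unfolding \<sigma>_def by (rule psd_ptrace[OF \<Sigma>])
  have \<sigma>m: "\<sigma> = msum dS m (\<lambda>i. ptrace_E dS dE (\<rho> ! i))"
    unfolding \<sigma>_def \<Sigma>_def using \<rho>i by (intro lin_map_msum[OF ptrace_lin_map])
  have "\<Lambda> \<sigma> = msum ?N m (\<lambda>i. \<Lambda> (ptrace_E dS dE (\<rho> ! i)))"
    unfolding \<sigma>m by (intro lin_map_msum[OF \<Lambda>(1)]) simp
  also have "\<dots> = \<Sigma>" unfolding \<Sigma>_def by (intro msum_cong \<Lambda>fix)
  finally have \<Lambda>\<sigma>: "\<Lambda> \<sigma> = \<Sigma>" .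
  \<comment> \<open>The difference is the sum of the remaining states; replacing the i-th term by
    zero keeps the index range.\<close>
  have dom: "dominated ?N \<Sigma> (\<rho> ! i)" if i: "i < m" for i
  proof -
    have "\<Sigma> - \<rho> ! i = msum ?N m (\<lambda>k. if k = i then 0\<^sub>m ?N ?N else \<rho> ! k)"
    proof (rule eq_matI)
      fix a b assume "a < dim_row (msum ?N m (\<lambda>k. if k = i then 0\<^sub>m ?N ?N else \<rho> ! k))"
        "b < dim_col (msum ?N m (\<lambda>k. if k = i then 0\<^sub>m ?N ?N else \<rho> ! k))"
      then have ab: "a < ?N" "b < ?N" by auto
      have "(\<Sum>k<m. (\<rho> ! k) $$ (a,b)) - (\<rho> ! i) $$ (a,b) = (\<Sum>k\<in>{..<m} - {i}. (\<rho> ! k) $$ (a,b))"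
        using i by (simp add: sum_diff1)
      also have "\<dots> = (\<Sum>k\<in>{..<m} - {i}. (if k = i then 0\<^sub>m ?N ?N else \<rho> ! k) $$ (a,b))"
        by (intro sum.cong) auto
      also have "\<dots> = (\<Sum>k<m. (if k = i then 0\<^sub>m ?N ?N else \<rho> ! k) $$ (a,b))"
        using i ab by (intro sum.mono_neutral_left) auto
      finally show "(\<Sigma> - \<rho> ! i) $$ (a,b) = msum ?N m (\<lambda>k. if k = i then 0\<^sub>m ?N ?N else \<rho> ! k) $$ (a,b)"
        using \<rho>i(3)[OF i] ab by (simp add: \<Sigma>_def msum_def)
    qed (use \<rho>i(3)[OF i] in simp_all)
    moreover have "psd ?N (msum ?N m (\<lambda>k. if k = i then 0\<^sub>m ?N ?N else \<rho> ! k))"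
      using \<rho>i psd_zero by (intro psd_msum) simp
    ultimately show ?thesis using \<rho>i(1)[OF i] by (simp add: dominated_def)
  qed
  obtain s t P r where "psd_sqrt dS \<sigma> s t P r" using psd_sqrt_exists[OF \<sigma>] by blast
  moreover obtain z u Q q where "psd_sqrt ?N \<Sigma> z u Q q" using psd_sqrt_exists[OF \<Sigma>] by blast
  ultimately interpret petz dS dE \<sigma> s t P r \<Sigma> z u Q q
    by (intro petz.intro petz_axioms.intro) (simp_all add: \<sigma>_def)
  have rec: "petz_map (ptrace_E dS dE (\<rho> ! i)) = \<rho> ! i" if "i < m" for i
    by (rule petz_recovery[OF \<Lambda> \<Lambda>\<sigma> \<Lambda>fix[OF that] dom[OF that]])
  obtain K a b W where "blocks dS alg K a b W"
    using star_algebra_structure[OF alg_star_algebra] by blast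
  then interpret B: normalized_blocks dS dE \<Sigma> alg K a b W
    using alg_star_algebra \<Sigma> alg_normalizes by unfold_locales
  have markov: "markov_state m dS dE (omega_RSE dS dE \<rho>)"
    unfolding m_def using recovered_factor[OF rec] dE
    by (intro B.markov[OF \<rho>ne \<rho>dens]) (auto simp: m_def)
  define \<Lambda>C where "\<Lambda>C = recovery \<tau>"
  have C: "lin_map dS ?N \<Lambda>C" "trace_pres dS \<Lambda>C" "cp_map dS ?N \<Lambda>C"
    unfolding \<Lambda>C_def by (rule recovery_lin_map[OF \<tau>'(2)] recovery_trace_pres[OF \<tau>] recovery_cp[OF \<tau>'(1)])+
  have Cfix: "\<Lambda>C (ptrace_E dS dE (\<rho> ! i)) = \<rho> ! i" if "i < m" for i
    unfolding \<Lambda>C_def by (rule recovery_fixed[OF \<tau>'(2) dom[OF that] rec[OF that]])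
  have pc: "set (map (ptrace_E dS dE) \<rho>) \<subseteq> carrier_mat dS dS" by auto
  have VD: "\<exists>d. r = lincomb ?N d \<rho> \<and> ptrace_E dS dE r = lincomb dS d (map (ptrace_E dS dE) \<rho>)" if "r \<in> V" for r
    using cspan_maximal[OF Sc assms(6), of r] that lin_map_lincomb[OF ptrace_lin_map \<rho>c] unfolding V_def by blast
  \<comment> \<open>Recovery of the basis states extends to the whole span, because r and its
    marginal have the same coefficients.\<close>
  have CV: "\<Lambda>C (ptrace_E dS dE r) = r" if rV: "r \<in> V" for r
  proof -
    obtain d where d: "r = lincomb ?N d \<rho>" "ptrace_E dS dE r = lincomb dS d (map (ptrace_E dS dE) \<rho>)"
      using VD[OF rV] by blast
    have "map \<Lambda>C (map (ptrace_E dS dE) \<rho>) = \<rho>"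
      using Cfix by (intro nth_equalityI) (simp_all add: m_def)
    then have "\<Lambda>C (ptrace_E dS dE r) = lincomb ?N d \<rho>"
      unfolding d(2) lin_map_lincomb[OF C(1) pc] by simp
    with d(1) show ?thesis by simp
  qed
  have unitary: "\<forall>U. unitary_mat ?N U \<longrightarrow>
      (let \<E> = (\<lambda>X. ptrace_E dS dE (U * \<Lambda>C X * mat_adjoint U)) in
         cp_map dS dS \<E> \<and>
         (\<forall>r\<in>density ?N \<inter> V. \<E> (ptrace_E dS dE r) = ptrace_E dS dE (U * r * mat_adjoint U)))"
  proof (intro allI impI)
    fix U assume "unitary_mat ?N U"
    then have U: "U \<in> carrier_mat ?N ?N" by (simp add: unitary_mat_def)
    have UC: "cp_map dS ?N (\<lambda>X. U * \<Lambda>C X * mat_adjoint U)"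
      by (rule cp_map_comp[OF C(3) cp_map_conj[OF U] lin_mapD(1)[OF C(1)]])
    have "cp_map dS dS (\<lambda>X. ptrace_E dS dE (U * \<Lambda>C X * mat_adjoint U))"
    proof (rule cp_map_comp[OF UC cp_map_ptrace])
      show "U * \<Lambda>C X * mat_adjoint U \<in> carrier_mat ?N ?N" for X
        using U by (intro carrier_matI) auto
    qed
    then show "let \<E> = (\<lambda>X. ptrace_E dS dE (U * \<Lambda>C X * mat_adjoint U)) in
         cp_map dS dS \<E> \<and>
         (\<forall>r\<in>density ?N \<inter> V. \<E> (ptrace_E dS dE r) = ptrace_E dS dE (U * r * mat_adjoint U))"
      by (simp add: Let_def CV)
  qed
  have image: "ptrace_E dS dE ` (density ?N \<inter> V) = density dS \<inter> VS"
  proof (intro equalityI subsetI)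
    fix y assume "y \<in> ptrace_E dS dE ` (density ?N \<inter> V)"
    then obtain r where r: "r \<in> density ?N" "r \<in> V" "y = ptrace_E dS dE r" by blast
    have "y \<in> density dS"
      using r psd_ptrace[of dS dE r] mtrace_ptrace[OF density_carrier[OF r(1)]] by (simp add: density_def)
    moreover have "y \<in> VS" using VD[OF r(2)] unfolding VS_def cspan_def r(3) by blast
    ultimately show "y \<in> density dS \<inter> VS" by blast
  next
    \<comment> \<open>The given positive lift itself provides the preimage: it sends a state in the
      reduced span to a state in the full span whose marginal is y.\<close>
    fix y assume y: "y \<in> density dS \<inter> VS"
    then obtain c l where l: "y = lincomb dS c l" "set l \<subseteq> set (map (ptrace_E dS dE) \<rho>)"
      by (auto simp: VS_def cspan_def)
    have lc: "set l \<subseteq> carrier_mat dS dS" using l(2) pc by blast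
    have \<Lambda>l: "\<Lambda> x \<in> set \<rho> \<and> ptrace_E dS dE (\<Lambda> x) = x" if "x \<in> set l" for x
    proof -
      have "x \<in> ptrace_E dS dE ` set \<rho>" using that l(2) by auto
      then obtain i where "i < m" "x = ptrace_E dS dE (\<rho> ! i)" by (auto simp: m_def in_set_conv_nth)
      then show ?thesis using \<Lambda>fix by (simp add: m_def)
    qed
    have e: "\<Lambda> y = lincomb ?N c (map \<Lambda> l)" unfolding l(1) by (rule lin_map_lincomb[OF \<Lambda>(1) lc])
    have "set (map \<Lambda> l) \<subseteq> \<S>" using \<Lambda>l \<rho>S by auto
    then have yV: "\<Lambda> y \<in> V" unfolding e V_def cspan_def by blast
    have "set (map \<Lambda> l) \<subseteq> carrier_mat ?N ?N" using \<Lambda>l \<rho>c by auto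
    then have "ptrace_E dS dE (\<Lambda> y) = lincomb dS c (map (ptrace_E dS dE) (map \<Lambda> l))"
      unfolding e by (rule lin_map_lincomb[OF ptrace_lin_map])
    also have "map (ptrace_E dS dE) (map \<Lambda> l) = l" using \<Lambda>l by (simp add: map_idI)
    finally have py: "ptrace_E dS dE (\<Lambda> y) = y" unfolding l(1) .
    have "\<Lambda> y \<in> density ?N"
      using y \<Lambda>(2,3) psd_carrier by (auto simp: density_def positive_map_def trace_pres_def)
    then show "y \<in> ptrace_E dS dE ` (density ?N \<inter> V)" using yV py by (metis IntI imageI)
  qed
  show ?thesis using markov C Cfix unitary image by blast
qed

end
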